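(* Let $\alpha\in(0,1]$, $\lambda>0$, $K\ge 1$ an integer, and $p_1,\dots,p_K>0$ with $p_1+\dots+p_K=1$. Let $N_1,\dots,N_K$ be Poisson processes of rate $\lambda^\alpha$ and $Y_\alpha$ the inverse of a standard $\alpha$-stable subordinator, all $K+1$ processes being mutually independent. For $i=1,\dots,K$ and $u>0$ define $$M_u^{(i)}(t)=\frac{N_i(p_iY_\alpha(ut))-p_i\lambda^\alpha Y_\alpha(ut)}{u^{\alpha/2}},\qquad t\ge 0.$$ Let $B_1,\dots,B_K$ be independent standard Brownian motions, independent of $Y_\alpha$. Then, as $u\to\infty$, we have the weak convergence $$(M_u^{(1)},\dots,M_u^{(K)})\stackrel{d}{\longrightarrow}\big\{\big(B_1(p_1\lambda^\alpha Y_\alpha(t)),\dots,B_K(p_K\lambda^\alpha Y_\alpha(t))\big)\big\}_{t\ge 0}$$ in the space $D([0,\infty),\mathbb{R}^K)$ of càdlàg functions equipped with the Skorokhod topology $J_1$.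
   Context: Inverse stable subordinator: a standard $\theta$-stable subordinator $L_\theta$, $\theta\in(0,1]$, is a nondecreasing Lévy process with $\mathbb{E}(e^{-tL_\theta(s)})=e^{-st^\theta}$ for $s,t\ge 0$ (so $L_1(s)=s$). Its inverse is $Y_\theta(t)=\inf\{s>0:L_\theta(s)>t\}$, $t\ge 0$ (so $Y_1(t)=t$). *)

theory Defs
  imports "HOL-Probability.Probability"
begin

section \<open>The Skorokhod space D([0,\<infinity>)) with the J1 topology\<close>

definition cadlag :: "(real \<Rightarrow> 'b::topological_space) \<Rightarrow> bool" where
  "cadlag x \<longleftrightarrow>
     (\<forall>t\<ge>0. (x \<longlongrightarrow> x t) (at_right t)) \<and>
     (\<forall>t>0. \<exists>l. (x \<longlongrightarrow> l) (at_left t))"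

text \<open>Functions on the half-line are represented by their extension with the dummy value
  \<^const>\<open>undefined\<close> to the negative reals.\<close>

definition skorokhod_space :: "(real \<Rightarrow> 'b::topological_space) set" where
  "skorokhod_space = {x \<in> extensional {0..}. cadlag x}"

definition time_changes :: "(real \<Rightarrow> real) set" where
  "time_changes =
     {l. strict_mono_on {0..} l \<and> continuous_on {0..} l \<and> l ` {0..} = {0..}}"

definition J1_nbhd :: "(real \<Rightarrow> 'b::metric_space) \<Rightarrow> real \<Rightarrow> real \<Rightarrow> (real \<Rightarrow> 'b) set" where
  "J1_nbhd x T e =
     {y \<in> skorokhod_space. \<exists>l\<in>time_changes.
        (\<forall>s\<ge>0. \<bar>l s - s\<bar> < e) \<and> (\<forall>s\<in>{0..T}. dist (y (l s)) (x s) < e)}"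

text \<open>The sets \<^term>\<open>J1_nbhd x T e\<close> form a base of the neighbourhoods of \<^term>\<open>x\<close>. Hence
  \<open>x\<^sub>n\<close> tends to \<open>x\<close> iff there are time changes \<open>l\<^sub>n\<close> such that \<open>l\<^sub>n\<close> tends to the identity
  uniformly on the half-line and \<open>x\<^sub>n \<circ> l\<^sub>n\<close> tends to \<open>x\<close> uniformly on every \<open>[0,T]\<close>. This is
  the usual description of the (metrizable) J1 topology on the half-line, e.g. Jacod and
  Shiryaev, Limit Theorems for Stochastic Processes, Theorem VI.1.14.\<close>

definition skorokhod_J1 :: "(real \<Rightarrow> 'b::metric_space) topology" where
  "skorokhod_J1 =
     topology (\<lambda>U. U \<subseteq> skorokhod_space \<and> (\<forall>x\<in>U. \<exists>T>0. \<exists>e>0. J1_nbhd x T e \<subseteq> U))"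

lemma J1_nbhd_mono:
  assumes "T \<le> T'" "e' \<le> e"
  shows "J1_nbhd x T' e' \<subseteq> J1_nbhd x T e"
proof
  fix y assume "y \<in> J1_nbhd x T' e'"
  then obtain l where l: "y \<in> skorokhod_space" "l \<in> time_changes"
    "\<And>s. s \<ge> 0 \<Longrightarrow> \<bar>l s - s\<bar> < e'" "\<And>s. s \<in> {0..T'} \<Longrightarrow> dist (y (l s)) (x s) < e'"
    unfolding J1_nbhd_def by blast
  have "\<bar>l s - s\<bar> < e" if "s \<ge> 0" for s
    using l(3)[OF that] assms(2) by linarith
  moreover have "dist (y (l s)) (x s) < e" if "s \<in> {0..T}" for s
  proof -
    have "s \<in> {0..T'}" using that assms(1) by auto
    then show ?thesis using l(4)[of s] assms(2) by linarith
  qed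
  ultimately show "y \<in> J1_nbhd x T e"
    unfolding J1_nbhd_def using l(1,2) by blast
qed

lemma openin_skorokhod_J1:
  fixes U :: "(real \<Rightarrow> 'b::metric_space) set"
  shows "openin skorokhod_J1 U \<longleftrightarrow>
     U \<subseteq> skorokhod_space \<and> (\<forall>x\<in>U. \<exists>T>0. \<exists>e>0. J1_nbhd x T e \<subseteq> U)"
proof -
  let ?P = "\<lambda>U :: (real \<Rightarrow> 'b) set. U \<subseteq> skorokhod_space \<and> (\<forall>x\<in>U. \<exists>T>0. \<exists>e>0. J1_nbhd x T e \<subseteq> U)"
  have "istopology ?P"
    unfolding istopology_def
  proof (intro conjI allI impI)
    fix S S' :: "(real \<Rightarrow> 'b) set" assume S: "?P S" and S': "?P S'"
    show "S \<inter> S' \<subseteq> skorokhod_space" using S by blast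
    show "\<forall>x\<in>S \<inter> S'. \<exists>T>0. \<exists>e>0. J1_nbhd x T e \<subseteq> S \<inter> S'"
    proof
      fix x assume "x \<in> S \<inter> S'"
      then obtain T e T' e' where *: "T > 0" "e > 0" "J1_nbhd x T e \<subseteq> S"
        "T' > 0" "e' > 0" "J1_nbhd x T' e' \<subseteq> S'"
        using S S' by blast
      have "J1_nbhd x (max T T') (min e e') \<subseteq> S \<inter> S'"
        using * J1_nbhd_mono[of T "max T T'" "min e e'" e x]
          J1_nbhd_mono[of T' "max T T'" "min e e'" e' x] by auto
      moreover have "max T T' > 0" "min e e' > 0" using * by auto
      ultimately show "\<exists>T>0. \<exists>e>0. J1_nbhd x T e \<subseteq> S \<inter> S'" by blast
    qed
  next
    fix \<K> :: "(real \<Rightarrow> 'b) set set" assume K: "\<forall>U\<in>\<K>. ?P U"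
    show "\<Union>\<K> \<subseteq> skorokhod_space" using K by blast
    show "\<forall>x\<in>\<Union>\<K>. \<exists>T>0. \<exists>e>0. J1_nbhd x T e \<subseteq> \<Union>\<K>"
    proof
      fix x assume "x \<in> \<Union>\<K>"
      then obtain U where U: "U \<in> \<K>" "x \<in> U" by blast
      then obtain T e where "T > 0" "e > 0" "J1_nbhd x T e \<subseteq> U" using K by blast
      then show "\<exists>T>0. \<exists>e>0. J1_nbhd x T e \<subseteq> \<Union>\<K>" using U(1) by blast
    qed
  qed
  then show ?thesis
    unfolding skorokhod_J1_def by (subst topology_inverse'[OF \<open>istopology ?P\<close>]) (rule refl)
qed

lemma topspace_skorokhod_J1:
  "topspace skorokhod_J1 = (skorokhod_space :: (real \<Rightarrow> 'b::metric_space) set)"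
proof -
  have "openin skorokhod_J1 (skorokhod_space :: (real \<Rightarrow> 'b) set)"
    unfolding openin_skorokhod_J1 J1_nbhd_def by (auto intro!: exI[of _ "1::real"])
  then show ?thesis
    by (metis openin_skorokhod_J1 openin_subset openin_topspace subset_antisym)
qed

section \<open>Weak convergence\<close>

definition borel_of :: "'b topology \<Rightarrow> 'b measure" where
  "borel_of S = sigma (topspace S) {U. openin S U}"

definition weakly_converges ::
    "'b topology \<Rightarrow> ('i \<Rightarrow> 'b measure) \<Rightarrow> 'b measure \<Rightarrow> 'i filter \<Rightarrow> bool" where
  "weakly_converges S \<mu> \<nu> F \<longleftrightarrow>
     (\<forall>f. continuous_map S euclideanreal f \<and> bounded (f ` topspace S) \<longrightarrow>
        ((\<lambda>i. integral\<^sup>L (\<mu> i) f) \<longlongrightarrow> integral\<^sup>L \<nu> f) F)"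

text \<open>Path properties of the processes below are only required almost surely, so the path of a
  process may fail to belong to D on a null set. The process is identified with any
  Borel measurable D-valued random element that almost surely coincides with its path; the law of
  such an element does not depend on the choice.\<close>

definition path_element ::
    "'a measure \<Rightarrow> (real \<Rightarrow> 'a \<Rightarrow> 'b::metric_space) \<Rightarrow> ('a \<Rightarrow> real \<Rightarrow> 'b) \<Rightarrow> bool" where
  "path_element M X Z \<longleftrightarrow>
     Z \<in> M \<rightarrow>\<^sub>M borel_of skorokhod_J1 \<and>
     (AE \<omega> in M. Z \<omega> = (\<lambda>t\<in>{0..}. X t \<omega>))"

definition converges_in_distribution_J1 ::
    "'a measure \<Rightarrow> ('i \<Rightarrow> real \<Rightarrow> 'a \<Rightarrow> 'b::metric_space) \<Rightarrow> (real \<Rightarrow> 'a \<Rightarrow> 'b) \<Rightarrow> 'i filter \<Rightarrow> bool"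
  where
  "converges_in_distribution_J1 M X X\<^sub>0 F \<longleftrightarrow>
     (\<exists>Z Z\<^sub>0. (\<forall>\<^sub>F i in F. path_element M (X i) (Z i)) \<and> path_element M X\<^sub>0 Z\<^sub>0 \<and>
        weakly_converges skorokhod_J1
          (\<lambda>i. distr M (borel_of skorokhod_J1) (Z i)) (distr M (borel_of skorokhod_J1) Z\<^sub>0) F)"

section \<open>Processes\<close>

text \<open>Processes are indexed by nonnegative times; their values at negative times are
  irrelevant.\<close>

definition independent_processes ::
    "'a measure \<Rightarrow> ('j \<Rightarrow> real \<Rightarrow> 'a \<Rightarrow> real) \<Rightarrow> bool" where
  "independent_processes M X \<longleftrightarrow>
     prob_space.indep_vars M (\<lambda>_. PiM {0..} (\<lambda>_. borel)) (\<lambda>j \<omega>. \<lambda>t\<in>{0..}. X j t \<omega>) UNIV"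

text \<open>Stochastic continuity follows from stationarity of the increments and right-continuity
  of the paths.\<close>

definition levy_process :: "'a measure \<Rightarrow> (real \<Rightarrow> 'a \<Rightarrow> real) \<Rightarrow> bool" where
  "levy_process M X \<longleftrightarrow>
     (\<forall>t\<ge>0. X t \<in> borel_measurable M) \<and>
     (AE \<omega> in M. X 0 \<omega> = 0) \<and>
     (\<forall>(t::nat \<Rightarrow> real) n. 0 \<le> t 0 \<and> mono t \<longrightarrow>
        prob_space.indep_vars M (\<lambda>_. borel) (\<lambda>k \<omega>. X (t (Suc k)) \<omega> - X (t k) \<omega>) {..<n}) \<and>
     (\<forall>s\<ge>0. \<forall>h\<ge>0. distr M borel (\<lambda>\<omega>. X (s + h) \<omega> - X s \<omega>) = distr M borel (X h)) \<and>
     (AE \<omega> in M. cadlag (\<lambda>t. X t \<omega>))"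

definition poisson_process :: "'a measure \<Rightarrow> real \<Rightarrow> (real \<Rightarrow> 'a \<Rightarrow> nat) \<Rightarrow> bool" where
  "poisson_process M r N \<longleftrightarrow>
     levy_process M (\<lambda>t \<omega>. real (N t \<omega>)) \<and>
     (\<forall>t>0. distr M (count_space UNIV) (N t) = measure_pmf (poisson_pmf (r * t)))"

definition standard_brownian_motion :: "'a measure \<Rightarrow> (real \<Rightarrow> 'a \<Rightarrow> real) \<Rightarrow> bool" where
  "standard_brownian_motion M B \<longleftrightarrow>
     levy_process M B \<and>
     (\<forall>t>0. distributed M lborel (B t) (\<lambda>x. ennreal (normal_density 0 (sqrt t) x))) \<and>
     (AE \<omega> in M. continuous_on {0..} (\<lambda>t. B t \<omega>))"

definition standard_stable_subordinator ::
    "'a measure \<Rightarrow> real \<Rightarrow> (real \<Rightarrow> 'a \<Rightarrow> real) \<Rightarrow> bool" where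
  "standard_stable_subordinator M \<theta> L \<longleftrightarrow>
     levy_process M L \<and>
     (AE \<omega> in M. mono_on {0..} (\<lambda>s. L s \<omega>)) \<and>
     (\<forall>s\<ge>0. \<forall>t\<ge>0. (\<integral>\<omega>. exp (- t * L s \<omega>) \<partial>M) = exp (- s * t powr \<theta>))"

definition inverse_stable_subordinator ::
    "'a measure \<Rightarrow> real \<Rightarrow> (real \<Rightarrow> 'a \<Rightarrow> real) \<Rightarrow> bool" where
  "inverse_stable_subordinator M \<theta> Y \<longleftrightarrow>
     (\<exists>L. standard_stable_subordinator M \<theta> L \<and>
        (\<forall>t\<ge>0. \<forall>\<omega>\<in>space M. Y t \<omega> = Inf {s. 0 < s \<and> t < L s \<omega>}))"

end

theory Submission
  imports Defs
begin

text \<open>Put \<open>c = u powr \<alpha>\<close> and \<open>\<mu> = lam powr \<alpha>\<close>. The stable subordinator is self-similar, so \<open>Y (u * t)\<close> and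
  \<open>c * Y t\<close> have the same law as processes in \<open>t\<close>. Since \<open>Y\<close> is independent of the Poisson processes, Fubini's
  theorem reduces the claim to a fixed nondecreasing right-continuous path \<open>y\<close> in place of \<open>Y\<close>: the compensated
  Poisson processes \<open>V i s = (N i (c * s) - \<mu> * c * s) / sqrt c\<close>, evaluated at \<open>p i * y t\<close>, have to converge to
  Brownian motions at the same times. For fixed \<open>y\<close>, a J1-continuous function of the composed path is
  continuous in \<open>V\<close> for locally uniform convergence (continuity of \<open>Y\<close> plays no role). So it suffices to
  compare \<open>V\<close> with its values on a grid. On the grid the independent increments converge by Levy's
  continuity theorem, and Skorohod's theorem for each increment gives a coupling on a product space. Between
  grid points Ottaviani's inequality and a Chernoff bound control the oscillation. Lipschitz envelopes of the
  test function make this comparison possible without uniform continuity.\<close>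

section \<open>Time changes, step paths and J1-measurability\<close>

text \<open>Freezing the clock leaves a bounded function \<open>g\<close> of the Poisson paths
  alone, continuous for locally uniform convergence. With \<open>C\<close> bounding \<open>g\<close>
  and \<open>env\<close> its \<open>k\<close>-Lipschitz envelope, g(V) >= env(V) >= env(skeleton of
  V) - k * oscillation holds off a bad event, and the expectation over that event costs at most 2 C
  times its probability. The skeleton term converges by the central limit theorem for finitely many
  increments. Applying this to \<open>-g\<close> gives the other inequality. The bad event is a
  union over about \<open>m * k\<close> cells of length \<open>1/m\<close> in each coordinate.
  Chebyshev's inequality gives every cell a probability of order \<open>1/m\<close>, so the union
  would not become small; a bound of order exp(- const * sqrt m) beats the number of cells. The
  jumps have size \<open>1 / sqrt c\<close>, and the exponential bound is available once
  \<open>c >= m\<close>. Hence the order of choices: \<open>k\<close>, the size of the oscillation,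
  \<open>m\<close>, and \<open>n\<close> last. Self-similarity is applied after the expectation over
  the Poisson processes has been taken: what remains is a function of the clock, so equality in law
  is enough, and \<open>Y (u * t)\<close> can be traded for \<open>c * Y t\<close> with one
  \<open>Y\<close> for all \<open>u\<close>.\<close>

lemma time_changes_comp:
  assumes "l \<in> time_changes" "k \<in> time_changes"
  shows "l \<circ> k \<in> time_changes"
proof -
  have l: "strict_mono_on {0..} l" "continuous_on {0..} l" "l ` {0..} = {0..}"
    and k: "strict_mono_on {0..} k" "continuous_on {0..} k" "k ` {0..} = {0..}"
    using assms by (auto simp: time_changes_def)
  have "continuous_on {0..} (l \<circ> k)" using k l by (metis continuous_on_compose)
  moreover have "(l \<circ> k) ` {0..} = {0..}" using k(3) l(3) by (metis image_comp)
  moreover have "strict_mono_on {0..} (l \<circ> k)"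
  proof (rule strict_mono_onI)
    fix r s :: real assume *: "r \<in> {0..}" "s \<in> {0..}" "r < s"
    then have "k r \<in> {0..}" "k s \<in> {0..}" "k r < k s" using k by (auto simp: strict_mono_on_def)
    then show "(l \<circ> k) r < (l \<circ> k) s" using l(1) by (auto simp: strict_mono_on_def)
  qed
  ultimately show ?thesis by (auto simp: time_changes_def)
qed

lemma time_changes_nonneg: "l \<in> time_changes \<Longrightarrow> s \<ge> 0 \<Longrightarrow> l s \<ge> 0"
  unfolding time_changes_def by auto

lemma time_changes_less: "l \<in> time_changes \<Longrightarrow> 0 \<le> s \<Longrightarrow> s < t \<Longrightarrow> l s < l t"
  unfolding time_changes_def strict_mono_on_def by auto

lemma time_changes_le: "l \<in> time_changes \<Longrightarrow> 0 \<le> s \<Longrightarrow> s \<le> t \<Longrightarrow> l s \<le> l t"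
  using time_changes_less[of l s t] by (cases "s = t") auto

text \<open>The identity up to \<open>a\<close>, the translation by \<open>c\<close> from
  \<open>b\<close> on, linear in between.\<close>

definition hinge :: "real \<Rightarrow> real \<Rightarrow> real \<Rightarrow> real \<Rightarrow> real" where
  "hinge a b c y = y + c * max 0 (min 1 ((y - a) / (b - a)))"

text \<open>The slope on \<open>[a,b]\<close> is \<open>1 + c / (b - a)\<close>, which is positive
  exactly for \<open>c > - (b - a)\<close>; elsewhere the slope is 1.\<close>

lemma hinge_time_change:
  assumes "0 \<le> a" "a < b" "c > - (b - a)"
  shows "hinge a b c \<in> time_changes"
proof -
  define \<phi> where "\<phi> y = max 0 (min 1 ((y - a) / (b - a)))" for y
  have g: "hinge a b c y = y + c * \<phi> y" for y by (simp add: hinge_def \<phi>_def)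
  have phi: "0 \<le> \<phi> y" "\<phi> y \<le> 1" for y by (auto simp: \<phi>_def)
  have incr: "0 \<le> \<phi> t - \<phi> s \<and> (b - a) * (\<phi> t - \<phi> s) \<le> t - s" if "s < t" for s t
  proof -
    define p where "p = (s - a) / (b - a)"
    define q where "q = (t - a) / (b - a)"
    have pq: "p \<le> q" unfolding p_def q_def using that assms by (simp add: divide_right_mono)
    have "t - s = (b - a) * (q - p)" unfolding p_def q_def using assms by (simp add: diff_divide_distrib[symmetric])
    moreover have "\<phi> t - \<phi> s \<le> q - p" "0 \<le> \<phi> t - \<phi> s" unfolding \<phi>_def p_def[symmetric] q_def[symmetric] using pq by auto
    ultimately show ?thesis using assms by (simp add: mult_left_mono)
  qed
  have mono: "hinge a b c s < hinge a b c t" if "s < t" for s t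
  proof (cases "\<phi> t - \<phi> s = 0")
    case True then show ?thesis using that by (simp add: g)
  next
    case False
    then have pos: "\<phi> t - \<phi> s > 0" using incr[OF that] by auto
    have "- c * (\<phi> t - \<phi> s) < (b - a) * (\<phi> t - \<phi> s)" using pos assms(3) by (intro mult_strict_right_mono) auto
    then show ?thesis using incr[OF that] by (simp add: g algebra_simps)
  qed
  have cont: "continuous_on A (hinge a b c)" for A
    unfolding hinge_def using assms by (auto intro!: continuous_intros)
  have z: "hinge a b c 0 = 0" using assms by (simp add: hinge_def max_def min_def field_simps)
  have "hinge a b c ` {0..} = {0..}"
  proof (intro subset_antisym subsetI)
    fix y assume "y \<in> hinge a b c ` {0..}"
    then obtain x where x: "x \<ge> 0" "y = hinge a b c x" by auto
    show "y \<in> {0..}" using mono[of 0 x] x z by (cases "x = 0") auto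
  next
    fix y :: real assume y: "y \<in> {0..}"
    \<comment> \<open>Gives \<open>y \<le> hinge a b c (y + \<bar>c\<bar>)\<close>, the right
      endpoint for the intermediate value theorem behind surjectivity.\<close>
    have "- \<bar>c\<bar> \<le> c * \<phi> (y + \<bar>c\<bar>)"
      using phi[of "y + \<bar>c\<bar>"] by (smt (verit) mult_left_le mult_nonneg_nonneg mult_minus_left)
    then have "y \<le> hinge a b c (y + \<bar>c\<bar>)" by (simp add: g)
    then obtain x where "x \<ge> 0" "x \<le> y + \<bar>c\<bar>" "hinge a b c x = y"
      using IVT'[of "hinge a b c" 0 y "y + \<bar>c\<bar>"] z y cont by auto
    then show "y \<in> hinge a b c ` {0..}" by auto
  qed
  then show ?thesis unfolding time_changes_def using mono cont by (auto simp: strict_mono_on_def)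
qed

text \<open>One grid point is corrected at a time: an interpolation of the first \<open>n\<close>
  points that is a translation beyond \<open>t n\<close> is composed with a hinge starting at
  \<open>a n\<close>. The hinge moves points by at most the defect in length of the new cell, whence
  the sum. The last conjunct carries the induction.\<close>

lemma time_change_interpolation:
  fixes t a :: "nat \<Rightarrow> real"
  assumes "t 0 = 0" "a 0 = 0" "\<And>i. i < n \<Longrightarrow> t i < t (Suc i)" "\<And>i. i < n \<Longrightarrow> a i < a (Suc i)"
  shows "\<exists>l\<in>time_changes. (\<forall>i\<le>n. l (t i) = a i) \<and>
    (\<forall>s\<ge>0. \<bar>l s - s\<bar> \<le> (\<Sum>i<n. \<bar>(a (Suc i) - a i) - (t (Suc i) - t i)\<bar>)) \<and>
    (\<forall>s\<ge>t n. l s = s + (a n - t n))"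
  using assms
proof (induction n)
  case 0
  have "id \<in> time_changes" by (auto simp: time_changes_def strict_mono_on_def)
  then show ?case using 0 by (intro bexI[of _ id]) auto
next
  case (Suc n)
  then obtain l where l: "l \<in> time_changes" "\<And>i. i \<le> n \<Longrightarrow> l (t i) = a i"
    "\<And>s. s \<ge> 0 \<Longrightarrow> \<bar>l s - s\<bar> \<le> (\<Sum>i<n. \<bar>(a (Suc i) - a i) - (t (Suc i) - t i)\<bar>)"
    "\<And>s. s \<ge> t n \<Longrightarrow> l s = s + (a n - t n)"
    using Suc.IH[OF Suc.prems(1,2)] by auto
  have amono: "a i \<le> a j" if "i \<le> j" "j \<le> Suc n" for i j
    using that
  proof (induction rule: dec_induct)
    case (step k) then show ?case using Suc.prems(4)[of k] by auto
  qed auto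
  have tmono: "t i \<le> t j" if "i \<le> j" "j \<le> Suc n" for i j
    using that
  proof (induction rule: dec_induct)
    case (step k) then show ?case using Suc.prems(3)[of k] by auto
  qed auto
  \<comment> \<open>\<open>c\<close> is the defect in length of the new cell, and \<open>b\<close>
    is where the translation \<open>l\<close> sends \<open>t (Suc n)\<close>.\<close>
  define c where "c = (a (Suc n) - a n) - (t (Suc n) - t n)"
  define b where "b = a n + (t (Suc n) - t n)"
  define g where "g = hinge (a n) b c"
  have ab: "0 \<le> a n" "a n < b" "c > - (b - a n)"
    using amono[of 0 n] Suc.prems(2-4) by (auto simp: b_def c_def)
  have g: "g \<in> time_changes" unfolding g_def using ab by (rule hinge_time_change)
  have g1: "g y = y" if "y \<le> a n" for y using that ab by (simp add: g_def hinge_def max_def min_def field_simps)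
  have g2: "g y = y + c" if "y \<ge> b" for y
  proof -
    have "(y - a n) / (b - a n) \<ge> 1" using that ab by (simp add: field_simps)
    then show ?thesis by (simp add: g_def hinge_def max_def min_def)
  qed
  have g3: "\<bar>g y - y\<bar> \<le> \<bar>c\<bar>" for y
    by (auto simp: g_def hinge_def abs_mult intro!: mult_left_le)
  have lb: "l (t (Suc n)) = b" using l(4)[of "t (Suc n)"] tmono[of n "Suc n"] by (simp add: b_def)
  show ?case
  proof (intro bexI[of _ "g \<circ> l"] conjI allI impI)
    show "g \<circ> l \<in> time_changes" using g l(1) by (rule time_changes_comp)
    fix i assume "i \<le> Suc n"
    show "(g \<circ> l) (t i) = a i"
    proof (cases "i \<le> n")
      case True then show ?thesis using l(2)[of i] g1 amono[of i n] by auto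
    next
      case False
      then have "i = Suc n" using \<open>i \<le> Suc n\<close> by simp
      then show ?thesis using lb g2[of b] by (simp add: b_def c_def)
    qed
  next
    fix s :: real assume s: "s \<ge> 0"
    show "\<bar>(g \<circ> l) s - s\<bar> \<le> (\<Sum>i<Suc n. \<bar>(a (Suc i) - a i) - (t (Suc i) - t i)\<bar>)"
      using g3[of "l s"] l(3)[OF s] by (simp add: c_def)
  next
    fix s assume s: "s \<ge> t (Suc n)"
    then have "l s = s + (a n - t n)" using l(4)[of s] tmono[of n "Suc n"] by auto
    moreover have "l s \<ge> b" using s calculation by (simp add: b_def)
    ultimately show "(g \<circ> l) s = s + (a (Suc n) - t (Suc n))" using g2 by (simp add: c_def)
  qed
qed

section \<open>Partitions and grid skeletons of cadlag paths\<close>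

lemma cadlag_cong: "(\<And>t. t \<ge> 0 \<Longrightarrow> x t = y t) \<Longrightarrow> cadlag x \<longleftrightarrow> cadlag y"
proof -
  have *: "cadlag y" if c: "cadlag x" and e: "\<And>t. t \<ge> 0 \<Longrightarrow> x t = y t" for x y :: "real \<Rightarrow> 'a"
    unfolding cadlag_def
  proof (intro conjI allI impI)
    fix t :: real assume t: "t \<ge> 0"
    have "(x \<longlongrightarrow> y t) (at_right t)" using c t e[OF t] by (auto simp: cadlag_def)
    moreover have "\<forall>\<^sub>F s in at_right t. x s = y s"
      using t by (auto simp: eventually_at_right_field intro!: exI[of _ "t+1"] e)
    ultimately show "(y \<longlongrightarrow> y t) (at_right t)" by (rule Lim_transform_eventually)
  next
    fix t :: real assume t: "t > 0"
    then obtain l where "(x \<longlongrightarrow> l) (at_left t)" using c by (auto simp: cadlag_def)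
    moreover have "\<forall>\<^sub>F s in at_left t. x s = y s"
      using t by (auto simp: eventually_at_left_field intro!: exI[of _ "0"] e)
    ultimately show "\<exists>l. (y \<longlongrightarrow> l) (at_left t)" using Lim_transform_eventually by blast
  qed
  show "(\<And>t. t \<ge> 0 \<Longrightarrow> x t = y t) \<Longrightarrow> cadlag x \<longleftrightarrow> cadlag y"
    using *[of x y] *[of y x] by metis
qed

lemma restrict_in_skorokhod_space: "(\<lambda>t\<in>{0..}. x t) \<in> skorokhod_space \<longleftrightarrow> cadlag x"
  unfolding skorokhod_space_def using cadlag_cong[of "\<lambda>t\<in>{0..}. x t" x] by auto

text \<open>One-sided limits give every point a left and a right neighbourhood of small oscillation,
  and Bolzano's bisection principle chains finitely many of them. Cells are closed on the left and
  open on the right, since the path may jump at the right endpoint.\<close>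

lemma cadlag_partition:
  fixes x :: "real \<Rightarrow> 'b::metric_space"
  assumes x: "cadlag x" and T: "T \<ge> 0" and e: "e > 0"
  obtains n t where "t 0 = 0" "t n = T" "\<And>i. i < n \<Longrightarrow> t i < t (Suc i)"
    "\<And>i r s. i < n \<Longrightarrow> r \<in> {t i..<t (Suc i)} \<Longrightarrow> s \<in> {t i..<t (Suc i)} \<Longrightarrow> dist (x r) (x s) < e"
proof -
  define R where "R a b \<longleftrightarrow> a < b \<and> (\<forall>r\<in>{a..<b}. \<forall>s\<in>{a..<b}. dist (x r) (x s) < e)" for a b :: real
  \<comment> \<open>The guard makes \<open>P\<close> vacuous for intervals that stick out to the
    left of 0; these occur in the local condition at the point 0.\<close>
  define P where "P a b \<longleftrightarrow> (0 \<le> a \<longrightarrow> R\<^sup>*\<^sup>* a b)" for a b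
  have "P 0 T"
    using T
  proof (induction rule: Bolzano)
    case (trans a b c) then show ?case using rtranclp_trans[of R a b c] by (auto simp: P_def)
  next
    case (local y)
    have half: "e / 2 > 0" using e by simp
    have "(x \<longlongrightarrow> x y) (at_right y)" using x local by (auto simp: cadlag_def)
    then have "\<forall>\<^sub>F s in at_right y. dist (x s) (x y) < e / 2" using half by (rule tendstoD)
    then obtain b where b: "b > y" "\<And>s. y < s \<Longrightarrow> s < b \<Longrightarrow> dist (x s) (x y) < e / 2"
      unfolding eventually_at_right_field by auto
    obtain a l where a: "a < y" "\<And>s. a < s \<Longrightarrow> s < y \<Longrightarrow> s \<ge> 0 \<Longrightarrow> dist (x s) l < e / 2"
    proof (cases "y = 0")
      case True then show ?thesis using that[of "-1"] by auto
    next
      case False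
      then obtain l where "(x \<longlongrightarrow> l) (at_left y)" using x local by (fastforce simp: cadlag_def)
      then have "\<forall>\<^sub>F s in at_left y. dist (x s) l < e / 2" using half by (rule tendstoD)
      then show ?thesis using that unfolding eventually_at_left_field by metis
    qed
    have Rl: "R\<^sup>*\<^sup>* r y" if "a < r" "r \<le> y" "0 \<le> r" for r
    proof (cases "r = y")
      case False
      have "dist (x s) (x s') < e" if "s \<in> {r..<y}" "s' \<in> {r..<y}" for s s'
      proof (rule dist_triangle_half_l[where y = l])
        have "a < s" "s < y" "s \<ge> 0" "a < s'" "s' < y" "s' \<ge> 0"
          using that \<open>a < r\<close> \<open>0 \<le> r\<close> by auto
        then show "dist (x s) l < e / 2" "dist (x s') l < e / 2" using a(2) by blast+
      qed
      then have "R r y" unfolding R_def using False that by auto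
      then show ?thesis by auto
    qed auto
    have Rr: "R\<^sup>*\<^sup>* y r" if "y \<le> r" "r < b" for r
    proof (cases "r = y")
      case False
      have *: "dist (x s) (x y) < e / 2" if "s \<in> {y..<r}" for s
        using that \<open>r < b\<close> b(2)[of s] half by (cases "s = y") auto
      have "dist (x s) (x s') < e" if "s \<in> {y..<r}" "s' \<in> {y..<r}" for s s'
        using *[OF that(1)] *[OF that(2)] by (rule dist_triangle_half_l)
      then have "R y r" unfolding R_def using False that by auto
      then show ?thesis by auto
    qed auto
    show ?case
      unfolding P_def
    proof (intro exI[of _ "min (y - a) (b - y)"] conjI allI impI)
      show "min (y - a) (b - y) > 0" using a b by simp
      fix r s assume rs: "r \<le> y \<and> y \<le> s \<and> s - r < min (y - a) (b - y)" "0 \<le> r"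
      show "R\<^sup>*\<^sup>* r s"
        by (rule rtranclp_trans[OF Rl Rr]) (use rs in auto)
    qed
  qed
  then have "R\<^sup>*\<^sup>* 0 T" by (simp add: P_def)
  then obtain n where "(R ^^ n) 0 T" by (auto simp: rtranclp_power)
  then obtain t where "t 0 = 0" "t n = T" "\<forall>i<n. R (t i) (t (Suc i))"
    unfolding relpowp_fun_conv by auto
  then show thesis using that[of t n] unfolding R_def by auto
qed

definition step_path :: "real \<Rightarrow> (nat \<Rightarrow> 'b) \<Rightarrow> real \<Rightarrow> 'b" where
  "step_path m z = (\<lambda>t\<in>{0..}. z (nat \<lfloor>m * t\<rfloor>))"

lemma step_path_cadlag:
  assumes m: "m > 0"
  shows "step_path m z \<in> skorokhod_space"
  unfolding step_path_def restrict_in_skorokhod_space cadlag_def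
proof (intro conjI allI impI)
  fix t :: real assume t: "t \<ge> 0"
  have "\<forall>\<^sub>F s in at_right t. z (nat \<lfloor>m * t\<rfloor>) = z (nat \<lfloor>m * s\<rfloor>)"
    unfolding eventually_at_right_field
  proof (intro exI[of _ "(\<lfloor>m * t\<rfloor> + 1) / m"] conjI allI impI)
    show "t < (\<lfloor>m * t\<rfloor> + 1) / m" using m by (simp add: field_simps) linarith
    fix s assume s: "t < s" "s < (\<lfloor>m * t\<rfloor> + 1) / m"
    then have "m * t < m * s" "m * s < \<lfloor>m * t\<rfloor> + 1" using m by (auto simp: field_simps)
    then have "\<lfloor>m * s\<rfloor> = \<lfloor>m * t\<rfloor>" by linarith
    then show "z (nat \<lfloor>m * t\<rfloor>) = z (nat \<lfloor>m * s\<rfloor>)" by simp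
  qed
  then show "((\<lambda>s. z (nat \<lfloor>m * s\<rfloor>)) \<longlongrightarrow> z (nat \<lfloor>m * t\<rfloor>)) (at_right t)"
    by (rule Lim_transform_eventually[OF tendsto_const])
next
  fix t :: real assume t: "t > 0"
  \<comment> \<open>The index of the cell to the left of \<open>t\<close>; it differs from
    \<open>\<lfloor>m * t\<rfloor>\<close> exactly when \<open>t\<close> is a grid point.\<close>
  have "\<forall>\<^sub>F s in at_left t. z (nat (\<lceil>m * t\<rceil> - 1)) = z (nat \<lfloor>m * s\<rfloor>)"
    unfolding eventually_at_left_field
  proof (intro exI[of _ "(\<lceil>m * t\<rceil> - 1) / m"] conjI allI impI)
    show "(\<lceil>m * t\<rceil> - 1) / m < t" using m by (simp add: field_simps) linarith
    fix s assume s: "s < t" "(\<lceil>m * t\<rceil> - 1) / m < s"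
    then have "m * s < m * t" "m * s > \<lceil>m * t\<rceil> - 1" using m by (auto simp: field_simps)
    then have "\<lfloor>m * s\<rfloor> = \<lceil>m * t\<rceil> - 1" by linarith
    then show "z (nat (\<lceil>m * t\<rceil> - 1)) = z (nat \<lfloor>m * s\<rfloor>)" by simp
  qed
  then have "((\<lambda>s. z (nat \<lfloor>m * s\<rfloor>)) \<longlongrightarrow> z (nat (\<lceil>m * t\<rceil> - 1))) (at_left t)"
    by (rule Lim_transform_eventually[OF tendsto_const])
  then show "\<exists>l. ((\<lambda>s. z (nat \<lfloor>m * s\<rfloor>)) \<longlongrightarrow> l) (at_left t)" by blast
qed

text \<open>Both memberships are stated because the interpolation lemma is symmetric in the two grids; this
  spares inverting time changes.\<close>

lemma skeleton_tendsto_J1: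
  fixes x :: "real \<Rightarrow> 'b::metric_space"
  assumes x: "x \<in> skorokhod_space" and T: "T \<ge> 0" and e: "e > 0"
  shows "\<forall>\<^sub>F m in sequentially. step_path (real m) (\<lambda>j. x (j / m)) \<in> J1_nbhd x T e \<and>
           x \<in> J1_nbhd (step_path (real m) (\<lambda>j. x (j / m))) T e"
proof -
  have "cadlag x" using x by (simp add: skorokhod_space_def)
  \<comment> \<open>With horizon \<open>T + 1\<close>, every \<open>s \<le> T\<close> lies strictly
    before the last partition point, also after the points have been rounded up.\<close>
  then obtain n t where t: "t 0 = 0" "t n = T + 1" "\<And>i. i < n \<Longrightarrow> t i < t (Suc i)"
    "\<And>i r s. i < n \<Longrightarrow> r \<in> {t i..<t (Suc i)} \<Longrightarrow> s \<in> {t i..<t (Suc i)} \<Longrightarrow> dist (x r) (x s) < e"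
    using cadlag_partition[of x "T + 1" e] T e by (metis add_nonneg_nonneg zero_le_one)
  have ev1: "\<forall>\<^sub>F m in sequentially. \<forall>i\<in>{..<n}. 1 / real m < t (Suc i) - t i"
  proof (rule eventually_ball_finite, simp, intro ballI)
    fix i assume "i \<in> {..<n}"
    then have "t (Suc i) - t i > 0" using t(3) by auto
    then show "\<forall>\<^sub>F m in sequentially. 1 / real m < t (Suc i) - t i"
      using lim_1_over_n[where 'a=real] by (rule order_tendstoD(2)[rotated])
  qed
  have "(\<lambda>m. n * (1 / real m)) \<longlonglongrightarrow> real n * 0" by (intro tendsto_intros lim_1_over_n)
  then have ev2: "\<forall>\<^sub>F m in sequentially. n * (1 / real m) < e" using e by (auto dest!: order_tendstoD(2)[of _ _ _ e])
  show ?thesis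
    using ev1 ev2 eventually_gt_at_top[of 0]
  proof eventually_elim
    case (elim m)
    \<comment> \<open>Rounding up to the grid: on \<open>{a i..<a (Suc i)}\<close> the skeleton
      samples \<open>x\<close> only inside \<open>{t i..<t (Suc i)}\<close>, where the oscillation
      is below \<open>e\<close>.\<close>
    define a where "a i = \<lceil>m * t i\<rceil> / real m" for i
    have mpos: "real m > 0" using elim by simp
    have a0: "a 0 = 0" by (simp add: a_def t)
    have at: "t i \<le> a i" "a i < t i + 1 / m" for i
      unfolding a_def using mpos by (auto simp: field_simps) linarith+
    have amono: "a i < a (Suc i)" if "i < n" for i
    proof -
      have "1 / m < t (Suc i) - t i" using elim that by auto
      then show ?thesis using at[of i] at[of "Suc i"] by linarith
    qed
    have diff: "\<bar>(a (Suc i) - a i) - (t (Suc i) - t i)\<bar> \<le> 1 / m" for i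
      using at[of i] at[of "Suc i"] by linarith
    have sum1: "(\<Sum>i<n. \<bar>(a (Suc i) - a i) - (t (Suc i) - t i)\<bar>) < e"
      using sum_bounded_above[of "{..<n}" "\<lambda>i. \<bar>(a (Suc i) - a i) - (t (Suc i) - t i)\<bar>" "1/m"] diff elim(2) by simp
    have sum2: "(\<Sum>i<n. \<bar>(t (Suc i) - t i) - (a (Suc i) - a i)\<bar>) < e"
      using sum1 by (simp add: abs_minus_commute)
    have cell: "\<lfloor>m * r\<rfloor> / real m \<in> {t i..<t (Suc i)}" if "r \<in> {a i..<a (Suc i)}" for r :: real and i
    proof -
      have "\<lceil>m * t i\<rceil> \<le> m * r" "m * r < \<lceil>m * t (Suc i)\<rceil>" using that mpos by (auto simp: a_def field_simps)
      then have "\<lceil>m * t i\<rceil> \<le> \<lfloor>m * r\<rfloor>" "\<lfloor>m * r\<rfloor> \<le> \<lceil>m * t (Suc i)\<rceil> - 1" by linarith+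
      then have "m * t i \<le> \<lfloor>m * r\<rfloor>" "\<lfloor>m * r\<rfloor> < m * t (Suc i)" by linarith+
      then show ?thesis using mpos by (auto simp: field_simps)
    qed
    have find: "\<exists>i<n. s \<in> {b i..<b (Suc i)}" if "b 0 = 0" "s \<in> {0..T}" "b n \<ge> T + 1" for s and b :: "nat \<Rightarrow> real"
    proof -
      define j where "j = (LEAST j. s < b j)"
      have ex: "s < b n" using that by auto
      have j: "s < b j" unfolding j_def using ex by (rule LeastI)
      have "j \<le> n" unfolding j_def using ex by (rule Least_le)
      moreover have "j \<noteq> 0" using j that by (cases j) auto
      moreover have "\<not> s < b (j - 1)" using not_less_Least[of "j - 1" "\<lambda>j. s < b j"] \<open>j \<noteq> 0\<close> by (auto simp: j_def)
      ultimately show ?thesis using j by (intro exI[of _ "j - 1"]) auto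
    qed
    let ?x = "step_path (real m) (\<lambda>j. x (j / m))"
    have skel: "?x r = x (\<lfloor>m * r\<rfloor> / real m)" if "r \<ge> 0" for r :: real using that by (simp add: step_path_def)
    have sk: "?x \<in> skorokhod_space" using mpos by (rule step_path_cadlag)
    have tn: "t i \<ge> 0" if "i \<le> n" for i
      using that
    proof (induction i)
      case (Suc i) then show ?case using t(3)[of i] by auto
    qed (simp add: t)
    obtain l where l: "l \<in> time_changes" "\<And>i. i \<le> n \<Longrightarrow> l (t i) = a i" "\<And>s. s \<ge> 0 \<Longrightarrow> \<bar>l s - s\<bar> < e"
      using time_change_interpolation[of t a n, OF t(1) a0 t(3) amono] order_le_less_trans[OF _ sum1] by blast
    obtain l' where l': "l' \<in> time_changes" "\<And>i. i \<le> n \<Longrightarrow> l' (a i) = t i" "\<And>s. s \<ge> 0 \<Longrightarrow> \<bar>l' s - s\<bar> < e"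
      using time_change_interpolation[of a t n, OF a0 t(1) amono t(3)] order_le_less_trans[OF _ sum2] by blast
    have "dist (?x (l s)) (x s) < e" if s: "s \<in> {0..T}" for s
    proof -
      obtain i where i: "i < n" "s \<in> {t i..<t (Suc i)}" using find[of t s] t s by auto
      then have "l s \<in> {a i..<a (Suc i)}"
        using time_changes_le[OF l(1) tn[of i], of s] time_changes_less[OF l(1), of s "t (Suc i)"] l(2)[of i] l(2)[of "Suc i"] s by auto
      then show ?thesis using t(4)[OF i(1) cell i(2)] skel time_changes_nonneg[OF l(1)] s by auto
    qed
    moreover have "dist (x (l' s)) (?x s) < e" if s: "s \<in> {0..T}" for s
    proof -
      obtain i where i: "i < n" "s \<in> {a i..<a (Suc i)}" using find[of a s] a0 at(1)[of n] t s by auto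
      have "a i \<ge> 0" using at(1)[of i] tn[of i] i by auto
      then have "l' s \<in> {t i..<t (Suc i)}"
        using time_changes_le[OF l'(1), of "a i" s] time_changes_less[OF l'(1), of s "a (Suc i)"] l'(2)[of i] l'(2)[of "Suc i"] s i by auto
      then show ?thesis using t(4)[OF i(1) _ cell[OF i(2)]] skel s by auto
    qed
    ultimately show ?case
      unfolding J1_nbhd_def using l l' sk x by blast
  qed
qed

text \<open>An open set \<open>U\<close> is recovered from the values of a path on the grids \<open>j/m\<close>: a path lies in \<open>U\<close> iff, for
  some \<open>k\<close>, its skeletons eventually come uniformly close on \<open>[0,k]\<close> to step paths whose
  \<open>1/k\<close>-neighbourhood is inside \<open>U\<close>.\<close>

lemma measurable_into_skorokhod:
  fixes X :: "'w \<Rightarrow> real \<Rightarrow> 'b::{metric_space, second_countable_topology}"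
  assumes X: "\<And>w. w \<in> space \<Omega> \<Longrightarrow> X w \<in> skorokhod_space"
    and meas: "\<And>t. t \<ge> 0 \<Longrightarrow> (\<lambda>w. X w t) \<in> borel_measurable \<Omega>"
  shows "X \<in> \<Omega> \<rightarrow>\<^sub>M borel_of skorokhod_J1"
  unfolding borel_of_def topspace_skorokhod_J1
proof (rule measurable_measure_of)
  show "{U. openin skorokhod_J1 U} \<subseteq> Pow (skorokhod_space :: (real \<Rightarrow> 'b) set)"
    by (auto simp: openin_skorokhod_J1)
  show "X \<in> space \<Omega> \<rightarrow> skorokhod_space" using X by auto
  fix U :: "(real \<Rightarrow> 'b) set" assume "U \<in> {U. openin skorokhod_J1 U}"
  then have U: "U \<subseteq> skorokhod_space" "\<And>x. x \<in> U \<Longrightarrow> \<exists>T>0. \<exists>e>0. J1_nbhd x T e \<subseteq> U"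
    by (auto simp: openin_skorokhod_J1)
  define A where "A k = {x \<in> skorokhod_space. J1_nbhd x k (1 / k) \<subseteq> U}" for k :: real
  define cyl where "cyl m k v' = {v :: nat \<Rightarrow> 'b. \<forall>j\<in>{..m * k}. dist (v j) (v' j) < 1 / (2 * real k)}" for m k v'
  \<comment> \<open>The union runs over uncountably many \<open>v'\<close>. It is measurable because
    it is open in the product topology on sequences, whose Borel sets are tested
    coordinatewise.\<close>
  define G where "G m k = \<Union>(cyl m k ` {v'. step_path (real m) v' \<in> A (real k)})" for m k
  have "open (cyl m k v')" for m k v'
  proof -
    have "cyl m k v' = (\<Inter>j\<in>{..m * k}. {v. dist (v j) (v' j) < 1 / (2 * real k)})"
      by (auto simp: cyl_def)
    then show ?thesis by (auto intro!: open_INT open_Collect_less continuous_intros)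
  qed
  then have openG: "open (G m k)" for m k by (auto simp: G_def)
  have skel_meas: "(\<lambda>w. \<lambda>j. X w (real j / real m)) \<in> borel_measurable \<Omega>" for m
    by (rule measurable_coordinatewise_then_product) (auto intro!: meas)
  have key: "x \<in> U \<longleftrightarrow> (\<exists>k>0. \<forall>\<^sub>F m in sequentially. (\<lambda>j. x (real j / real m)) \<in> G m k)"
    if x: "x \<in> skorokhod_space" for x
  proof
    assume "x \<in> U"
    then obtain T e where Te: "T > 0" "e > 0" "J1_nbhd x T e \<subseteq> U" using U(2) by blast
    \<comment> \<open>\<open>1 / i < e / 2\<close> halves the errors in time and space, and
      \<open>T + e / 2 \<le> i\<close> keeps \<open>l s\<close> within the horizon \<open>i\<close>;
      so the two time changes compose.\<close>
    obtain i :: nat where i: "real i > T + 2 / e + e" using reals_Archimedean2 by blast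
    have ipos: "real i > 0" using i Te by (smt (verit) divide_pos_pos)
    have "2 / e < real i" using i Te by linarith
    then have ie: "1 / real i < e / 2" using ipos Te by (simp add: field_simps)
    have iT: "T + e / 2 \<le> real i" using i Te by (smt (verit) divide_pos_pos field_sum_of_halves)
    have "\<forall>\<^sub>F m in sequentially. (\<lambda>j. x (real j / real m)) \<in> G m i"
      using skeleton_tendsto_J1[OF x less_imp_le[OF Te(1)] half_gt_zero[OF Te(2)]] eventually_gt_at_top[of 0]
    proof eventually_elim
      case (elim m)
      let ?x = "step_path (real m) (\<lambda>j. x (j / m))"
      obtain l where l: "?x \<in> skorokhod_space" "l \<in> time_changes" "\<And>s. s \<ge> 0 \<Longrightarrow> \<bar>l s - s\<bar> < e / 2"
        "\<And>s. s \<in> {0..T} \<Longrightarrow> dist (?x (l s)) (x s) < e / 2"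
        using elim(1) Te unfolding J1_nbhd_def by auto
      have "J1_nbhd ?x i (1 / i) \<subseteq> U"
      proof (rule subset_trans[OF subsetI Te(3)])
        fix y assume "y \<in> J1_nbhd ?x i (1 / i)"
        then obtain h where h: "y \<in> skorokhod_space" "h \<in> time_changes" "\<And>s. s \<ge> 0 \<Longrightarrow> \<bar>h s - s\<bar> < 1 / i"
          "\<And>s. s \<in> {0..real i} \<Longrightarrow> dist (y (h s)) (?x s) < 1 / i"
          unfolding J1_nbhd_def by auto
        have "\<bar>(h \<circ> l) s - s\<bar> < e" if "s \<ge> 0" for s
          using h(3)[OF time_changes_nonneg[OF l(2) that]] l(3)[OF that] ie unfolding o_def by linarith
        moreover have "dist (y ((h \<circ> l) s)) (x s) < e" if s: "s \<in> {0..T}" for s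
        proof -
          have "0 \<le> l s" "\<bar>l s - s\<bar> < e / 2" "s \<le> T"
            using time_changes_nonneg[OF l(2), of s] l(3)[of s] s by auto
          then have "l s \<in> {0..real i}" using iT unfolding atLeastAtMost_iff by linarith
          then have "dist (y (h (l s))) (?x (l s)) < e / 2" using h(4) ie by fastforce
          then show ?thesis using l(4)[OF s] dist_triangle[of "y (h (l s))" "x s" "?x (l s)"] by simp
        qed
        ultimately show "y \<in> J1_nbhd x T e"
          unfolding J1_nbhd_def using h(1) time_changes_comp[OF h(2) l(2)] by blast
      qed
      then have "?x \<in> A i" using l(1) by (simp add: A_def)
      then show ?case unfolding G_def cyl_def using ipos by auto
    qed
    then show "\<exists>k>0. \<forall>\<^sub>F m in sequentially. (\<lambda>j. x (real j / real m)) \<in> G m k"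
      using ipos by (intro exI[of _ i]) auto
  next
    assume "\<exists>k>0. \<forall>\<^sub>F m in sequentially. (\<lambda>j. x (real j / real m)) \<in> G m k"
    then obtain k where k: "k > 0" "\<forall>\<^sub>F m in sequentially. (\<lambda>j. x (real j / real m)) \<in> G m k" by blast
    have kp: "real k \<ge> 0" "1 / (2 * real k) > 0" using k by auto
    have "\<forall>\<^sub>F m in sequentially. x \<in> U"
      using k(2) skeleton_tendsto_J1[OF x kp] eventually_gt_at_top[of 0]
    proof eventually_elim
      case (elim m)
      let ?x = "step_path (real m) (\<lambda>j. x (j / m))"
      obtain v' where v': "step_path (real m) v' \<in> A k"
        "\<And>j. j \<le> m * k \<Longrightarrow> dist (x (j / m)) (v' j) < 1 / (2 * real k)"
        using elim(1) by (auto simp: G_def cyl_def)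
      obtain l where l: "l \<in> time_changes" "\<And>s. s \<ge> 0 \<Longrightarrow> \<bar>l s - s\<bar> < 1 / (2 * real k)"
        "\<And>s. s \<in> {0..real k} \<Longrightarrow> dist (x (l s)) (?x s) < 1 / (2 * real k)"
        using elim(2) unfolding J1_nbhd_def by auto
      \<comment> \<open>One half of the radius pays for passing from \<open>x\<close> to its
        skeleton, the other for passing from the skeleton to the step path of
        \<open>v'\<close>.\<close>
      have half: "1 / (2 * real k) + 1 / (2 * real k) = 1 / k" by simp
      have "\<bar>l s - s\<bar> < 1 / k" if "s \<ge> 0" for s
        using l(2)[OF that] half kp(2) by linarith
      moreover have "dist (x (l s)) (step_path (real m) v' s) < 1 / k" if s: "s \<in> {0..real k}" for s
      proof -
        have "nat \<lfloor>m * s\<rfloor> \<le> m * k"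
        proof -
          have "m * s \<le> real m * real k" using s by (intro mult_left_mono) auto
          then have "\<lfloor>m * s\<rfloor> \<le> int (m * k)" by (simp add: floor_le_iff)
          then show ?thesis by (simp add: nat_le_iff)
        qed
        then have "dist (?x s) (step_path (real m) v' s) < 1 / (2 * real k)"
          using v'(2)[of "nat \<lfloor>m * s\<rfloor>"] s by (simp add: step_path_def)
        then show ?thesis using l(3)[OF s] half dist_triangle[of "x (l s)" "step_path (real m) v' s" "?x s"] by linarith
      qed
      ultimately have "x \<in> J1_nbhd (step_path (real m) v') k (1 / k)"
        unfolding J1_nbhd_def using x l(1) by blast
      then show ?case using v'(1) by (auto simp: A_def)
    qed
    then show "x \<in> U" by simp
  qed
  have "X -` U \<inter> space \<Omega> = {w \<in> space \<Omega>. \<exists>k>0. \<exists>n. \<forall>m\<ge>n. (\<lambda>j. X w (real j / real m)) \<in> G m k}"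
    using key[OF X] by (auto simp: eventually_sequentially)
  also have "\<dots> \<in> sets \<Omega>"
  proof -
    have [measurable]: "Measurable.pred \<Omega> (\<lambda>w. (\<lambda>j. X w (real j / real m)) \<in> G m k)" for m k
      by (rule pred_sets2[OF borel_open[OF openG] skel_meas])
    show ?thesis by measurable
  qed
  finally show "X -` U \<inter> space \<Omega> \<in> sets \<Omega>" .
qed

section \<open>Nondecreasing right-continuous time changes of cadlag paths\<close>

text \<open>At a discretised time the variable is a countable patchwork of measurable ones; let the
  mesh tend to 0.\<close>

lemma borel_measurable_random_time:
  fixes X :: "real \<Rightarrow> 'w \<Rightarrow> 'b::metric_space"
  assumes X: "\<And>t. t \<ge> 0 \<Longrightarrow> X t \<in> borel_measurable \<Omega>"
    and T [measurable]: "T \<in> borel_measurable \<Omega>" and T0: "\<And>w. w \<in> space \<Omega> \<Longrightarrow> T w \<ge> 0"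
    and rc: "\<And>w t. w \<in> space \<Omega> \<Longrightarrow> t \<ge> 0 \<Longrightarrow> ((\<lambda>t. X t w) \<longlongrightarrow> X t w) (at_right t)"
  shows "(\<lambda>w. X (T w) w) \<in> borel_measurable \<Omega>"
proof (rule borel_measurable_LIMSEQ_metric)
  \<comment> \<open>The summand 1 puts the grid point strictly to the right of \<open>T w\<close>,
    even if \<open>T w\<close> is on the grid, so the right limit applies.\<close>
  define S where "S n w = (real (nat \<lfloor>real (Suc n) * T w\<rfloor>) + 1) / real (Suc n)" for n w
  show "(\<lambda>w. X (S n w) w) \<in> borel_measurable \<Omega>" for n
    unfolding S_def
    by (rule measurable_compose_countable[where g = "\<lambda>w. nat \<lfloor>real (Suc n) * T w\<rfloor>"]) (auto intro!: X)
  fix w assume w: "w \<in> space \<Omega>"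
  have S: "T w < S n w" "S n w \<le> T w + 1 / real (Suc n)" for n
  proof -
    have "real_of_int \<lfloor>real (Suc n) * T w\<rfloor> \<ge> 0" using T0[OF w] by simp
    then have "real (nat \<lfloor>real (Suc n) * T w\<rfloor>) = real_of_int \<lfloor>real (Suc n) * T w\<rfloor>" by simp
    then have *: "S n w = (real_of_int \<lfloor>real (Suc n) * T w\<rfloor> + 1) / real (Suc n)" by (simp add: S_def)
    have "real (Suc n) * T w < real_of_int \<lfloor>real (Suc n) * T w\<rfloor> + 1" by linarith
    then show "T w < S n w" unfolding * by (simp add: pos_less_divide_eq mult.commute del: of_nat_Suc)
    have "real_of_int \<lfloor>real (Suc n) * T w\<rfloor> + 1 \<le> real (Suc n) * T w + 1" by linarith
    also have "\<dots> = (T w + 1 / real (Suc n)) * real (Suc n)" by (simp add: distrib_right mult.commute[of "T w"] del: of_nat_Suc)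
    finally show "S n w \<le> T w + 1 / real (Suc n)" unfolding * by (simp add: pos_divide_le_eq del: of_nat_Suc)
  qed
  have "(\<lambda>n. S n w) \<longlonglongrightarrow> T w"
  proof (rule tendsto_sandwich[of "\<lambda>n. T w" _ _ "\<lambda>n. T w + 1 / real (Suc n)"])
    have "(\<lambda>n. T w + 1 / real (Suc n)) \<longlonglongrightarrow> T w + 0"
      by (intro tendsto_intros LIMSEQ_Suc[OF lim_1_over_n])
    then show "(\<lambda>n. T w + 1 / real (Suc n)) \<longlonglongrightarrow> T w" by simp
  qed (use S in \<open>auto intro!: always_eventually less_imp_le\<close>)
  then have "filterlim (\<lambda>n. S n w) (at_right (T w)) sequentially"
    by (rule filterlim_at_withinI) (use S(1) in \<open>auto simp: less_imp_neq\<close>)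
  then show "(\<lambda>n. X (S n w) w) \<longlonglongrightarrow> X (T w) w"
    using filterlim_compose[OF rc[OF w T0[OF w]]] by blast
qed

definition clock :: "(real \<Rightarrow> real) \<Rightarrow> bool" where
  "clock y \<longleftrightarrow> (\<forall>t\<ge>0. 0 \<le> y t \<and> (y \<longlongrightarrow> y t) (at_right t)) \<and> mono_on {0..} y"

lemma clock_scale:
  assumes y: "clock y" and "a \<ge> 0" "b > 0"
  shows "clock (\<lambda>t. a * y (b * t))"
  unfolding clock_def
proof (intro conjI allI impI)
  fix t :: real assume t: "t \<ge> 0"
  then show "0 \<le> a * y (b * t)" using assms by (auto simp: clock_def)
  have "filterlim (\<lambda>s. b * s) (at_right (b * t)) (at_right t)"
  proof (rule filterlim_at_withinI)
    show "((\<lambda>s. b * s) \<longlongrightarrow> b * t) (at_right t)" by (intro tendsto_intros)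
    show "\<forall>\<^sub>F s in at_right t. b * s \<in> {b * t<..} - {b * t}"
      using \<open>b > 0\<close> by (auto simp: eventually_at_right_field intro!: exI[of _ "t+1"])
  qed
  moreover have "(y \<longlongrightarrow> y (b * t)) (at_right (b * t))" using assms t by (auto simp: clock_def)
  ultimately have "((\<lambda>s. y (b * s)) \<longlongrightarrow> y (b * t)) (at_right t)" by (rule filterlim_compose[rotated])
  then show "((\<lambda>s. a * y (b * s)) \<longlongrightarrow> a * y (b * t)) (at_right t)" by (intro tendsto_intros)
next
  show "mono_on {0..} (\<lambda>t. a * y (b * t))"
  proof (rule mono_onI)
    fix r s :: real assume "r \<in> {0..}" "s \<in> {0..}" "r \<le> s"
    then have "b * r \<in> {0..}" "b * s \<in> {0..}" "b * r \<le> b * s" using \<open>b > 0\<close> by auto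
    then have "y (b * r) \<le> y (b * s)" using y by (auto simp: clock_def mono_on_def)
    then show "a * y (b * r) \<le> a * y (b * s)" using \<open>a \<ge> 0\<close> by (rule mult_left_mono)
  qed
qed

lemma clock_mono: "clock y \<Longrightarrow> 0 \<le> s \<Longrightarrow> s \<le> t \<Longrightarrow> y s \<le> y t"
  by (auto simp: clock_def mono_on_def)

lemma clock_nonneg: "clock y \<Longrightarrow> t \<ge> 0 \<Longrightarrow> y t \<ge> 0"
  by (auto simp: clock_def)

lemma clock_mult: "clock y \<Longrightarrow> a \<ge> 0 \<Longrightarrow> clock (\<lambda>t. a * y t)"
  using clock_scale[of y a 1] by simp

lemma clock_restrict:
  assumes "clock y"
  shows "clock (\<lambda>t\<in>{0..}. y t)"
proof -
  have "((\<lambda>t\<in>{0..}. y t) \<longlongrightarrow> y t) (at_right t)" if "t \<ge> 0" for t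
  proof (rule Lim_transform_eventually)
    show "(y \<longlongrightarrow> y t) (at_right t)" using assms that by (simp add: clock_def)
    show "\<forall>\<^sub>F s in at_right t. y s = (\<lambda>t\<in>{0..}. y t) s"
      unfolding eventually_at_right_field using that by (intro exI[of _ "t + 1"]) auto
  qed
  then show ?thesis using assms by (auto simp: clock_def mono_on_def)
qed

lemma clock_linear: "c \<ge> 0 \<Longrightarrow> clock (\<lambda>t. c * t)"
  unfolding clock_def by (auto intro!: tendsto_intros mono_onI mult_left_mono)

text \<open>For left limits at \<open>t\<close>, let \<open>l\<close> be the supremum of
  \<open>y\<close> on \<open>[0,t)\<close>. If \<open>l\<close> is attained, \<open>y\<close> is
  constant just before \<open>t\<close>; otherwise \<open>y\<close> tends to \<open>l\<close>
  strictly from below and the left limit of \<open>x\<close> at \<open>l\<close> is inherited. On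
  the right, \<open>y s\<close> either equals \<open>y t\<close> or approaches it from
  above.\<close>

lemma cadlag_clock:
  assumes x: "cadlag x" and y: "clock y"
  shows "cadlag (\<lambda>t. x (y t))"
  unfolding cadlag_def
proof (intro conjI allI impI)
  have ymono: "y s \<le> y t" if "0 \<le> s" "s \<le> t" for s t using y that by (auto simp: clock_def mono_on_def)
  fix t :: real assume t: "t \<ge> 0"
  have yt: "y t \<ge> 0" "(y \<longlongrightarrow> y t) (at_right t)" using y t by (auto simp: clock_def)
  have xr: "(x \<longlongrightarrow> x (y t)) (at_right (y t))" using x yt by (auto simp: cadlag_def)
  show "((\<lambda>t. x (y t)) \<longlongrightarrow> x (y t)) (at_right t)"
  proof (rule topological_tendstoI)
    fix S assume S: "open S" "x (y t) \<in> S"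
    then have "\<forall>\<^sub>F r in at_right (y t). x r \<in> S" using xr by (simp add: tendsto_def)
    then obtain b where b: "b > y t" "\<And>r. y t < r \<Longrightarrow> r < b \<Longrightarrow> x r \<in> S"
      by (auto simp: eventually_at_right_field)
    have "\<forall>\<^sub>F s in at_right t. y s < b" using yt(2) b(1) by (rule order_tendstoD(2))
    moreover have "\<forall>\<^sub>F s in at_right t. y t \<le> y s"
      using t by (auto simp: eventually_at_right_field intro!: exI[of _ "t+1"] ymono)
    ultimately show "\<forall>\<^sub>F s in at_right t. x (y s) \<in> S"
    proof eventually_elim
      case (elim s)
      then show ?case using b(2)[of "y s"] S(2) by (cases "y s = y t") auto
    qed
  qed
next
  have ymono: "y s \<le> y t" if "0 \<le> s" "s \<le> t" for s t using y that by (auto simp: clock_def mono_on_def)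
  have y0: "y s \<ge> 0" if "s \<ge> 0" for s using y that by (auto simp: clock_def)
  fix t :: real assume t: "t > 0"
  define l where "l = Sup (y ` {0..<t})"
  have bdd: "bdd_above (y ` {0..<t})" using ymono by (auto intro!: bdd_aboveI[of _ "y t"])
  have le: "y s \<le> l" if "0 \<le> s" "s < t" for s unfolding l_def using that bdd by (auto intro!: cSup_upper)
  show "\<exists>m. ((\<lambda>t. x (y t)) \<longlongrightarrow> m) (at_left t)"
  proof (cases "\<exists>s\<in>{0..<t}. y s = l")
    case True
    then obtain s where s: "0 \<le> s" "s < t" "y s = l" by auto
    have "\<forall>\<^sub>F r in at_left t. x l = x (y r)"
      unfolding eventually_at_left_field
    proof (intro exI[of _ s] conjI allI impI)
      fix r assume "s < r" "r < t"
      then have "y r = l" using le[of r] ymono[of s r] s by auto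
      then show "x l = x (y r)" by simp
    qed (use s in auto)
    from Lim_transform_eventually[OF tendsto_const this] show ?thesis by (rule exI)
  next
    case False
    then have lt: "y s < l" if "0 \<le> s" "s < t" for s using le[OF that] that by force
    have "(y \<longlongrightarrow> l) (at_left t)"
    proof (rule order_tendstoI)
      fix a assume "a < l"
      then obtain s where s: "s \<in> {0..<t}" "a < y s"
        unfolding l_def using less_cSup_iff[OF _ bdd, of a] t by auto
      then show "\<forall>\<^sub>F r in at_left t. a < y r"
        unfolding eventually_at_left_field by (intro exI[of _ s]) (use ymono in \<open>force intro: less_le_trans\<close>)
    next
      fix a assume "l < a"
      then show "\<forall>\<^sub>F r in at_left t. y r < a"
        unfolding eventually_at_left_field using t by (intro exI[of _ 0]) (auto intro: le_less_trans[OF le])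
    qed
    then have "filterlim y (at_left l) (at_left t)"
    proof (rule filterlim_at_withinI)
      show "\<forall>\<^sub>F s in at_left t. y s \<in> {..<l} - {l}"
        unfolding eventually_at_left_field using t lt by (intro exI[of _ 0]) force
    qed
    moreover have "l > 0" using lt[of 0] y0[of 0] t by simp
    then obtain m where "(x \<longlongrightarrow> m) (at_left l)" using x by (auto simp: cadlag_def)
    ultimately show ?thesis using filterlim_compose by blast
  qed
qed

section \<open>Closure properties of cadlag paths\<close>

lemma cadlag_vec:
  fixes f :: "'k::finite \<Rightarrow> real \<Rightarrow> 'b::topological_space"
  assumes "\<And>i. cadlag (f i)"
  shows "cadlag (\<lambda>t. \<chi> i. f i t)"
  unfolding cadlag_def
proof (intro conjI allI impI)
  show "((\<lambda>t. \<chi> i. f i t) \<longlongrightarrow> (\<chi> i. f i t)) (at_right t)" if "t \<ge> 0" for t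
    using assms that by (intro vec_tendstoI) (auto simp: cadlag_def)
  show "\<exists>l. ((\<lambda>t. \<chi> i. f i t) \<longlongrightarrow> l) (at_left t)" if "t > 0" for t
  proof -
    have "\<forall>i. \<exists>l. (f i \<longlongrightarrow> l) (at_left t)" using assms that by (auto simp: cadlag_def)
    then obtain l where "\<And>i. (f i \<longlongrightarrow> l i) (at_left t)" by metis
    then have "((\<lambda>t. \<chi> i. f i t) \<longlongrightarrow> (\<chi> i. l i)) (at_left t)" by (intro vec_tendstoI) auto
    then show ?thesis by blast
  qed
qed

lemma cadlag_const: "cadlag (\<lambda>_. c)"
  unfolding cadlag_def by auto

lemma cadlag_nth:
  fixes v :: "real \<Rightarrow> real ^ 'k"
  assumes v: "cadlag v"
  shows "cadlag (\<lambda>t. v t $ i)"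
  unfolding cadlag_def
proof (intro conjI allI impI)
  show "((\<lambda>t. v t $ i) \<longlongrightarrow> v t $ i) (at_right t)" if "t \<ge> 0" for t
    using v that by (intro tendsto_vec_nth) (auto simp: cadlag_def)
  show "\<exists>l. ((\<lambda>t. v t $ i) \<longlongrightarrow> l) (at_left t)" if t: "t > 0" for t
  proof -
    have "\<exists>l. (v \<longlongrightarrow> l) (at_left t)" using v t by (simp add: cadlag_def)
    then obtain l where "(v \<longlongrightarrow> l) (at_left t)" by (rule exE)
    from tendsto_vec_nth[OF this] show ?thesis by (rule exI)
  qed
qed

lemma continuous_cadlag:
  assumes "continuous_on {0..} (x :: real \<Rightarrow> 'b::topological_space)"
  shows "cadlag x"
  unfolding cadlag_def
proof (intro conjI allI impI)
  fix t :: real assume "t \<ge> 0"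
  then show "(x \<longlongrightarrow> x t) (at_right t)"
    using assms unfolding continuous_on_def by (auto intro: tendsto_within_subset)
next
  fix t :: real assume t: "t > 0"
  have "at t within {0..} = at t" using t by (intro at_within_interior) auto
  then have "(x \<longlongrightarrow> x t) (at t)"
    using assms t unfolding continuous_on_def by (metis atLeast_iff less_imp_le)
  then show "\<exists>l. (x \<longlongrightarrow> l) (at_left t)" by (auto simp: filterlim_at_split)
qed

lemma cadlag_affine:
  fixes x :: "real \<Rightarrow> real"
  assumes x: "cadlag x" and y: "cadlag y"
  shows "cadlag (\<lambda>s. (x s - a * y s) / d)"
  unfolding cadlag_def
proof (intro conjI allI impI)
  show "((\<lambda>s. (x s - a * y s) / d) \<longlongrightarrow> (x t - a * y t) / d) (at_right t)" if "t \<ge> 0" for t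
    unfolding divide_inverse using assms that
    by (intro tendsto_mult tendsto_diff tendsto_const) (auto simp: cadlag_def)
  show "\<exists>l. ((\<lambda>s. (x s - a * y s) / d) \<longlongrightarrow> l) (at_left t)" if "t > 0" for t
  proof -
    have "\<exists>l. (x \<longlongrightarrow> l) (at_left t)" "\<exists>l. (y \<longlongrightarrow> l) (at_left t)"
      using x y that by (simp_all add: cadlag_def)
    then obtain l l' where l: "(x \<longlongrightarrow> l) (at_left t)" and l': "(y \<longlongrightarrow> l') (at_left t)"
      by (elim exE)
    have "((\<lambda>s. (x s - a * y s) / d) \<longlongrightarrow> (l - a * l') / d) (at_left t)"
      unfolding divide_inverse by (intro tendsto_mult tendsto_diff tendsto_const l l')
    then show ?thesis by blast
  qed
qed

lemma clock_cadlag: "clock y \<Longrightarrow> cadlag y"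
proof -
  assume "clock y"
  moreover have "cadlag (\<lambda>x::real. x)" unfolding cadlag_def by (auto intro!: tendsto_intros exI)
  ultimately show "cadlag y" using cadlag_clock[of "\<lambda>x. x" y] by simp
qed

section \<open>Compensated Poisson variables\<close>

text \<open>Complex \<open>z\<close> covers both uses: imaginary values give the characteristic
  function, real values the Chernoff bound.\<close>

lemma poisson_exp_moment:
  fixes z :: complex
  assumes r: "r > 0"
  shows "integrable (measure_pmf (poisson_pmf r)) (\<lambda>k. exp (z * of_nat k))"
    and "(\<integral>k. exp (z * of_nat k) \<partial>measure_pmf (poisson_pmf r)) = exp (of_real r * (exp z - 1))"
proof -
  let ?t = "\<lambda>k::nat. exp (- of_real r) * ((of_real r * exp z) ^ k /\<^sub>R fact k)"
  have t: "pmf (poisson_pmf r) k *\<^sub>R exp (z * of_nat k) = ?t k" for k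
  proof -
    have "exp (z * of_nat k) = exp z ^ k" by (metis exp_of_nat_mult mult.commute)
    then show ?thesis using r
      by (simp add: scaleR_conv_of_real power_mult_distrib exp_of_real[symmetric] exp_minus field_simps)
  qed
  have s: "?t sums (exp (- of_real r) * exp (of_real r * exp z))"
    by (intro sums_mult exp_converges)
  have sn: "summable (\<lambda>k. norm (?t k))"
    unfolding norm_mult using summable_norm_exp[of "of_real r * exp z"] by (intro summable_mult)
  have i: "integrable (count_space UNIV) (\<lambda>k::nat. pmf (poisson_pmf r) k *\<^sub>R exp (z * of_nat k))"
    unfolding integrable_count_space_nat_iff t by (rule sn)
  show "integrable (measure_pmf (poisson_pmf r)) (\<lambda>k. exp (z * of_nat k))"
    unfolding measure_pmf_eq_density using i by (subst integrable_density) auto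
  have "(\<integral>k. exp (z * of_nat k) \<partial>measure_pmf (poisson_pmf r))
      = (\<integral>k. pmf (poisson_pmf r) k *\<^sub>R exp (z * of_nat k) \<partial>count_space UNIV)"
    unfolding measure_pmf_eq_density by (subst integral_density) auto
  also have "\<dots> = (\<Sum>k. pmf (poisson_pmf r) k *\<^sub>R exp (z * of_nat k))"
    by (rule integral_count_space_nat[OF i])
  also have "\<dots> = exp (- of_real r) * exp (of_real r * exp z)"
    unfolding t using s by (rule sums_unique[symmetric])
  also have "\<dots> = exp (of_real r * (exp z - 1))"
    by (simp add: exp_add[symmetric] algebra_simps)
  finally show "(\<integral>k. exp (z * of_nat k) \<partial>measure_pmf (poisson_pmf r)) = exp (of_real r * (exp z - 1))" .
qed

lemma poisson_exp_moment_real: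
  fixes s :: real
  assumes r: "r > 0"
  shows "integrable (measure_pmf (poisson_pmf r)) (\<lambda>k. exp (s * real k))"
    and "(\<integral>k. exp (s * real k) \<partial>measure_pmf (poisson_pmf r)) = exp (r * (exp s - 1))"
proof -
  have e: "exp (of_real s * of_nat k) = complex_of_real (exp (s * real k))" for k :: nat
    by (simp add: exp_of_real[symmetric])
  note p = poisson_exp_moment[OF r, of "of_real s", unfolded e]
  show i: "integrable (measure_pmf (poisson_pmf r)) (\<lambda>k. exp (s * real k))"
    using p(1) by (simp only: complex_of_real_integrable_eq)
  have "complex_of_real (\<integral>k. exp (s * real k) \<partial>measure_pmf (poisson_pmf r)) = exp (of_real r * (exp (of_real s) - 1))"
    using p(2) by simp
  also have "\<dots> = complex_of_real (exp (r * (exp s - 1)))" by (simp add: exp_of_real[symmetric])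
  finally show "(\<integral>k. exp (s * real k) \<partial>measure_pmf (poisson_pmf r)) = exp (r * (exp s - 1))"
    by (simp only: of_real_eq_iff)
qed

text \<open>For \<open>a = \<mu> * h\<close> this is the law of the compensated, rescaled Poisson
  process over a time span \<open>h\<close>, where \<open>c\<close> is the speed-up of time.\<close>

definition scaled_poisson :: "real \<Rightarrow> real \<Rightarrow> real measure" where
  "scaled_poisson c a = distr (measure_pmf (poisson_pmf (c * a))) borel (\<lambda>k. (real k - c * a) / sqrt c)"

lemma real_distribution_scaled_poisson: "real_distribution (scaled_poisson c a)"
proof -
  interpret prob_space "scaled_poisson c a"
    unfolding scaled_poisson_def by (rule measure_pmf.prob_space_distr) simp
  show ?thesis by standard (simp_all add: scaled_poisson_def)
qed

lemma exp_quadratic_bound: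
  fixes x :: real
  assumes "\<bar>x\<bar> \<le> 1"
  shows "exp x \<le> 1 + x + x\<^sup>2"
proof (cases "x \<ge> 0")
  case True then show ?thesis using exp_bound[of x] assms by simp
next
  case False
  define y where "y = - x"
  have y: "0 < y" "y \<le> 1" using False assms by (auto simp: y_def)
  have "1 + y \<le> exp y" by (rule exp_ge_add_one_self)
  then have "exp (- y) \<le> 1 / (1 + y)" using y by (simp add: exp_minus field_simps)
  \<comment> \<open>Because \<open>(1 + y) * (1 - y + y\<^sup>2) = 1 + y ^ 3\<close>.\<close>
  also have "\<dots> \<le> 1 - y + y\<^sup>2"
    using y by (simp add: field_simps power2_eq_square)
  finally show ?thesis by (simp add: y_def)
qed

text \<open>Markov's inequality for exponential moments with parameter \<open>1 / sqrt h\<close>.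
  The condition \<open>c * h \<ge> 1\<close> makes the exponent \<open>u\<close> per jump at most 1
  in size, so \<open>exp u - 1 - u \<le> u\<^sup>2\<close>, and the logarithm of the moment is at
  most \<open>\<mu> * l / h \<le> \<mu>\<close>. The bound is uniform over \<open>l \<le> h\<close>,
  as Ottaviani's inequality requires. The sign \<open>\<sigma>\<close> treats both tails at
  once.\<close>

lemma scaled_poisson_tail:
  assumes c: "c > 0" and h: "h > 0" "c * h \<ge> 1" and \<mu>: "\<mu> > 0" and l: "0 < l" "l \<le> h"
  shows "measure (scaled_poisson c (\<mu> * l)) {x. \<bar>x\<bar> \<ge> \<epsilon>} \<le> 2 * exp (\<mu> - \<epsilon> / sqrt h)"
proof -
  define r where "r = c * (\<mu> * l)"
  have r: "r > 0" using c \<mu> l by (simp add: r_def)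
  let ?P = "measure_pmf (poisson_pmf r)"
  let ?V = "\<lambda>k::nat. (real k - r) / sqrt c"
  define \<theta> where "\<theta> = 1 / sqrt h"
  have \<theta>: "\<theta> > 0" "\<theta>\<^sup>2 = 1 / h" using h by (auto simp: \<theta>_def power_divide)
  have sc: "sqrt c > 0" using c by simp
  have "\<theta> / sqrt c \<le> 1"
  proof -
    have "\<theta> / sqrt c = 1 / sqrt (c * h)" by (simp add: \<theta>_def real_sqrt_mult)
    also have "\<dots> \<le> 1" using h(2) by simp
    finally show ?thesis .
  qed
  then have small: "\<bar>\<sigma> * \<theta> / sqrt c\<bar> \<le> 1" if "\<bar>\<sigma>\<bar> = 1" for \<sigma> :: real
    using that \<theta>(1) sc by (simp add: abs_mult)
  have one: "measure ?P {k. \<sigma> * ?V k \<ge> \<epsilon>} \<le> exp (\<mu> - \<epsilon> / sqrt h)" if \<sigma>: "\<bar>\<sigma>\<bar> = 1" for \<sigma> :: real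
  proof -
    define u where "u = \<sigma> * \<theta> / sqrt c"
    have ex: "exp (\<theta> * (\<sigma> * ?V k)) = exp (- u * r) * exp (u * real k)" for k
      by (simp add: u_def exp_add[symmetric] algebra_simps diff_divide_distrib)
    note pm = poisson_exp_moment_real[OF r, of u]
    have int: "integrable ?P (\<lambda>k. exp (\<theta> * (\<sigma> * ?V k)))"
      unfolding ex using pm(1) by simp
    have "measure ?P {k. \<sigma> * ?V k \<ge> \<epsilon>} = measure ?P {k\<in>space ?P. exp (\<theta> * (\<sigma> * ?V k)) \<ge> exp (\<theta> * \<epsilon>)}"
      using \<theta>(1) by (simp only: exp_le_cancel_iff mult_le_cancel_left_pos) simp
    also have "\<dots> \<le> (\<integral>k. exp (\<theta> * (\<sigma> * ?V k)) \<partial>?P) / exp (\<theta> * \<epsilon>)"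
      by (rule integral_Markov_inequality_measure[where A = UNIV, OF int]) auto
    also have "(\<integral>k. exp (\<theta> * (\<sigma> * ?V k)) \<partial>?P) = exp (- u * r) * exp (r * (exp u - 1))"
      unfolding ex using pm(2) by simp
    also have "\<dots> = exp (r * (exp u - 1 - u))" by (simp add: exp_add[symmetric] algebra_simps)
    also have "\<dots> \<le> exp \<mu>"
    proof -
      have "exp u - 1 - u \<le> u\<^sup>2" using exp_quadratic_bound[of u] small[OF \<sigma>] by (simp add: u_def)
      then have "r * (exp u - 1 - u) \<le> r * u\<^sup>2" using r by (intro mult_left_mono) auto
      also have "u\<^sup>2 = 1 / (h * c)"
        using \<sigma> c \<theta>(2) by (simp add: u_def power_mult_distrib power_divide) (metis power2_abs power_one)
      also have "r * (1 / (h * c)) = \<mu> * (l / h)" using c by (simp add: r_def)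
      also have "\<dots> \<le> \<mu> * 1" using l h \<mu> by (intro mult_left_mono) auto
      finally show ?thesis by simp
    qed
    finally show ?thesis
      by (simp add: exp_diff \<theta>_def divide_right_mono)
  qed
  have "measure (scaled_poisson c (\<mu> * l)) {x. \<bar>x\<bar> \<ge> \<epsilon>} = measure ?P {k. \<bar>?V k\<bar> \<ge> \<epsilon>}"
    unfolding scaled_poisson_def by (subst measure_distr) (auto simp: r_def vimage_def)
  also have "\<dots> \<le> measure ?P ({k. 1 * ?V k \<ge> \<epsilon>} \<union> {k. (-1) * ?V k \<ge> \<epsilon>})"
    by (rule measure_pmf.finite_measure_mono) (auto simp: abs_real_def diff_divide_distrib split: if_splits simp del: abs_divide)
  also have "\<dots> \<le> measure ?P {k. 1 * ?V k \<ge> \<epsilon>} + measure ?P {k. (-1) * ?V k \<ge> \<epsilon>}"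
    by (rule measure_Un_le) auto
  also have "\<dots> \<le> 2 * exp (\<mu> - \<epsilon> / sqrt h)" using one[of 1] one[of "-1"] by linarith
  finally show ?thesis .
qed

lemma char_scaled_poisson:
  assumes "c > 0" "a > 0"
  shows "char (scaled_poisson c a) t = exp (of_real (c * a) * (iexp (t / sqrt c) - 1 - \<i> * of_real (t / sqrt c)))"
proof -
  define w where "w = \<i> * of_real (t / sqrt c)"
  have r: "c * a > 0" using assms by simp
  have "char (scaled_poisson c a) t = (\<integral>k. iexp (t * ((real k - c * a) / sqrt c)) \<partial>measure_pmf (poisson_pmf (c * a)))"
    unfolding char_def scaled_poisson_def by (subst integral_distr) auto
  also have "\<dots> = (\<integral>k. exp (- of_real (c * a) * w) * exp (w * of_nat k) \<partial>measure_pmf (poisson_pmf (c * a)))"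
    by (intro Bochner_Integration.integral_cong refl)
       (simp add: w_def exp_add[symmetric] diff_divide_distrib algebra_simps)
  also have "\<dots> = exp (- of_real (c * a) * w) * exp (of_real (c * a) * (exp w - 1))"
    using poisson_exp_moment[OF r, of w] by simp
  also have "\<dots> = exp (of_real (c * a) * (exp w - 1 - w))"
    by (simp add: exp_add[symmetric] algebra_simps)
  finally show ?thesis by (simp add: w_def)
qed

text \<open>With \<open>x = t / sqrt c\<close> the exponent of the characteristic function is
  \<open>c * a\<close> times the exponential series of \<open>\<i> * x\<close> without its first two
  terms. The quadratic term gives \<open>- a * t\<^sup>2 / 2\<close>, and the cubic remainder is at
  most \<open>a * \<bar>t\<bar>^3 / sqrt c\<close>.\<close>

lemma scaled_poisson_clt:
  assumes c: "filterlim c at_top sequentially" "\<And>n. c n > 0" and a: "a > 0"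
    and \<nu>: "real_distribution \<nu>" "\<And>t. char \<nu> t = of_real (exp (- a * t\<^sup>2 / 2))"
  shows "weak_conv_m (\<lambda>n. scaled_poisson (c n) a) \<nu>"
proof (rule levy_continuity[OF real_distribution_scaled_poisson \<nu>(1)])
  fix t :: real
  let ?E = "\<lambda>n. of_real (c n * a) * (iexp (t / sqrt (c n)) - 1 - \<i> * of_real (t / sqrt (c n)))"
  have "(\<lambda>n. ?E n) \<longlonglongrightarrow> of_real (- a * t\<^sup>2 / 2)"
  proof (rule Lim_null[THEN iffD2], rule Lim_null_comparison)
    have bound: "cmod (?E n - of_real (- a * t\<^sup>2 / 2)) \<le> a * \<bar>t\<bar>^3 / sqrt (c n)" for n
    proof -
      define x where "x = t / sqrt (c n)"
      have cx: "c n * x\<^sup>2 = t\<^sup>2" using c(2)[of n] by (simp add: x_def power_divide)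
      have "of_real (- a * t\<^sup>2 / 2) = of_real (c n * a) * (of_real (- x\<^sup>2 / 2) :: complex)"
        unfolding of_real_mult[symmetric] cx[symmetric] by (simp add: mult_ac)
      then have "?E n - of_real (- a * t\<^sup>2 / 2) = of_real (c n * a) * (iexp x - (1 + \<i> * of_real x + of_real (- x\<^sup>2 / 2)))"
        by (simp add: x_def[symmetric] algebra_simps)
      also have "1 + \<i> * of_real x + of_real (- x\<^sup>2 / 2) = (\<Sum>k\<le>2. (\<i> * of_real x) ^ k / fact k)"
        by (simp add: numeral_2_eq_2 mult.assoc[symmetric]) (simp add: mult.commute mult.left_commute)
      finally have "cmod (?E n - of_real (- a * t\<^sup>2 / 2)) \<le> c n * a * (\<bar>x\<bar> ^ Suc 2 / fact (Suc 2))"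
        using mult_left_mono[OF iexp_approx1[of x 2], of "c n * a"] c(2)[of n] a by (simp add: norm_mult)
      also have "\<dots> \<le> c n * a * \<bar>x\<bar> ^ 3"
        using c(2)[of n] a divide_left_mono[of 1 "fact 3" "\<bar>x\<bar> ^ 3"] by (intro mult_left_mono) auto
      also have "\<dots> = a * (c n * x\<^sup>2) * \<bar>x\<bar>" by (simp add: power3_eq_cube power2_eq_square abs_mult_self_eq)
      also have "\<dots> = a * \<bar>t\<bar>^3 / sqrt (c n)"
        unfolding cx using c(2)[of n] by (simp add: x_def power3_eq_cube power2_eq_square)
      finally show ?thesis .
    qed
    show "\<forall>\<^sub>F n in sequentially. cmod (?E n - of_real (- a * t\<^sup>2 / 2)) \<le> a * \<bar>t\<bar>^3 / sqrt (c n)"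
      using bound by simp
    have "filterlim (\<lambda>n. sqrt (c n)) at_top sequentially"
      using sqrt_at_top c(1) by (rule filterlim_compose)
    then show "(\<lambda>n. a * \<bar>t\<bar>^3 / sqrt (c n)) \<longlonglongrightarrow> 0"
      by (intro tendsto_divide_0[OF tendsto_const] filterlim_at_top_imp_at_infinity)
  qed
  then have "(\<lambda>n. exp (?E n)) \<longlonglongrightarrow> exp (of_real (- a * t\<^sup>2 / 2))" by (intro tendsto_intros)
  then show "(\<lambda>n. char (scaled_poisson (c n) a) t) \<longlonglongrightarrow> char \<nu> t"
    unfolding \<nu>(2) char_scaled_poisson[OF c(2) a] by (simp only: exp_of_real)
qed

section \<open>Oscillation of processes with independent increments\<close>

lemma levy_process_measurable: "levy_process M X \<Longrightarrow> t \<ge> 0 \<Longrightarrow> X t \<in> borel_measurable M"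
  unfolding levy_process_def by blast

lemma levy_process_indep:
  "levy_process M X \<Longrightarrow> 0 \<le> t 0 \<Longrightarrow> mono t \<Longrightarrow>
    prob_space.indep_vars M (\<lambda>_. borel) (\<lambda>k \<omega>. X (t (Suc k)) \<omega> - X (t k) \<omega>) {..<n}"
  unfolding levy_process_def by blast

lemma levy_process_increment:
  "levy_process M X \<Longrightarrow> s \<ge> 0 \<Longrightarrow> h \<ge> 0 \<Longrightarrow>
    distr M borel (\<lambda>\<omega>. X (s + h) \<omega> - X s \<omega>) = distr M borel (X h)"
  unfolding levy_process_def by blast

text \<open>Split according to the first \<open>k\<close> with
  \<open>\<bar>S k\<bar> > 2 * \<epsilon>\<close>. Independently of that event,
  \<open>\<bar>S n - S k\<bar> \<le> \<epsilon>\<close> has probability at least 1/2, and together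
  they force \<open>\<bar>S n\<bar> > \<epsilon>\<close>. So half the probability of a crossing is
  at most that of \<open>\<bar>S n\<bar> > \<epsilon>\<close>.\<close>

lemma (in prob_space) ottaviani_inequality:
  fixes \<xi> :: "nat \<Rightarrow> 'a \<Rightarrow> real"
  defines "S \<equiv> \<lambda>k \<omega>. \<Sum>i<k. \<xi> i \<omega>"
  assumes ind: "indep_vars (\<lambda>_. borel) \<xi> {..<n}"
    and tail: "\<And>k. k \<le> n \<Longrightarrow> prob {\<omega>\<in>space M. \<bar>S n \<omega> - S k \<omega>\<bar> > \<epsilon>} \<le> q" and q: "q \<le> 1 / 2"
  shows "prob {\<omega>\<in>space M. \<exists>k\<le>n. \<bar>S k \<omega>\<bar> > 2 * \<epsilon>} \<le> 2 * q"
proof -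
  have xi [measurable]: "\<xi> i \<in> borel_measurable M" if "i < n" for i
    using ind that by (auto simp: indep_vars_def)
  have S [measurable]: "S k \<in> borel_measurable M" if "k \<le> n" for k
    unfolding S_def using that by (auto intro!: borel_measurable_sum xi)
  \<comment> \<open>First crossing at index \<open>k\<close>: these events are disjoint, and
    \<open>F k\<close> depends on the \<open>\<xi> i\<close> with \<open>i < k\<close>.\<close>
  define F where "F k = {\<omega>\<in>space M. \<bar>S k \<omega>\<bar> > 2 * \<epsilon> \<and> (\<forall>j\<in>{..<k}. \<bar>S j \<omega>\<bar> \<le> 2 * \<epsilon>)}" for k
  have F_sets: "F k \<in> events" if "k \<le> n" for k
  proof -
    have [measurable]: "S k \<in> borel_measurable M" using that by simp
    have "(\<lambda>\<omega>. \<forall>j\<in>{..<k}. \<bar>S j \<omega>\<bar> \<le> 2 * \<epsilon>) \<in> measurable M (count_space UNIV)"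
    proof (rule measurable_pred_countable)
      fix j assume "j \<in> {..<k}"
      then have [measurable]: "S j \<in> borel_measurable M" using that by simp
      show "Measurable.pred M (\<lambda>\<omega>. \<bar>S j \<omega>\<bar> \<le> 2 * \<epsilon>)" by measurable
    qed auto
    then show ?thesis unfolding F_def by measurable
  qed
  let ?E = "{\<omega>\<in>space M. \<bar>S n \<omega>\<bar> > \<epsilon>}"
  have E_sets: "?E \<in> events" using S[of n] by measurable
  have disj: "disjoint_family_on F {..n}"
    unfolding disjoint_family_on_def F_def
  proof (intro ballI impI)
    fix i j :: nat assume "i \<noteq> j"
    then show "{\<omega>\<in>space M. \<bar>S i \<omega>\<bar> > 2 * \<epsilon> \<and> (\<forall>l\<in>{..<i}. \<bar>S l \<omega>\<bar> \<le> 2 * \<epsilon>)} \<inter>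
       {\<omega>\<in>space M. \<bar>S j \<omega>\<bar> > 2 * \<epsilon> \<and> (\<forall>l\<in>{..<j}. \<bar>S l \<omega>\<bar> \<le> 2 * \<epsilon>)} = {}"
      using less_linear[of i j] by (elim disjE) force+
  qed
  have un: "{\<omega>\<in>space M. \<exists>k\<le>n. \<bar>S k \<omega>\<bar> > 2 * \<epsilon>} = (\<Union>k\<in>{..n}. F k)"
  proof (intro subset_antisym subsetI)
    fix \<omega> assume "\<omega> \<in> {\<omega>\<in>space M. \<exists>k\<le>n. \<bar>S k \<omega>\<bar> > 2 * \<epsilon>}"
    then obtain k where k: "\<omega> \<in> space M" "k \<le> n" "\<bar>S k \<omega>\<bar> > 2 * \<epsilon>" by auto
    define l where "l = (LEAST k. \<bar>S k \<omega>\<bar> > 2 * \<epsilon>)"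
    have "\<bar>S l \<omega>\<bar> > 2 * \<epsilon>" unfolding l_def using k(3) by (rule LeastI)
    moreover have "l \<le> k" unfolding l_def using k(3) by (rule Least_le)
    moreover have "\<bar>S j \<omega>\<bar> \<le> 2 * \<epsilon>" if "j < l" for j
      using not_less_Least[of j "\<lambda>k. \<bar>S k \<omega>\<bar> > 2 * \<epsilon>"] that by (auto simp: l_def)
    ultimately show "\<omega> \<in> (\<Union>k\<in>{..n}. F k)" using k by (auto simp: F_def)
  qed (auto simp: F_def)
  have step: "prob (F k) * (1 / 2) \<le> prob (F k \<inter> ?E)" if k: "k \<le> n" for k
  proof -
    let ?X = "\<lambda>\<omega>. \<lambda>i\<in>{..<k}. \<xi> i \<omega>" and ?Y = "\<lambda>\<omega>. \<lambda>i\<in>{k..<n}. \<xi> i \<omega>"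
    let ?PX = "PiM {..<k} (\<lambda>_. borel :: real measure)" and ?PY = "PiM {k..<n} (\<lambda>_. borel :: real measure)"
    have iv: "indep_var ?PX ?X ?PY ?Y"
      by (rule indep_var_restrict[OF ind]) (use k in auto)
    let ?A = "{x\<in>space ?PX. \<bar>\<Sum>i<k. x i\<bar> > 2 * \<epsilon> \<and> (\<forall>j\<in>{..<k}. \<bar>\<Sum>i<j. x i\<bar> \<le> 2 * \<epsilon>)}"
    let ?B = "{y\<in>space ?PY. \<bar>\<Sum>i\<in>{k..<n}. y i\<bar> \<le> \<epsilon>}"
    have sums [measurable]: "(\<lambda>x. \<Sum>i<j. x i) \<in> borel_measurable ?PX" if "j \<le> k" for j
      using that by (intro borel_measurable_sum measurable_component_singleton) auto
    have A: "?A \<in> sets ?PX"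
    proof -
      have [measurable]: "(\<lambda>x. \<Sum>i<k. x i) \<in> borel_measurable ?PX" by simp
      have "(\<lambda>x. \<forall>j\<in>{..<k}. \<bar>\<Sum>i<j. x i\<bar> \<le> 2 * \<epsilon>) \<in> measurable ?PX (count_space UNIV)"
      proof (rule measurable_pred_countable)
        fix j assume "j \<in> {..<k}"
        then have [measurable]: "(\<lambda>x. \<Sum>i<j. x i) \<in> borel_measurable ?PX" by simp
        show "Measurable.pred ?PX (\<lambda>x. \<bar>\<Sum>i<j. x i\<bar> \<le> 2 * \<epsilon>)" by measurable
      qed auto
      then show ?thesis by measurable
    qed
    have B: "?B \<in> sets ?PY" by measurable
    have XA: "?X -` ?A \<inter> space M = F k"
      by (auto simp: F_def S_def space_PiM)
    have diff: "S n \<omega> - S k \<omega> = (\<Sum>i\<in>{k..<n}. \<xi> i \<omega>)" for \<omega>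
      using sum_diff[of "{..<n}" "{..<k}" "\<lambda>i. \<xi> i \<omega>"] k by (simp add: S_def)
    have YB: "?Y -` ?B \<inter> space M = {\<omega>\<in>space M. \<bar>S n \<omega> - S k \<omega>\<bar> \<le> \<epsilon>}"
      unfolding diff by (auto simp: space_PiM)
    have "prob (F k \<inter> {\<omega>\<in>space M. \<bar>S n \<omega> - S k \<omega>\<bar> \<le> \<epsilon>}) = prob ((\<lambda>\<omega>. (?X \<omega>, ?Y \<omega>)) -` (?A \<times> ?B) \<inter> space M)"
      unfolding XA[symmetric] YB[symmetric] by (rule arg_cong[of _ _ prob]) auto
    also have "\<dots> = prob (F k) * prob {\<omega>\<in>space M. \<bar>S n \<omega> - S k \<omega>\<bar> \<le> \<epsilon>}"
      using indep_varD[OF iv A B] by (simp only: XA YB)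
    finally have eq: "prob (F k \<inter> {\<omega>\<in>space M. \<bar>S n \<omega> - S k \<omega>\<bar> \<le> \<epsilon>}) = \<dots>" .
    have [measurable]: "S n \<in> borel_measurable M" "S k \<in> borel_measurable M" using k by auto
    have "{\<omega>\<in>space M. \<bar>S n \<omega> - S k \<omega>\<bar> \<le> \<epsilon>} = space M - {\<omega>\<in>space M. \<bar>S n \<omega> - S k \<omega>\<bar> > \<epsilon>}" by auto
    moreover have "{\<omega>\<in>space M. \<bar>S n \<omega> - S k \<omega>\<bar> > \<epsilon>} \<in> events" by measurable
    ultimately have "prob {\<omega>\<in>space M. \<bar>S n \<omega> - S k \<omega>\<bar> \<le> \<epsilon>} \<ge> 1 / 2"
      using tail[OF k] q by (simp add: prob_compl)
    then have "prob (F k) * (1 / 2) \<le> prob (F k \<inter> {\<omega>\<in>space M. \<bar>S n \<omega> - S k \<omega>\<bar> \<le> \<epsilon>})"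
      unfolding eq by (intro mult_left_mono) auto
    also have "\<dots> \<le> prob (F k \<inter> ?E)"
    proof (rule finite_measure_mono)
      show "F k \<inter> ?E \<in> events" using F_sets[OF k] E_sets by auto
      show "F k \<inter> {\<omega>\<in>space M. \<bar>S n \<omega> - S k \<omega>\<bar> \<le> \<epsilon>} \<subseteq> F k \<inter> ?E"
      proof
        fix \<omega> assume "\<omega> \<in> F k \<inter> {\<omega>\<in>space M. \<bar>S n \<omega> - S k \<omega>\<bar> \<le> \<epsilon>}"
        then have *: "\<omega> \<in> F k" "\<omega> \<in> space M" "\<bar>S n \<omega> - S k \<omega>\<bar> \<le> \<epsilon>" "\<bar>S k \<omega>\<bar> > 2 * \<epsilon>"
          by (auto simp: F_def)
        from *(3,4) have "\<bar>S n \<omega>\<bar> > \<epsilon>" by linarith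
        then show "\<omega> \<in> F k \<inter> ?E" using * by simp
      qed
    qed
    finally show ?thesis .
  qed
  have "prob (\<Union>k\<in>{..n}. F k) * (1 / 2) = (\<Sum>k\<le>n. prob (F k) * (1 / 2))"
    using F_sets disj by (subst finite_measure_finite_Union) (auto simp: sum_divide_distrib)
  also have "\<dots> \<le> (\<Sum>k\<le>n. prob (F k \<inter> ?E))" by (intro sum_mono step) auto
  also have "\<dots> = prob (\<Union>k\<in>{..n}. F k \<inter> ?E)"
    using F_sets E_sets disj
    by (subst finite_measure_finite_Union) (auto simp: disjoint_family_on_def)
  also have "\<dots> \<le> prob ?E" using E_sets by (intro finite_measure_mono) auto
  \<comment> \<open>The tail hypothesis at \<open>k = 0\<close>, where
    \<open>S 0 = 0\<close>.\<close>
  also have "\<dots> \<le> q" using tail[of 0] by (simp add: S_def)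
  finally show ?thesis unfolding un by simp
qed

text \<open>Ottaviani's inequality on dyadic grids of \<open>[a, a + h]\<close> gives a bound
  independent of the level. The grids are nested, so the exceptional events increase to a limit
  event with the same bound, and right-continuity extends the estimate to all \<open>s\<close>.
  Naming an exceptional set \<open>A\<close> avoids asking whether the supremum over uncountably
  many times is measurable.\<close>

lemma levy_oscillation:
  assumes "prob_space M" and X: "levy_process M X"
    and rc: "\<And>\<omega> t. \<omega> \<in> space M \<Longrightarrow> t \<ge> 0 \<Longrightarrow> ((\<lambda>t. X t \<omega>) \<longlongrightarrow> X t \<omega>) (at_right t)"
    and a: "a \<ge> 0" and h: "h > 0"
    and tail: "\<And>l. 0 \<le> l \<Longrightarrow> l \<le> h \<Longrightarrow> measure M {\<omega>\<in>space M. \<bar>X l \<omega>\<bar> > \<epsilon>} \<le> q" and q: "q \<le> 1 / 2"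
  shows "\<exists>A\<in>sets M. measure M A \<le> 2 * q \<and>
    (\<forall>\<omega>\<in>space M - A. \<forall>s\<in>{a..<a + h}. \<bar>X s \<omega> - X a \<omega>\<bar> \<le> 2 * \<epsilon>)"
proof -
  interpret prob_space M by fact
  have meas [measurable]: "X t \<in> borel_measurable M" if "t \<ge> 0" for t using X that by (auto simp: levy_process_def)
  define t where "t r k = a + h * real k / 2 ^ r" for r k :: nat
  have t0: "t r k \<ge> 0" for r k using a h by (simp add: t_def)
  have [measurable]: "X (t r k) \<in> borel_measurable M" "X a \<in> borel_measurable M" for r k using t0 a by auto
  define A where "A r = {\<omega>\<in>space M. \<exists>k\<le>2^r. \<bar>X (t r k) \<omega> - X a \<omega>\<bar> > 2 * \<epsilon>}" for r :: nat
  have A_sets: "A r \<in> events" for r unfolding A_def by measurable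
  have ta: "t r 0 = a" for r by (simp add: t_def)
  have le: "measure M (A r) \<le> 2 * q" for r
  proof -
    let ?xi = "\<lambda>k \<omega>. X (t r (Suc k)) \<omega> - X (t r k) \<omega>"
    have S: "(\<Sum>i<k. ?xi i \<omega>) = X (t r k) \<omega> - X a \<omega>" for k \<omega>
      by (subst sum_lessThan_telescope) (simp add: ta)
    have "mono (t r)" using h by (auto simp: mono_def t_def divide_right_mono)
    then have ind: "indep_vars (\<lambda>_. borel) ?xi {..<2^r}"
      using X t0[of r 0] by (auto simp: levy_process_def)
    have "measure M {\<omega>\<in>space M. \<exists>k\<le>2^r. \<bar>\<Sum>i<k. ?xi i \<omega>\<bar> > 2 * \<epsilon>} \<le> 2 * q"
    proof (rule ottaviani_inequality[OF ind _ q])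
      fix k :: nat assume k: "k \<le> 2^r"
      define l where "l = t r (2^r) - t r k"
      have "real k \<le> 2 ^ r" using k by (metis of_nat_le_iff of_nat_numeral of_nat_power)
      then have kr: "real k / 2 ^ r \<le> 1" by simp
      have l: "0 \<le> l" "l \<le> h" "t r k + l = t r (2^r)"
        using h kr mult_left_mono[OF kr, of h] by (auto simp: l_def t_def)
      have d: "distr M borel (\<lambda>\<omega>. X (t r k + l) \<omega> - X (t r k) \<omega>) = distr M borel (X l)"
        using X t0 l(1) by (auto simp: levy_process_def)
      have "measure M {\<omega>\<in>space M. \<bar>(\<Sum>i<2^r. ?xi i \<omega>) - (\<Sum>i<k. ?xi i \<omega>)\<bar> > \<epsilon>}
         = measure (distr M borel (\<lambda>\<omega>. X (t r k + l) \<omega> - X (t r k) \<omega>)) {x. \<bar>x\<bar> > \<epsilon>}"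
        unfolding S l(3) by (subst measure_distr) (auto simp: vimage_def Int_def conj_commute)
      also have "\<dots> = measure M {\<omega>\<in>space M. \<bar>X l \<omega>\<bar> > \<epsilon>}"
        unfolding d using meas[OF l(1)] by (subst measure_distr) (auto simp: vimage_def Int_def conj_commute)
      also have "\<dots> \<le> q" using l by (intro tail)
      finally show "measure M {\<omega>\<in>space M. \<bar>(\<Sum>i<2^r. ?xi i \<omega>) - (\<Sum>i<k. ?xi i \<omega>)\<bar> > \<epsilon>} \<le> q" .
    qed
    then show ?thesis unfolding S A_def .
  qed
  have "A r \<subseteq> A (Suc r)" for r
  proof
    fix \<omega> assume "\<omega> \<in> A r"
    then obtain k where k: "\<omega> \<in> space M" "k \<le> 2 ^ r" "\<bar>X (t r k) \<omega> - X a \<omega>\<bar> > 2 * \<epsilon>" by (auto simp: A_def)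
    have "t (Suc r) (2 * k) = t r k" by (simp add: t_def)
    then show "\<omega> \<in> A (Suc r)" using k by (auto simp: A_def intro!: exI[of _ "2 * k"])
  qed
  then have "incseq A" by (rule incseq_SucI)
  then have "(\<lambda>r. measure M (A r)) \<longlonglongrightarrow> measure M (\<Union>r. A r)"
    using A_sets by (intro finite_Lim_measure_incseq) auto
  then have "measure M (\<Union>r. A r) \<le> 2 * q" by (rule LIMSEQ_le_const2) (use le in auto)
  moreover have "\<bar>X s \<omega> - X a \<omega>\<bar> \<le> 2 * \<epsilon>" if \<omega>: "\<omega> \<in> space M" "\<omega> \<notin> (\<Union>r. A r)" and s: "a \<le> s" "s < a + h" for \<omega> s
  proof -
    define y where "y = (s - a) / h"
    have y: "0 \<le> y" "y < 1" "s = a + h * y" using s h by (auto simp: y_def)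
    \<comment> \<open>The next dyadic index strictly to the right of \<open>y\<close>. Since
      \<open>y < 1\<close> it is at most \<open>2 ^ r\<close>, so the grid point stays in the
      interval.\<close>
    define k where "k r = nat \<lfloor>2 ^ r * y\<rfloor> + 1" for r :: nat
    have kreal: "real (k r) = real_of_int \<lfloor>2 ^ r * y\<rfloor> + 1" for r using y by (simp add: k_def)
    have kle: "k r \<le> 2 ^ r" for r
    proof -
      have "2 ^ r * y < 2 ^ r" using y by simp
      then have "\<lfloor>2 ^ r * y\<rfloor> < 2 ^ r" by (simp add: floor_less_iff)
      then have "\<lfloor>2 ^ r * y\<rfloor> < int (2 ^ r)" by simp
      then have "nat \<lfloor>2 ^ r * y\<rfloor> < 2 ^ r" using y by (subst nat_less_iff) auto
      then show ?thesis by (simp only: k_def Suc_eq_plus1[symmetric] Suc_le_eq)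
    qed
    have ub: "real (k r) / 2 ^ r \<le> y + (1 / 2) ^ r" and lb: "y < real (k r) / 2 ^ r" for r
    proof -
      have "real (k r) \<le> 2 ^ r * y + 1" "2 ^ r * y < real (k r)" unfolding kreal by linarith+
      then show "real (k r) / 2 ^ r \<le> y + (1 / 2) ^ r" "y < real (k r) / 2 ^ r"
        by (auto simp: field_simps power_divide)
    qed
    have "(\<lambda>r. real (k r) / 2 ^ r) \<longlonglongrightarrow> y"
    proof (rule tendsto_sandwich[of "\<lambda>_. y" _ _ "\<lambda>r. y + (1 / 2) ^ r"])
      have "(\<lambda>r. y + (1 / 2) ^ r) \<longlonglongrightarrow> y + 0" by (intro tendsto_intros LIMSEQ_realpow_zero) auto
      then show "(\<lambda>r. y + (1 / 2) ^ r) \<longlonglongrightarrow> y" by simp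
    qed (use ub lb in \<open>auto intro!: always_eventually less_imp_le\<close>)
    then have "(\<lambda>r. a + h * (real (k r) / 2 ^ r)) \<longlonglongrightarrow> a + h * y" by (intro tendsto_intros)
    then have "(\<lambda>r. t r (k r)) \<longlonglongrightarrow> s" unfolding y(3) by (simp add: t_def)
    moreover have "s < t r (k r)" for r
      using mult_strict_left_mono[OF lb[of r] h] unfolding y(3) by (simp add: t_def)
    ultimately have "filterlim (\<lambda>r. t r (k r)) (at_right s) sequentially"
      by (intro filterlim_at_withinI) (auto simp: less_imp_neq[THEN not_sym])
    then have "(\<lambda>r. X (t r (k r)) \<omega>) \<longlonglongrightarrow> X s \<omega>"
      by (rule filterlim_compose[OF rc[OF \<omega>(1)], rotated]) (use a s in auto)
    then have "(\<lambda>r. \<bar>X (t r (k r)) \<omega> - X a \<omega>\<bar>) \<longlonglongrightarrow> \<bar>X s \<omega> - X a \<omega>\<bar>" by (intro tendsto_intros)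
    moreover have "\<bar>X (t r (k r)) \<omega> - X a \<omega>\<bar> \<le> 2 * \<epsilon>" for r
      using \<omega> kle[of r] by (force simp: A_def)
    ultimately show ?thesis by (intro LIMSEQ_le_const2) auto
  qed
  ultimately show ?thesis using A_sets by (intro bexI[of _ "\<Union>r. A r"]) auto
qed

section \<open>Coupling of increments\<close>

lemma distr_PiM_compose:
  assumes I: "finite I" and N: "prob_space N" and f [measurable]: "f \<in> N \<rightarrow>\<^sub>M R"
  shows "distr (PiM I (\<lambda>_. N)) (PiM I (\<lambda>_. R)) (compose I f) = PiM I (\<lambda>_. distr N R f)"
proof -
  let ?R = "distr N R f"
  have "distr (PiM I (\<lambda>_. N)) (PiM I (\<lambda>_. R)) (compose I f) = distr (PiM I (\<lambda>_. N)) (PiM I (\<lambda>_. ?R)) (compose I f)"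
    by (intro distr_cong refl sets_PiM_cong) auto
  also have "\<dots> = PiM I (\<lambda>_. distr N ?R f)"
    using I N by (intro distr_PiM_finite_prob_space') (auto intro: prob_space.prob_space_distr)
  also have "distr N ?R f = ?R" by (intro distr_cong) auto
  finally show ?thesis .
qed

lemma measurable_compose_PiM:
  assumes f: "f \<in> N \<rightarrow>\<^sub>M R"
  shows "compose I f \<in> PiM I (\<lambda>_. N) \<rightarrow>\<^sub>M PiM I (\<lambda>_. R)"
  unfolding compose_def
  by (intro measurable_restrict measurable_compose[OF _ f] measurable_component_singleton)

text \<open>The integrals depend on the arrays through their joint laws only, and independence
  determines these from the law of one entry. Skorohod's theorem concerns laws on the line, so it is
  applied to that one law; independent copies of its sample space carry the whole array, and
  dominated convergence finishes.\<close>

lemma array_weak_convergence: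
  fixes D :: "nat \<Rightarrow> 'k::finite \<Rightarrow> nat \<Rightarrow> 'a \<Rightarrow> real" and E :: "'k \<Rightarrow> nat \<Rightarrow> 'a \<Rightarrow> real"
    and H :: "('k \<Rightarrow> nat \<Rightarrow> real) \<Rightarrow> real"
  assumes "prob_space M" and J: "J > 0"
    and D1: "\<And>n. prob_space.indep_vars M (\<lambda>_. PiM {..<J} (\<lambda>_. borel)) (\<lambda>i \<omega>. \<lambda>j\<in>{..<J}. D n i j \<omega>) UNIV"
    and D2: "\<And>n i. prob_space.indep_vars M (\<lambda>_. borel) (D n i) {..<J}"
    and D3: "\<And>n i j. j < J \<Longrightarrow> distr M borel (D n i j) = \<mu> n"
    and E1: "prob_space.indep_vars M (\<lambda>_. PiM {..<J} (\<lambda>_. borel)) (\<lambda>i \<omega>. \<lambda>j\<in>{..<J}. E i j \<omega>) UNIV"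
    and E2: "\<And>i. prob_space.indep_vars M (\<lambda>_. borel) (E i) {..<J}"
    and E3: "\<And>i j. j < J \<Longrightarrow> distr M borel (E i j) = \<nu>"
    and conv: "\<And>n. real_distribution (\<mu> n)" "real_distribution \<nu>" "weak_conv_m \<mu> \<nu>"
    and H [measurable]: "H \<in> borel_measurable (PiM UNIV (\<lambda>_. PiM {..<J} (\<lambda>_. borel)))"
    and bound: "\<And>x. \<bar>H x\<bar> \<le> C"
    and cont: "\<And>X x. (\<And>i j. j < J \<Longrightarrow> (\<lambda>n. X n i j) \<longlonglongrightarrow> x i j) \<Longrightarrow> (\<lambda>n. H (X n)) \<longlonglongrightarrow> H x"
  shows "(\<lambda>n. \<integral>\<omega>. H (\<lambda>i. \<lambda>j\<in>{..<J}. D n i j \<omega>) \<partial>M) \<longlonglongrightarrow> (\<integral>\<omega>. H (\<lambda>i. \<lambda>j\<in>{..<J}. E i j \<omega>) \<partial>M)"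
proof -
  interpret prob_space M by fact
  let ?P = "PiM UNIV (\<lambda>_::'k. PiM {..<J} (\<lambda>_. borel :: real measure))"
  obtain \<Omega> :: "real measure" and S :: "nat \<Rightarrow> real \<Rightarrow> real" and S' where
    sk: "prob_space \<Omega> \<and> (\<forall>n. S n \<in> borel_measurable \<Omega>) \<and> (\<forall>n. distr \<Omega> borel (S n) = \<mu> n) \<and>
      S' \<in> measurable \<Omega> lborel \<and> distr \<Omega> borel S' = \<nu> \<and> (\<forall>x\<in>space \<Omega>. (\<lambda>n. S n x) \<longlonglongrightarrow> S' x)"
    using Skorohod[OF conv] by (elim exE)
  then have \<Omega>: "prob_space \<Omega>" and S: "\<And>n. S n \<in> borel_measurable \<Omega>" "\<And>n. distr \<Omega> borel (S n) = \<mu> n"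
    and S': "S' \<in> borel_measurable \<Omega>" "distr \<Omega> borel S' = \<nu>"
    and lim: "\<And>x. x \<in> space \<Omega> \<Longrightarrow> (\<lambda>n. S n x) \<longlonglongrightarrow> S' x"
    by (simp_all add: measurable_lborel1)
  define P where "P = PiM (UNIV :: 'k set) (\<lambda>_. PiM {..<J} (\<lambda>_. \<Omega>))"
  interpret P: prob_space P
    unfolding P_def by (intro prob_space_PiM \<Omega>)
  \<comment> \<open>Independence is used twice: within a row (\<open>F2\<close>) and between rows
    (\<open>F1\<close>), giving a product of product measures.\<close>
  have law: "(\<integral>\<omega>. H (\<lambda>i. \<lambda>j\<in>{..<J}. F i j \<omega>) \<partial>M) = (\<integral>x. H (\<lambda>i. \<lambda>j\<in>{..<J}. s (x i j)) \<partial>P)"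
    if s [measurable]: "s \<in> borel_measurable \<Omega>"
      and F1: "indep_vars (\<lambda>_. PiM {..<J} (\<lambda>_. borel)) (\<lambda>i \<omega>. \<lambda>j\<in>{..<J}. F i j \<omega>) UNIV"
      and F2: "\<And>i. indep_vars (\<lambda>_. borel) (F i) {..<J}"
      and F3: "\<And>i j. j < J \<Longrightarrow> distr M borel (F i j) = distr \<Omega> borel s"
    for s :: "real \<Rightarrow> real" and F :: "'k \<Rightarrow> nat \<Rightarrow> 'a \<Rightarrow> real"
  proof -
    let ?Q = "PiM {..<J} (\<lambda>_. borel :: real measure)"
    have rv [measurable]: "(\<lambda>\<omega>. \<lambda>j\<in>{..<J}. F i j \<omega>) \<in> M \<rightarrow>\<^sub>M ?Q" for i
      using F1 by (auto simp: indep_vars_def)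
    have [measurable]: "(\<lambda>\<omega> i. \<lambda>j\<in>{..<J}. F i j \<omega>) \<in> M \<rightarrow>\<^sub>M ?P"
      by (rule measurable_abs_UNIV) (rule rv)
    have rvF: "F i j \<in> borel_measurable M" if "j < J" for i j
      using F2[of i] that by (auto simp: indep_vars_def)
    have inner: "distr M ?Q (\<lambda>\<omega>. \<lambda>j\<in>{..<J}. F i j \<omega>) = distr (PiM {..<J} (\<lambda>_. \<Omega>)) ?Q (compose {..<J} s)" for i
    proof -
      have "distr M ?Q (\<lambda>\<omega>. \<lambda>j\<in>{..<J}. F i j \<omega>) = PiM {..<J} (\<lambda>j. distr M borel (F i j))"
        using F2[of i] J rvF by (subst (asm) indep_vars_iff_distr_eq_PiM') auto
      also have "\<dots> = PiM {..<J} (\<lambda>j. distr \<Omega> borel s)" using F3 by (intro PiM_cong) auto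
      also have "\<dots> = distr (PiM {..<J} (\<lambda>_. \<Omega>)) ?Q (compose {..<J} s)"
        by (rule distr_PiM_compose[symmetric]) (use \<Omega> in auto)
      finally show ?thesis .
    qed
    have "distr M ?P (\<lambda>\<omega> i. \<lambda>j\<in>{..<J}. F i j \<omega>) = PiM UNIV (\<lambda>i. distr M ?Q (\<lambda>\<omega>. \<lambda>j\<in>{..<J}. F i j \<omega>))"
      using F1 by (subst (asm) indep_vars_iff_distr_eq_PiM') (auto simp: restrict_UNIV)
    also have "\<dots> = PiM UNIV (\<lambda>i::'k. distr (PiM {..<J} (\<lambda>_. \<Omega>)) ?Q (compose {..<J} s))"
      unfolding inner ..
    also have "\<dots> = distr P ?P (compose UNIV (compose {..<J} s))"
      unfolding P_def
      by (rule distr_PiM_compose[symmetric]) (auto intro!: prob_space_PiM \<Omega> measurable_compose_PiM)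
    finally have eq: "distr M ?P (\<lambda>\<omega> i. \<lambda>j\<in>{..<J}. F i j \<omega>) = distr P ?P (compose UNIV (compose {..<J} s))" .
    have "(\<integral>\<omega>. H (\<lambda>i. \<lambda>j\<in>{..<J}. F i j \<omega>) \<partial>M) = (\<integral>x. H x \<partial>distr M ?P (\<lambda>\<omega> i. \<lambda>j\<in>{..<J}. F i j \<omega>))"
      by (subst integral_distr) auto
    also have "\<dots> = (\<integral>x. H (compose UNIV (compose {..<J} s) x) \<partial>P)"
      unfolding eq P_def by (subst integral_distr) (auto intro!: measurable_compose_PiM)
    finally show ?thesis by (simp add: compose_def restrict_def)
  qed
  have fD: "(\<integral>\<omega>. H (\<lambda>i. \<lambda>j\<in>{..<J}. D n i j \<omega>) \<partial>M) = (\<integral>x. H (\<lambda>i. \<lambda>j\<in>{..<J}. S n (x i j)) \<partial>P)" for n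
    by (rule law[OF S(1) D1 D2]) (simp add: D3 S)
  have fE: "(\<integral>\<omega>. H (\<lambda>i. \<lambda>j\<in>{..<J}. E i j \<omega>) \<partial>M) = (\<integral>x. H (\<lambda>i. \<lambda>j\<in>{..<J}. S' (x i j)) \<partial>P)"
    by (rule law[OF S'(1) E1 E2]) (simp add: E3 S')
  have m: "(\<lambda>x. H (\<lambda>i. \<lambda>j\<in>{..<J}. s (x i j))) \<in> borel_measurable P" if [measurable]: "s \<in> borel_measurable \<Omega>" for s
    using measurable_compose[OF measurable_compose_PiM[OF measurable_compose_PiM[OF that]] H]
    by (simp add: P_def compose_def restrict_def)
  show ?thesis
    unfolding fD fE
  proof (rule integral_dominated_convergence[where w = "\<lambda>_. C"])
    show "AE x in P. (\<lambda>n. H (\<lambda>i. \<lambda>j\<in>{..<J}. S n (x i j))) \<longlonglongrightarrow> H (\<lambda>i. \<lambda>j\<in>{..<J}. S' (x i j))"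
    proof (rule AE_I2, rule cont)
      fix x i j assume "x \<in> space P" "j < J"
      then show "(\<lambda>n. (\<lambda>j\<in>{..<J}. S n (x i j)) j) \<longlonglongrightarrow> (\<lambda>j\<in>{..<J}. S' (x i j)) j"
        by (auto simp: P_def space_PiM intro!: lim)
    qed
  qed (use S S' m bound in auto)
qed

section \<open>Lipschitz envelopes\<close>

text \<open>The truncation at 1 keeps the supremum bounded for arbitrary functions.\<close>

definition path_dist :: "real \<Rightarrow> (real \<Rightarrow> 'b::metric_space) \<Rightarrow> (real \<Rightarrow> 'b) \<Rightarrow> real" where
  "path_dist T v w = (SUP s\<in>{0..T}. min 1 (dist (v s) (w s)))"

lemma bdd_above_path_dist: "bdd_above ((\<lambda>s. min 1 (dist (v s) (w s))) ` {0..T::real})"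
  by (rule bdd_aboveI[of _ 1]) auto

lemma path_dist_upper: "s \<in> {0..T} \<Longrightarrow> min 1 (dist (v s) (w s)) \<le> path_dist T v w"
  unfolding path_dist_def by (rule cSUP_upper[OF _ bdd_above_path_dist])

lemma path_dist_le:
  assumes "T \<ge> 0" "\<And>s. s \<in> {0..T} \<Longrightarrow> dist (v s) (w s) \<le> \<eta>"
  shows "path_dist T v w \<le> \<eta>"
  unfolding path_dist_def using assms by (intro cSUP_least) (auto intro: min.coboundedI2)

lemma path_dist_nonneg: "T \<ge> 0 \<Longrightarrow> 0 \<le> path_dist T v w"
  by (rule order_trans[OF _ path_dist_upper[of 0]]) auto

lemma path_dist_triangle:
  assumes "T \<ge> 0"
  shows "path_dist T u w \<le> path_dist T u v + path_dist T v w"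
  unfolding path_dist_def[of T u w]
proof (rule cSUP_least)
  fix s assume s: "s \<in> {0..T}"
  have "min 1 (dist (u s) (w s)) \<le> min 1 (dist (u s) (v s)) + min 1 (dist (v s) (w s))"
    using dist_triangle[of "u s" "w s" "v s"] zero_le_dist[of "u s" "v s"] zero_le_dist[of "v s" "w s"]
    unfolding min_def by (simp split: if_splits del: zero_le_dist)
  then show "min 1 (dist (u s) (w s)) \<le> path_dist T u v + path_dist T v w"
    using path_dist_upper[OF s, of u v] path_dist_upper[OF s, of v w] by linarith
qed (use assms in auto)

text \<open>The largest \<open>k\<close>-Lipschitz minorant of \<open>g\<close> for the uniform distance on \<open>[0,k]\<close> truncated at 1. It stands
  in for the uniform continuity that a J1-continuous function need not have, and increases to \<open>g\<close>.\<close>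

definition envelope :: "((real \<Rightarrow> 'b::metric_space) \<Rightarrow> real) \<Rightarrow> real \<Rightarrow> (real \<Rightarrow> 'b) \<Rightarrow> real" where
  "envelope g k v = (INF w\<in>{w. cadlag w}. g w + k * path_dist k v w)"

text \<open>Continuity at each cadlag path for the topology of locally uniform convergence.
  \<open>T\<close> and \<open>d\<close> may depend on \<open>v\<close>, so this is weaker than
  uniform continuity.\<close>

definition locally_uniformly_continuous :: "((real \<Rightarrow> 'b::metric_space) \<Rightarrow> real) \<Rightarrow> bool" where
  "locally_uniformly_continuous g \<longleftrightarrow> (\<forall>v e. cadlag v \<longrightarrow> e > 0 \<longrightarrow> (\<exists>T>0. \<exists>d>0. \<forall>w. cadlag w \<longrightarrow>
      (\<forall>s\<in>{0..T}. dist (v s) (w s) < d) \<longrightarrow> \<bar>g w - g v\<bar> < e))"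

context
  fixes g :: "(real \<Rightarrow> 'b::metric_space) \<Rightarrow> real" and C :: real
  assumes bound: "\<And>v. \<bar>g v\<bar> \<le> C"
begin

lemma bdd_below_envelope: "k \<ge> 0 \<Longrightarrow> bdd_below ((\<lambda>w. g w + k * path_dist k v w) ` {w. cadlag w})"
proof (rule bdd_belowI2[of _ "- C"])
  fix w assume "k \<ge> 0"
  then have "k * path_dist k v w \<ge> 0" by (simp add: path_dist_nonneg)
  then show "- C \<le> g w + k * path_dist k v w" using bound[of w] by linarith
qed

lemma envelope_ge: "k \<ge> 0 \<Longrightarrow> - C \<le> envelope g k v"
  unfolding envelope_def
proof (rule cINF_greatest)
  show "{w :: real \<Rightarrow> 'b. cadlag w} \<noteq> {}" using cadlag_const by auto
  fix w assume "k \<ge> 0"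
  then have "k * path_dist k v w \<ge> 0" by (simp add: path_dist_nonneg)
  then show "- C \<le> g w + k * path_dist k v w" using bound[of w] by linarith
qed

lemma envelope_lower: "k \<ge> 0 \<Longrightarrow> cadlag w \<Longrightarrow> envelope g k v \<le> g w + k * path_dist k v w"
  unfolding envelope_def by (rule cINF_lower[OF bdd_below_envelope]) auto

lemma envelope_le: "k \<ge> 0 \<Longrightarrow> cadlag v \<Longrightarrow> envelope g k v \<le> g v"
  using envelope_lower[of k v v] path_dist_le[of k v v 0] by (smt (verit) dist_self mult_nonneg_nonpos)

text \<open>By the triangle inequality the envelope is an infimum of functions that are
  \<open>k\<close>-Lipschitz in \<open>v\<close>.\<close>

lemma envelope_lipschitz:
  assumes k: "k \<ge> 0"
  shows "\<bar>envelope g k u - envelope g k v\<bar> \<le> k * path_dist k u v"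
proof -
  have *: "envelope g k u - k * path_dist k u v \<le> envelope g k v" for u v
    unfolding envelope_def[of g k v]
  proof (rule cINF_greatest)
    show "{w :: real \<Rightarrow> 'b. cadlag w} \<noteq> {}" using cadlag_const by auto
    fix w :: "real \<Rightarrow> 'b" assume "w \<in> {w. cadlag w}"
    then have "envelope g k u \<le> g w + k * path_dist k u w" using envelope_lower[OF k] by auto
    also have "\<dots> \<le> g w + k * (path_dist k u v + path_dist k v w)"
      using path_dist_triangle[OF k] k by (intro add_left_mono mult_left_mono)
    finally show "envelope g k u - k * path_dist k u v \<le> g w + k * path_dist k v w" by (simp add: algebra_simps)
  qed
  have "path_dist k v u = path_dist k u v" by (simp add: path_dist_def dist_commute)
  then show ?thesis using *[of u v] *[of v u] by (simp add: abs_le_iff)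
qed

text \<open>A competitor \<open>w\<close> close to \<open>v\<close> on \<open>[0,T]\<close> has
  \<open>g w\<close> close to \<open>g v\<close>; any other pays a penalty of at least
  \<open>k * min 1 d\<close>, which outweighs the largest possible gain
  \<open>2 * C\<close>.\<close>

lemma envelope_tendsto:
  assumes g: "locally_uniformly_continuous g" and v: "cadlag v"
  shows "(\<lambda>k::nat. envelope g (real k) v) \<longlonglongrightarrow> g v"
proof (rule tendstoI)
  fix e :: real assume e: "e > 0"
  obtain T d where Td: "T > 0" "d > 0" "\<forall>w. cadlag w \<longrightarrow>
      (\<forall>s\<in>{0..T}. dist (v s) (w s) < d) \<longrightarrow> \<bar>g w - g v\<bar> < e / 2"
    using g[unfolded locally_uniformly_continuous_def, rule_format, OF v half_gt_zero[OF e]]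
    by (elim exE conjE)
  note ev = filterlim_real_sequentially[unfolded filterlim_at_top, rule_format]
  \<comment> \<open>The two conditions say that the penalty exceeds \<open>2 * C\<close> and that
    the horizon \<open>k\<close> of the envelope covers \<open>[0,T]\<close>.\<close>
  have "\<forall>\<^sub>F k in sequentially. T + 2 * C / min 1 d \<le> real k" by (rule ev)
  moreover have "\<forall>\<^sub>F k in sequentially. T \<le> real k" by (rule ev)
  ultimately show "\<forall>\<^sub>F k in sequentially. dist (envelope g (real k) v) (g v) < e"
  proof eventually_elim
    case (elim k)
    have md: "min 1 d > 0" using Td by simp
    have "2 * C / min 1 d \<le> k" using elim Td by linarith
    then have kd: "2 * C \<le> k * min 1 d" using md by (simp add: pos_divide_le_eq)
    have "g v - e / 2 \<le> envelope g k v"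
      unfolding envelope_def
    proof (rule cINF_greatest)
      show "{w :: real \<Rightarrow> 'b. cadlag w} \<noteq> {}" using cadlag_const by auto
      fix w :: "real \<Rightarrow> 'b" assume "w \<in> {w. cadlag w}"
      then have w: "cadlag w" by simp
      show "g v - e / 2 \<le> g w + k * path_dist k v w"
      proof (cases "\<forall>s\<in>{0..T}. dist (v s) (w s) < d")
        case True
        then have "\<bar>g w - g v\<bar> < e / 2" using Td(3) w by blast
        moreover have "k * path_dist k v w \<ge> 0" by (simp add: path_dist_nonneg)
        ultimately show ?thesis by linarith
      next
        case False
        then obtain s where s: "s \<in> {0..T}" "dist (v s) (w s) \<ge> d" by force
        then have "s \<in> {0..real k}" using elim by auto
        then have "min 1 d \<le> path_dist k v w"
          using path_dist_upper[of s k v w] s(2) by linarith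
        then have "k * min 1 d \<le> k * path_dist k v w" by (intro mult_left_mono) auto
        then show ?thesis using kd bound[of v] bound[of w] e by linarith
      qed
    qed
    moreover have "envelope g k v \<le> g v" by (rule envelope_le) (use v in auto)
    ultimately show ?case using e by (simp add: dist_real_def)
  qed
qed

text \<open>On \<open>[0,k]\<close> a step path takes only the finitely many values with index at
  most \<open>m * k\<close>, so coordinatewise convergence is uniform there.\<close>

lemma envelope_step_tendsto:
  assumes k: "k \<ge> 0" and m: "m > 0" and z: "\<And>j. real j \<le> m * k \<Longrightarrow> (\<lambda>n. z n j) \<longlonglongrightarrow> z' j"
  shows "(\<lambda>n. envelope g k (step_path m (z n))) \<longlonglongrightarrow> envelope g k (step_path m z')"
proof (rule tendstoI)
  fix e :: real assume e: "e > 0"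
  \<comment> \<open>\<open>k + 1\<close> instead of \<open>k\<close> keeps the denominator positive
    for \<open>k = 0\<close>.\<close>
  define \<eta> where "\<eta> = e / (2 * (k + 1))"
  have \<eta>: "\<eta> > 0" "k * \<eta> < e" using e k by (auto simp: \<eta>_def field_simps intro: add_nonneg_pos)
  have "finite {j. real j \<le> m * k}"
    by (rule finite_subset[of _ "{..nat \<lfloor>m * k\<rfloor>}"]) (auto simp: le_nat_floor)
  then have "\<forall>\<^sub>F n in sequentially. \<forall>j\<in>{j. real j \<le> m * k}. dist (z n j) (z' j) < \<eta>"
    by (rule eventually_ball_finite) (auto intro!: tendstoD[OF z] \<eta>)
  then show "\<forall>\<^sub>F n in sequentially. dist (envelope g k (step_path m (z n))) (envelope g k (step_path m z')) < e"
  proof eventually_elim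
    case (elim n)
    have "path_dist k (step_path m (z n)) (step_path m z') \<le> \<eta>"
    proof (rule path_dist_le[OF k])
      fix s assume s: "s \<in> {0..k}"
      have "m * s \<le> m * k" using s m by (intro mult_left_mono) auto
      moreover have "real (nat \<lfloor>m * s\<rfloor>) \<le> m * s" using s m by (simp add: of_nat_floor)
      ultimately have "real (nat \<lfloor>m * s\<rfloor>) \<le> m * k" by linarith
      then show "dist (step_path m (z n) s) (step_path m z' s) \<le> \<eta>"
        using elim s by (auto simp: step_path_def less_imp_le)
    qed
    then have "k * path_dist k (step_path m (z n)) (step_path m z') \<le> k * \<eta>" using k by (rule mult_left_mono)
    then show ?case using envelope_lipschitz[OF k, of "step_path m (z n)" "step_path m z'"] \<eta> by (simp add: dist_real_def)
  qed
qed

end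

section \<open>Functional convergence\<close>

text \<open>Number of cells times the exponential bound per cell. In terms of
  \<open>x = e * sqrt m\<close> the factor \<open>m + 1\<close> is
  \<open>x\<^sup>2 / e\<^sup>2 + 1\<close>, hence the powers 2 and 0.\<close>

lemma sqrt_exp_decay:
  fixes e b :: real
  assumes e: "e > 0"
  shows "(\<lambda>m::nat. (real m + 1) * exp (b - e * sqrt (real m))) \<longlonglongrightarrow> 0"
proof -
  have "filterlim (\<lambda>m. e * sqrt (real m)) at_top sequentially"
    using e by (intro filterlim_tendsto_pos_mult_at_top[OF tendsto_const]
      filterlim_compose[OF sqrt_at_top filterlim_real_sequentially])
  then have p: "(\<lambda>m. (e * sqrt (real m)) ^ k / exp (e * sqrt (real m))) \<longlonglongrightarrow> 0" for k
    by (rule filterlim_compose[OF tendsto_power_div_exp_0])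
  have "(\<lambda>m. exp b * ((e * sqrt (real m)) ^ 2 / exp (e * sqrt (real m)) / e\<^sup>2 +
      (e * sqrt (real m)) ^ 0 / exp (e * sqrt (real m)))) \<longlonglongrightarrow> exp b * (0 / e\<^sup>2 + 0)"
    using e by (intro tendsto_intros p) auto
  also have "(\<lambda>m. exp b * ((e * sqrt (real m)) ^ 2 / exp (e * sqrt (real m)) / e\<^sup>2 +
      (e * sqrt (real m)) ^ 0 / exp (e * sqrt (real m)))) = (\<lambda>m. (real m + 1) * exp (b - e * sqrt (real m)))"
    using e by (auto simp: fun_eq_iff power_mult_distrib exp_diff field_simps)
  finally show ?thesis by simp
qed

section \<open>Measurability, independence and approximation on grids\<close>

lemma borel_measurable_vec_lambda [measurable (raw)]:
  fixes f :: "'k::finite \<Rightarrow> 'a \<Rightarrow> real"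
  assumes "\<And>i. f i \<in> borel_measurable M"
  shows "(\<lambda>x. \<chi> i. f i x) \<in> borel_measurable M"
proof (rule borel_measurable_euclidean_space[THEN iffD2], rule ballI)
  fix b :: "real ^ 'k" assume "b \<in> Basis"
  then obtain i where "b = axis i 1" by (auto simp: Basis_vec_def)
  then show "(\<lambda>x. (\<chi> i. f i x) \<bullet> b) \<in> borel_measurable M"
    using assms by (simp add: inner_axis)
qed

lemma envelope_step_measurable:
  fixes g :: "(real \<Rightarrow> 'b::{metric_space, second_countable_topology}) \<Rightarrow> real"
  assumes bound: "\<And>v. \<bar>g v\<bar> \<le> C" and k: "k \<ge> 0" and m: "m > 0"
  shows "(\<lambda>z. envelope g k (step_path m z)) \<in> borel_measurable borel"
proof (rule borel_measurable_continuous_onI, rule continuous_on_sequentiallyI)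
  fix u :: "nat \<Rightarrow> nat \<Rightarrow> 'b" and a assume u: "u \<longlonglongrightarrow> a"
  have "(\<lambda>n. u n j) \<longlonglongrightarrow> a j" for j
    using continuous_on_tendsto_compose[OF continuous_on_product_coordinates u, of j] by simp
  then show "(\<lambda>n. envelope g k (step_path m (u n))) \<longlonglongrightarrow> envelope g k (step_path m a)"
    by (intro envelope_step_tendsto[where g = g, OF bound k m])
qed

lemma process_increments_indep:
  fixes X :: "'k::finite \<Rightarrow> real \<Rightarrow> 'a \<Rightarrow> real"
  assumes "prob_space M" and X: "independent_processes M X" and t: "\<And>j::nat. t j \<ge> 0"
  shows "prob_space.indep_vars M (\<lambda>_. PiM {..<J} (\<lambda>_. borel))
    (\<lambda>i \<omega>. \<lambda>j\<in>{..<J}. X i (t (Suc j)) \<omega> - X i (t j) \<omega>) UNIV"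
proof -
  interpret prob_space M by fact
  have "indep_vars (\<lambda>_. PiM {..<J} (\<lambda>_. borel))
    (\<lambda>i \<omega>. (\<lambda>p. \<lambda>j\<in>{..<J}. p (t (Suc j)) - p (t j)) (\<lambda>t\<in>{0..}. X i t \<omega>)) UNIV"
    using X unfolding independent_processes_def
  proof (rule indep_vars_compose2)
    show "(\<lambda>p. \<lambda>j\<in>{..<J}. p (t (Suc j)) - p (t j) :: real) \<in> PiM {0..} (\<lambda>_. borel) \<rightarrow>\<^sub>M PiM {..<J} (\<lambda>_. borel)"
      by (rule measurable_restrict) (use t in \<open>auto intro!: borel_measurable_diff measurable_component_singleton\<close>)
  qed
  then show ?thesis using t by (simp cong: restrict_cong)
qed

text \<open>For continuous paths the skeletons converge uniformly with no time change. The cap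
  \<open>min _ k\<close> leaves the path on \<open>[0,k]\<close> as it is and makes the skeleton a
  function of the values at the grid points up to time \<open>k\<close>.\<close>

lemma continuous_skeleton:
  fixes v :: "real \<Rightarrow> 'b::metric_space"
  assumes v: "continuous_on {0..} v" and k: "k \<ge> 0"
  shows "(\<lambda>m::nat. path_dist k v (step_path (real m) (\<lambda>j. v (min (real j / real m) k)))) \<longlonglongrightarrow> 0"
proof (rule tendstoI)
  fix e :: real assume e: "e > 0"
  have "uniformly_continuous_on {0..k} v"
    by (rule compact_uniformly_continuous) (auto intro: continuous_on_subset[OF v])
  then obtain d where d: "d > 0" "\<And>s t. s \<in> {0..k} \<Longrightarrow> t \<in> {0..k} \<Longrightarrow> dist s t < d \<Longrightarrow> dist (v s) (v t) < e / 2"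
    unfolding uniformly_continuous_on_def using half_gt_zero[OF e] by metis
  have "\<forall>\<^sub>F m in sequentially. 1 / real m < d" using lim_1_over_n d(1) by (rule order_tendstoD(2))
  then show "\<forall>\<^sub>F m in sequentially. dist (path_dist k v (step_path (real m) (\<lambda>j. v (min (real j / real m) k)))) 0 < e"
    using eventually_gt_at_top[of 0]
  proof eventually_elim
    case (elim m)
    then have m: "real m > 0" by simp
    have "path_dist k v (step_path (real m) (\<lambda>j. v (min (real j / real m) k))) \<le> e / 2"
    proof (rule path_dist_le[OF k])
      fix s assume s: "s \<in> {0..k}"
      define j where "j = nat \<lfloor>m * s\<rfloor>"
      have "m * s - 1 < real j" "real j \<le> m * s" using s m by (auto simp: j_def of_nat_floor) 
      then have "(m * s - 1) / m < real j / m" "real j / m \<le> m * s / m"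
        using divide_strict_right_mono[OF _ m] divide_right_mono[OF _ less_imp_le[OF m]] by blast+
      then have js: "s - 1 / m < real j / m" "real j / m \<le> s" using m by (auto simp: diff_divide_distrib)
      then have "min (real j / m) k = real j / m" "dist s (real j / m) < d" "real j / m \<in> {0..k}"
        using s elim by (auto simp: dist_real_def)
      then have "dist (v s) (v (min (real j / m) k)) < e / 2" using d(2)[OF s] by simp
      then show "dist (v s) (step_path (real m) (\<lambda>j. v (min (real j / real m) k)) s) \<le> e / 2"
        using s by (simp add: step_path_def j_def)
    qed
    then show ?case
      using path_dist_nonneg[OF k, of v "step_path (real m) (\<lambda>j. v (min (real j / real m) k))"] e
      unfolding dist_real_def by linarith
  qed
qed

text \<open>Only the lower bound is needed: the upper one is the same statement for \<open>-g\<close>. No measurability of the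
  envelope is used outside skeletons, which depend on finitely many coordinates.\<close>

lemma functional_convergence_lower:
  fixes X :: "nat \<Rightarrow> 'k::finite \<Rightarrow> real \<Rightarrow> 'a \<Rightarrow> real" and W :: "'k \<Rightarrow> real \<Rightarrow> 'a \<Rightarrow> real"
    and \<mu> :: "real \<Rightarrow> nat \<Rightarrow> real measure"
  assumes M: "prob_space M"
    and X: "\<And>n i. levy_process M (X n i)" "\<And>n. independent_processes M (X n)"
    and Xpath: "\<And>n i \<omega>. \<omega> \<in> space M \<Longrightarrow> cadlag (\<lambda>t. X n i t \<omega>) \<and> X n i 0 \<omega> = 0"
    and Xlaw: "\<And>n i h. h > 0 \<Longrightarrow> distr M borel (X n i h) = \<mu> h n"
    and W: "\<And>i. levy_process M (W i)" "independent_processes M W"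
    and Wpath: "\<And>i \<omega>. \<omega> \<in> space M \<Longrightarrow> continuous_on {0..} (\<lambda>t. W i t \<omega>) \<and> W i 0 \<omega> = 0"
    and Wlaw: "\<And>i h. h > 0 \<Longrightarrow> distr M borel (W i h) = \<nu> h"
    and conv: "\<And>h. h > 0 \<Longrightarrow> weak_conv_m (\<mu> h) (\<nu> h)"
    and tail: "\<And>m \<epsilon>. m > 0 \<Longrightarrow> \<epsilon> > 0 \<Longrightarrow> \<forall>\<^sub>F n in sequentially. \<forall>l. 0 < l \<and> l \<le> 1 / real m \<longrightarrow>
      measure (\<mu> l n) {x. \<bar>x\<bar> \<ge> \<epsilon>} \<le> 2 * exp (b - \<epsilon> * sqrt (real m))"
    and bound: "\<And>v. \<bar>g v\<bar> \<le> C" and luc: "locally_uniformly_continuous g"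
    and gX: "\<And>n. (\<lambda>\<omega>. g (\<lambda>t. \<chi> i. X n i t \<omega>)) \<in> borel_measurable M"
    and gW: "(\<lambda>\<omega>. g (\<lambda>t. \<chi> i. W i t \<omega>)) \<in> borel_measurable M"
    and \<delta>: "\<delta> > 0"
  shows "\<forall>\<^sub>F n in sequentially. (\<integral>\<omega>. g (\<lambda>t. \<chi> i. X n i t \<omega>) \<partial>M) \<ge> (\<integral>\<omega>. g (\<lambda>t. \<chi> i. W i t \<omega>) \<partial>M) - \<delta>"
proof -
  interpret prob_space M by fact
  have C: "C \<ge> 0" using bound[of undefined] by linarith
  let ?V = "\<lambda>n \<omega> t. \<chi> i. X n i t \<omega>" and ?W = "\<lambda>\<omega> t. \<chi> i. W i t \<omega>"
  let ?sk = "\<lambda>k m v. step_path (real m) (\<lambda>j. v (min (real j / real m) (real k)) :: real ^ 'k)"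
  let ?GV = "\<lambda>n. \<integral>\<omega>. g (?V n \<omega>) \<partial>M" and ?GW = "\<integral>\<omega>. g (?W \<omega>) \<partial>M"
  let ?E = "\<lambda>k. \<integral>\<omega>. envelope g (real k) (?W \<omega>) \<partial>M"
  let ?EW = "\<lambda>k m. \<integral>\<omega>. envelope g (real k) (?sk k m (?W \<omega>)) \<partial>M"
  let ?EV = "\<lambda>k m n. \<integral>\<omega>. envelope g (real k) (?sk k m (?V n \<omega>)) \<partial>M"
  have Xm: "X n i t \<in> borel_measurable M" and Wm: "W i t \<in> borel_measurable M" if "t \<ge> 0" for n i t
    using levy_process_measurable[OF X(1) that] levy_process_measurable[OF W(1) that] by auto
  have Vcad: "cadlag (?V n \<omega>)" if "\<omega> \<in> space M" for n \<omega>
    using Xpath[OF that] by (intro cadlag_vec) auto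
  have Wcont: "continuous_on {0..} (?W \<omega>)" if "\<omega> \<in> space M" for \<omega>
    using Wpath[OF that] by (intro continuous_on_vec_lambda) auto
  have Wcad: "cadlag (?W \<omega>)" if "\<omega> \<in> space M" for \<omega>
    using Wcont[OF that] by (rule continuous_cadlag)
  have skel_cad: "cadlag (?sk k m v)" if "m > 0" for k m v
    using step_path_cadlag[of "real m"] that by (auto simp: skorokhod_space_def)
  have sk_meas: "(\<lambda>\<omega>. envelope g (real k) (?sk k m (\<lambda>t. \<chi> i. F i t \<omega>))) \<in> borel_measurable M"
    if "m > 0" and F: "\<And>i t. t \<ge> 0 \<Longrightarrow> F i t \<in> borel_measurable M" for k m :: nat and F :: "'k \<Rightarrow> real \<Rightarrow> 'a \<Rightarrow> real"
  proof -
    have "(\<lambda>\<omega> j. \<chi> i. F i (min (real j / real m) (real k)) \<omega>) \<in> borel_measurable M"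
      by (intro measurable_coordinatewise_then_product borel_measurable_vec_lambda F) auto
    then show ?thesis
      by (rule measurable_compose) (use that in \<open>auto intro!: envelope_step_measurable bound\<close>)
  qed
  have env_bound: "\<bar>envelope g (real k) v\<bar> \<le> C" if "cadlag v" for k v
    using envelope_ge[where g = g, OF bound, of "real k" v] envelope_le[where g = g, OF bound, of "real k" v] that bound[of v] by auto

  \<comment> \<open>Continuity of the paths of \<open>W\<close> enters here: the envelope is
    Lipschitz for the uniform distance, not for a J1 distance.\<close>
  have lim_m: "(\<lambda>m. envelope g (real k) (?sk k m (?W \<omega>))) \<longlonglongrightarrow> envelope g (real k) (?W \<omega>)"
    if "\<omega> \<in> space M" for k \<omega>
  proof (rule Lim_null[THEN iffD2], rule Lim_null_comparison)
    show "\<forall>\<^sub>F m in sequentially. norm (envelope g (real k) (?sk k m (?W \<omega>)) - envelope g (real k) (?W \<omega>))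
        \<le> real k * path_dist k (?W \<omega>) (?sk k m (?W \<omega>))"
      by (intro always_eventually allI, subst real_norm_def, subst abs_minus_commute)
         (rule envelope_lipschitz[where g = g, OF bound], simp)
    have "(\<lambda>m. real k * path_dist k (?W \<omega>) (?sk k m (?W \<omega>))) \<longlonglongrightarrow> real k * 0"
      by (intro tendsto_intros continuous_skeleton Wcont that) auto
    then show "(\<lambda>m. real k * path_dist k (?W \<omega>) (?sk k m (?W \<omega>))) \<longlonglongrightarrow> 0" by simp
  qed
  \<comment> \<open>The envelope is an infimum over uncountably many paths; along \<open>W\<close>
    it is measurable as a limit of values on skeletons.\<close>
  have env_meas: "(\<lambda>\<omega>. envelope g (real k) (?W \<omega>)) \<in> borel_measurable M" for k
    by (rule borel_measurable_LIMSEQ_real[where u = "\<lambda>m \<omega>. envelope g (real k) (?sk k (Suc m) (?W \<omega>))"])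
       (auto intro!: sk_meas Wm LIMSEQ_Suc lim_m simp del: of_nat_Suc)
  have E_k: "(\<lambda>k. ?E k) \<longlonglongrightarrow> ?GW"
    by (rule integral_dominated_convergence[where w = "\<lambda>_. C"])
       (use env_meas gW env_bound Wcad in \<open>auto intro!: AE_I2 envelope_tendsto[where g = g, OF bound luc]\<close>)
  have E_m: "(\<lambda>m. ?EW k (Suc m)) \<longlonglongrightarrow> ?E k" for k
  proof (rule integral_dominated_convergence[where w = "\<lambda>_. C"])
    show "AE \<omega> in M. norm (envelope g (real k) (?sk k (Suc m) (?W \<omega>))) \<le> C" for m
      unfolding real_norm_def by (intro AE_I2 env_bound skel_cad) simp
    show "AE \<omega> in M. (\<lambda>m. envelope g (real k) (?sk k (Suc m) (?W \<omega>))) \<longlonglongrightarrow> envelope g (real k) (?W \<omega>)"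
      by (intro AE_I2 LIMSEQ_Suc lim_m)
  qed (use env_meas in \<open>auto intro!: sk_meas Wm simp del: of_nat_Suc\<close>)

  have E_n: "(\<lambda>n. ?EV k m n) \<longlonglongrightarrow> ?EW k m"
    if km: "k > 0" "m > 0" for k m :: nat
  proof -
    define J where "J = m * k"
    define t where "t j = real j / real m" for j :: nat
    have t: "t j \<ge> 0" "t 0 = 0" "t (Suc j) = t j + 1 / m" for j by (auto simp: t_def add_divide_distrib)
    have "mono t" by (auto simp: mono_def t_def divide_right_mono)
    have m1: "1 / real m > 0" using km by simp
    \<comment> \<open>The partial sums stop at \<open>J\<close>, in step with the cap of the
      skeleton, so \<open>H\<close> depends on \<open>J\<close> increments per coordinate.\<close>
    define Z :: "('k \<Rightarrow> nat \<Rightarrow> real) \<Rightarrow> nat \<Rightarrow> real ^ 'k" where "Z x j = (\<chi> i. \<Sum>l<min j J. x i l)" for x j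
    define H where "H x = envelope g (real k) (step_path (real m) (Z x))" for x
    have HX: "H (\<lambda>i. \<lambda>j\<in>{..<J}. F i (t (Suc j)) \<omega> - F i (t j) \<omega>) = envelope g (real k) (?sk k m (\<lambda>t. \<chi> i. F i t \<omega>))"
      if "\<And>i. F i 0 \<omega> = 0" for F :: "'k \<Rightarrow> real \<Rightarrow> 'a \<Rightarrow> real" and \<omega>
    proof -
      have "Z (\<lambda>i. \<lambda>j\<in>{..<J}. F i (t (Suc j)) \<omega> - F i (t j) \<omega>) j = (\<chi> i. F i (min (real j / real m) (real k)) \<omega>)" for j
      proof -
        have "(\<Sum>l<min j J. (\<lambda>j\<in>{..<J}. F i (t (Suc j)) \<omega> - F i (t j) \<omega>) l) = F i (t (min j J)) \<omega> - F i (t 0) \<omega>" for i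
          by (subst sum_lessThan_telescope[symmetric]) (auto intro!: sum.cong)
        moreover have "t (min j J) = min (real j / real m) (real k)"
          using km by (auto simp: t_def J_def min_def field_simps simp flip: of_nat_mult)
        ultimately show ?thesis using that by (simp add: Z_def t(2))
      qed
      then have "Z (\<lambda>i. \<lambda>j\<in>{..<J}. F i (t (Suc j)) \<omega> - F i (t j) \<omega>) = (\<lambda>j. \<chi> i. F i (min (real j / real m) (real k)) \<omega>)"
        by (rule ext)
      then show ?thesis by (simp only: H_def)
    qed
    have "(\<lambda>n. \<integral>\<omega>. H (\<lambda>i. \<lambda>j\<in>{..<J}. X n i (t (Suc j)) \<omega> - X n i (t j) \<omega>) \<partial>M)
        \<longlonglongrightarrow> (\<integral>\<omega>. H (\<lambda>i. \<lambda>j\<in>{..<J}. W i (t (Suc j)) \<omega> - W i (t j) \<omega>) \<partial>M)"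
    proof (rule array_weak_convergence[where \<mu> = "\<mu> (1 / m)" and \<nu> = "\<nu> (1 / m)" and C = "C"])
      show "prob_space M" "J > 0" using M km by (auto simp: J_def)
      show "indep_vars (\<lambda>_. PiM {..<J} (\<lambda>_. borel)) (\<lambda>i \<omega>. \<lambda>j\<in>{..<J}. X n i (t (Suc j)) \<omega> - X n i (t j) \<omega>) UNIV" for n
        by (rule process_increments_indep[OF M X(2) t(1)])
      show "indep_vars (\<lambda>_. PiM {..<J} (\<lambda>_. borel)) (\<lambda>i \<omega>. \<lambda>j\<in>{..<J}. W i (t (Suc j)) \<omega> - W i (t j) \<omega>) UNIV"
        by (rule process_increments_indep[OF M W(2) t(1)])
      show "indep_vars (\<lambda>_. borel) (\<lambda>j \<omega>. X n i (t (Suc j)) \<omega> - X n i (t j) \<omega>) {..<J}" for n i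
        using X(1) t(1) \<open>mono t\<close> by (rule levy_process_indep)
      show "indep_vars (\<lambda>_. borel) (\<lambda>j \<omega>. W i (t (Suc j)) \<omega> - W i (t j) \<omega>) {..<J}" for i
        using W(1) t(1) \<open>mono t\<close> by (rule levy_process_indep)
      show "distr M borel (\<lambda>\<omega>. X n i (t (Suc j)) \<omega> - X n i (t j) \<omega>) = \<mu> (1 / m) n" for n i j
        unfolding t(3) using levy_process_increment[OF X(1) t(1) less_imp_le[OF m1]] Xlaw[OF m1] by simp
      show "distr M borel (\<lambda>\<omega>. W i (t (Suc j)) \<omega> - W i (t j) \<omega>) = \<nu> (1 / m)" for i j
        unfolding t(3) using levy_process_increment[OF W(1) t(1) less_imp_le[OF m1]] Wlaw[OF m1] by simp
      show "weak_conv_m (\<mu> (1 / m)) (\<nu> (1 / m))" using m1 by (rule conv)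
      \<comment> \<open>\<open>undefined\<close> is an arbitrary index: the law is the same for all
        coordinates.\<close>
      show "real_distribution (\<mu> (1 / m) n)" for n
        unfolding Xlaw[OF m1, of n undefined, symmetric] by (rule real_distribution_distr) (use Xm m1 in auto)
      show "real_distribution (\<nu> (1 / m))"
        unfolding Wlaw[OF m1, of undefined, symmetric] by (rule real_distribution_distr) (use Wm m1 in auto)
      show "\<bar>H x\<bar> \<le> C" for x
        unfolding H_def by (rule env_bound) (use step_path_cadlag[of "real m"] km in \<open>auto simp: skorokhod_space_def\<close>)
      have "(\<lambda>x. x i l :: real) \<in> borel_measurable (PiM UNIV (\<lambda>_. PiM {..<J} (\<lambda>_. borel)))" if "l < J" for i :: 'k and l
      proof -
        have 1: "(\<lambda>x::'k \<Rightarrow> nat \<Rightarrow> real. x i) \<in> PiM UNIV (\<lambda>_. PiM {..<J} (\<lambda>_. borel)) \<rightarrow>\<^sub>M PiM {..<J} (\<lambda>_. borel)"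
          by (rule measurable_component_singleton) simp
        have 2: "(\<lambda>y. y l) \<in> PiM {..<J} (\<lambda>_. borel :: real measure) \<rightarrow>\<^sub>M borel"
          by (rule measurable_component_singleton) (use that in simp)
        show ?thesis using measurable_compose[OF 1 2] .
      qed
      then have "Z \<in> borel_measurable (PiM UNIV (\<lambda>_. PiM {..<J} (\<lambda>_. borel)))"
        unfolding Z_def
        by (intro measurable_coordinatewise_then_product borel_measurable_vec_lambda borel_measurable_sum) auto
      then show "H \<in> borel_measurable (PiM UNIV (\<lambda>_. PiM {..<J} (\<lambda>_. borel)))"
        unfolding H_def by (rule measurable_compose) (use km in \<open>auto intro!: envelope_step_measurable bound\<close>)
      fix Y :: "nat \<Rightarrow> 'k \<Rightarrow> nat \<Rightarrow> real" and y assume "\<And>i j. j < J \<Longrightarrow> (\<lambda>n. Y n i j) \<longlonglongrightarrow> y i j"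
      then show "(\<lambda>n. H (Y n)) \<longlonglongrightarrow> H y"
        unfolding H_def Z_def
        by (intro envelope_step_tendsto[where g = g, OF bound] vec_tendstoI) (use km in \<open>auto intro!: tendsto_sum\<close>)
    qed
    moreover have "(\<integral>\<omega>. H (\<lambda>i. \<lambda>j\<in>{..<J}. X n i (t (Suc j)) \<omega> - X n i (t j) \<omega>) \<partial>M) = ?EV k m n" for n
      using Xpath by (intro Bochner_Integration.integral_cong refl HX) auto
    moreover have "(\<integral>\<omega>. H (\<lambda>i. \<lambda>j\<in>{..<J}. W i (t (Suc j)) \<omega> - W i (t j) \<omega>) \<partial>M) = ?EW k m"
      using Wpath by (intro Bochner_Integration.integral_cong refl HX) auto
    ultimately show ?thesis by simp
  qed

  \<comment> \<open>Off a union of exceptional sets, one for each coordinate and cell, path and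
    skeleton differ by at most \<open>2 * \<epsilon>\<close> per coordinate; on that union
    \<open>g\<close> and its envelope on the skeleton differ by at most
    \<open>2 * C\<close>.\<close>
  have osc: "\<forall>\<^sub>F n in sequentially. ?GV n \<ge> ?EV k m n
      - real k * (2 * CARD('k) * \<epsilon>) - 2 * C * (CARD('k) * (m * k + 1) * (4 * exp (b - \<epsilon> * sqrt (real m))))"
    if km: "k > 0" "m > 0" and \<epsilon>: "\<epsilon> > 0" and small: "2 * exp (b - \<epsilon> * sqrt (real m)) \<le> 1 / 2" for k m :: nat and \<epsilon> :: real
    using tail[OF km(2) \<epsilon>]
  proof eventually_elim
    case (elim n)
    define q where "q = 2 * exp (b - \<epsilon> * sqrt (real m))"
    have m1: "1 / real m > 0" using km by simp
    define P where "P i j A \<longleftrightarrow> A \<in> events \<and> prob A \<le> 2 * q \<and> (\<forall>\<omega>\<in>space M - A.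
      \<forall>s\<in>{real j / m..<real j / m + 1 / m}. \<bar>X n i s \<omega> - X n i (real j / m) \<omega>\<bar> \<le> 2 * \<epsilon>)" for i j A
    have "\<exists>A\<in>events. prob A \<le> 2 * q \<and> (\<forall>\<omega>\<in>space M - A. \<forall>s\<in>{real j / m..<real j / m + 1 / m}. \<bar>X n i s \<omega> - X n i (real j / m) \<omega>\<bar> \<le> 2 * \<epsilon>)" for i j
    proof (rule levy_oscillation[OF M X(1) _ _ m1])
      fix l :: real assume l: "0 \<le> l" "l \<le> 1 / m"
      show "prob {\<omega>\<in>space M. \<bar>X n i l \<omega>\<bar> > \<epsilon>} \<le> q"
      \<comment> \<open>The laws are given at positive times only; at time 0 the path
        vanishes.\<close>
      proof (cases "l = 0")
        case True
        then have "{\<omega>\<in>space M. \<bar>X n i l \<omega>\<bar> > \<epsilon>} = {}" using Xpath \<epsilon> by auto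
        then show ?thesis by (simp only: measure_empty) (simp add: q_def)
      next
        case False
        then have lp: "l > 0" using l by simp
        have [measurable]: "X n i l \<in> borel_measurable M" using Xm l by simp
        have "prob {\<omega>\<in>space M. \<bar>X n i l \<omega>\<bar> > \<epsilon>} \<le> prob {\<omega>\<in>space M. \<bar>X n i l \<omega>\<bar> \<ge> \<epsilon>}"
          by (intro finite_measure_mono) auto
        also have "\<dots> = measure (\<mu> l n) {x. \<bar>x\<bar> \<ge> \<epsilon>}"
          unfolding Xlaw[OF lp, of n i, symmetric]
          by (subst measure_distr) (auto simp: vimage_def Int_def conj_commute)
        also have "\<dots> \<le> q" unfolding q_def using elim lp l by auto
        finally show ?thesis .
      qed
    qed (use small Xpath in \<open>auto simp: q_def cadlag_def\<close>)
    then have ex: "\<exists>A. P i j A" for i j unfolding P_def by blast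
    obtain A where "\<And>i j. P i j (A i j)" using ex by metis
    then have A: "\<And>i j. A i j \<in> events" "\<And>i j. prob (A i j) \<le> 2 * q"
      "\<And>i j \<omega> s. \<omega> \<in> space M \<Longrightarrow> \<omega> \<notin> A i j \<Longrightarrow> s \<in> {real j / m..<real j / m + 1 / real m} \<Longrightarrow> \<bar>X n i s \<omega> - X n i (real j / m) \<omega>\<bar> \<le> 2 * \<epsilon>"
      unfolding P_def by blast+
    \<comment> \<open>The index \<open>m * k\<close> is included because \<open>s = k\<close> lies
      in that cell.\<close>
    define U where "U = (\<Union>p\<in>UNIV \<times> {..m * k}. A (fst p) (snd p))"
    have U: "U \<in> events" unfolding U_def using A(1) by auto
    have "prob U \<le> (\<Sum>p\<in>UNIV \<times> {..m * k}. prob (A (fst p) (snd p)))"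
      unfolding U_def by (intro finite_measure_subadditive_finite) (use A(1) in auto)
    also have "\<dots> \<le> real (card ((UNIV :: 'k set) \<times> {..m * k})) * (2 * q)"
      by (rule sum_bounded_above) (use A(2) in auto)
    finally have PU: "prob U \<le> CARD('k) * (m * k + 1) * (2 * q)" by (simp add: card_cartesian_product)
    have pw: "envelope g (real k) (?sk k m (?V n \<omega>)) - real k * (2 * CARD('k) * \<epsilon>) - 2 * C * indicator U \<omega> \<le> g (?V n \<omega>)"
      if \<omega>: "\<omega> \<in> space M" for \<omega>
    proof (cases "\<omega> \<in> U")
      case True
      have "cadlag (?sk k m (?V n \<omega>))" by (rule skel_cad[OF km(2)])
      then have "envelope g (real k) (?sk k m (?V n \<omega>)) \<le> C" using env_bound by (blast intro: abs_le_D1)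
      moreover have "real k * (2 * CARD('k) * \<epsilon>) \<ge> 0" using \<epsilon> by simp
      ultimately show ?thesis using bound[of "?V n \<omega>", unfolded abs_le_iff] unfolding indicator_simps(1)[OF True] by linarith
    next
      case False
      have "path_dist k (?sk k m (?V n \<omega>)) (?V n \<omega>) \<le> 2 * CARD('k) * \<epsilon>"
      proof (rule path_dist_le)
        fix s assume s: "s \<in> {0..real k}"
        define j where "j = nat \<lfloor>m * s\<rfloor>"
        have mp: "real m > 0" using km by simp
        have "m * s < real j + 1" "real j \<le> m * s" using s mp by (auto simp: j_def of_nat_floor)
        then have "m * s / m < (real j + 1) / m" "real j / m \<le> m * s / m"
          using divide_strict_right_mono[OF _ mp] divide_right_mono[OF _ less_imp_le[OF mp]] by blast+
        then have js: "s < real j / m + 1 / m" "real j / m \<le> s" using mp by (auto simp: add_divide_distrib)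
        have "m * s \<le> real m * real k" using s by (intro mult_left_mono) auto
        then have "real j \<le> real (m * k)" using \<open>real j \<le> m * s\<close> by simp
        then have jJ: "j \<le> m * k" by (simp only: of_nat_le_iff)
        have sk: "?sk k m (?V n \<omega>) s = ?V n \<omega> (real j / m)"
          using s js by (simp add: step_path_def j_def[symmetric])
        have "dist (?sk k m (?V n \<omega>) s) (?V n \<omega> s) \<le> (\<Sum>i\<in>UNIV. \<bar>(?V n \<omega> s - ?V n \<omega> (real j / m)) $ i\<bar>)"
          unfolding sk by (subst dist_commute, subst dist_norm) (rule norm_le_l1_cart)
        also have "\<dots> \<le> real CARD('k) * (2 * \<epsilon>)"
        proof (rule sum_bounded_above)
          fix i :: 'k
          have "\<omega> \<notin> A i j" using False jJ by (auto simp: U_def)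
          then show "\<bar>(?V n \<omega> s - ?V n \<omega> (real j / m)) $ i\<bar> \<le> 2 * \<epsilon>" using A(3)[OF \<omega>, of i j s] js by simp
        qed
        finally show "dist (?sk k m (?V n \<omega>) s) (?V n \<omega> s) \<le> 2 * CARD('k) * \<epsilon>" by simp
      qed auto
      then have "real k * path_dist k (?sk k m (?V n \<omega>)) (?V n \<omega>) \<le> real k * (2 * CARD('k) * \<epsilon>)"
        by (rule mult_left_mono) auto
      moreover have "\<bar>envelope g (real k) (?sk k m (?V n \<omega>)) - envelope g (real k) (?V n \<omega>)\<bar> \<le> real k * path_dist k (?sk k m (?V n \<omega>)) (?V n \<omega>)"
        by (rule envelope_lipschitz[where g = g, OF bound]) auto
      moreover have "envelope g (real k) (?V n \<omega>) \<le> g (?V n \<omega>)"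
        using Vcad[OF \<omega>] by (intro envelope_le[where g = g, OF bound]) auto
      ultimately show ?thesis unfolding indicator_simps(2)[OF False] by linarith
    qed
    have i1: "integrable M (\<lambda>\<omega>. envelope g (real k) (?sk k m (?V n \<omega>)))"
    proof (rule integrable_const_bound[where B = C])
      show "AE \<omega> in M. norm (envelope g (real k) (?sk k m (?V n \<omega>))) \<le> C"
        unfolding real_norm_def by (intro AE_I2 env_bound skel_cad km)
    qed (intro sk_meas km Xm)
    have i2: "integrable M (\<lambda>\<omega>. g (?V n \<omega>))"
      by (rule integrable_const_bound[where B = C]) (use bound gX in auto)
    have i3: "integrable M (indicator U :: 'a \<Rightarrow> real)" using U by (simp add: emeasure_eq_measure)
    have "(\<integral>\<omega>. envelope g (real k) (?sk k m (?V n \<omega>)) - real k * (2 * CARD('k) * \<epsilon>) - 2 * C * indicator U \<omega> \<partial>M) \<le> ?GV n"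
      by (rule integral_mono) (use i1 i2 i3 pw in auto)
    also have "(\<integral>\<omega>. envelope g (real k) (?sk k m (?V n \<omega>)) - real k * (2 * CARD('k) * \<epsilon>) - 2 * C * indicator U \<omega> \<partial>M)
      = ?EV k m n - real k * (2 * CARD('k) * \<epsilon>) - 2 * C * prob U"
      using i1 i3 U by (simp add: prob_space)
    finally have "?EV k m n - real k * (2 * CARD('k) * \<epsilon>) - 2 * C * prob U \<le> ?GV n" .
    moreover have "2 * C * prob U \<le> 2 * C * (CARD('k) * (m * k + 1) * (2 * q))"
      using PU C by (intro mult_left_mono) auto
    moreover have "2 * q = 4 * exp (b - \<epsilon> * sqrt (real m))" by (simp add: q_def)
    ultimately show ?case by (simp only:)
  qed

  \<comment> \<open>Budget for \<open>\<delta>\<close>: a quarter each for the envelope, for the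
    skeleton of \<open>W\<close> and for the oscillation, an eighth each for the convergence of
    skeletons and for the bad cells.\<close>
  have "\<forall>\<^sub>F k in sequentially. ?E k > ?GW - \<delta> / 4"
    using order_tendstoD(1)[OF E_k] \<delta> by simp
  then have "\<forall>\<^sub>F k in sequentially. ?E k > ?GW - \<delta> / 4 \<and> k > 0"
    using eventually_gt_at_top[of 0] by (rule eventually_conj)
  then obtain k where k: "?E k > ?GW - \<delta> / 4" "k > 0"
    by (auto dest!: eventually_happens)
  \<comment> \<open>Chosen so that the Lipschitz loss in \<open>osc\<close> is
    \<open>\<delta> / 4\<close>.\<close>
  define \<epsilon> where "\<epsilon> = \<delta> / (8 * real k * CARD('k))"
  have \<epsilon>: "\<epsilon> > 0" "real k * (2 * CARD('k) * \<epsilon>) = \<delta> / 4" using \<delta> k by (auto simp: \<epsilon>_def field_simps)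
  note dec = LIMSEQ_Suc[OF sqrt_exp_decay[OF \<epsilon>(1), of b]]
  have "(\<lambda>m. (8 * C * CARD('k) * real k) * ((real (Suc m) + 1) * exp (b - \<epsilon> * sqrt (real (Suc m))))) \<longlonglongrightarrow> (8 * C * CARD('k) * real k) * 0"
    by (intro tendsto_intros dec)
  then have ev1: "\<forall>\<^sub>F m in sequentially. (8 * C * CARD('k) * real k) * ((real (Suc m) + 1) * exp (b - \<epsilon> * sqrt (real (Suc m)))) < \<delta> / 8"
    using \<delta> by (auto dest!: order_tendstoD(2)[where a = "\<delta> / 8"] simp del: of_nat_Suc)
  \<comment> \<open>Secures the tail probability at most 1/2 that Ottaviani's inequality asks
    for.\<close>
  have ev2: "\<forall>\<^sub>F m in sequentially. (real (Suc m) + 1) * exp (b - \<epsilon> * sqrt (real (Suc m))) < 1 / 4"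
    using dec by (auto dest!: order_tendstoD(2)[where a = "1 / 4"] simp del: of_nat_Suc)
  have ev3: "\<forall>\<^sub>F m in sequentially. ?EW k (Suc m) > ?E k - \<delta> / 4"
    using order_tendstoD(1)[OF E_m] \<delta> by simp
  obtain m' where m': "(8 * C * CARD('k) * real k) * ((real (Suc m') + 1) * exp (b - \<epsilon> * sqrt (real (Suc m')))) < \<delta> / 8"
    "(real (Suc m') + 1) * exp (b - \<epsilon> * sqrt (real (Suc m'))) < 1 / 4"
    "?EW k (Suc m') > ?E k - \<delta> / 4"
    using eventually_happens[OF eventually_conj[OF ev1 eventually_conj[OF ev2 ev3]]] by auto
  define m where "m = Suc m'"
  define r where "r = exp (b - \<epsilon> * sqrt (real m))"
  have m: "m > 0" and r: "r > 0" by (auto simp: m_def r_def)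
  note m' = m'[folded m_def, folded r_def]
  have "1 * r \<le> (real m + 1) * r" using r by (intro mult_right_mono) auto
  then have small: "2 * r \<le> 1 / 2" using m'(2) by linarith
  have "2 * C * (CARD('k) * (m * k + 1) * (4 * r)) \<le> (8 * C * CARD('k) * real k) * ((real m + 1) * r)"
  proof -
    have "real (m * k + 1) \<le> real k * (real m + 1)" using k(2) by (simp add: algebra_simps)
    then have "(8 * C * CARD('k) * r) * real (m * k + 1) \<le> (8 * C * CARD('k) * r) * (real k * (real m + 1))"
      using C r by (intro mult_left_mono) auto
    then show ?thesis by (simp add: algebra_simps)
  qed
  then have last: "2 * C * (CARD('k) * (m * k + 1) * (4 * r)) \<le> \<delta> / 8" using m'(1) by linarith
  have ev4: "\<forall>\<^sub>F n in sequentially. ?EV k m n > ?EW k m - \<delta> / 8"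
    using order_tendstoD(1)[OF E_n[OF k(2) m]] \<delta> by simp
  show ?thesis
    using ev4 osc[OF k(2) m \<epsilon>(1) small[unfolded r_def]]
  proof eventually_elim
    case (elim n)
    then show ?case using k(1) m'(3) last \<epsilon>(2) \<delta> unfolding r_def by linarith
  qed
qed

section \<open>Laws of Levy processes\<close>

text \<open>The exponential series may be integrated termwise, being dominated by
  \<open>\<bar>t\<bar> ^ k / fact k\<close>. Consequently the moments of a variable with values in
  \<open>[0,1]\<close> determine its law.\<close>

lemma char_moment_series:
  assumes "prob_space M" and U [measurable]: "U \<in> borel_measurable M" and U01: "AE x in M. 0 \<le> U x \<and> U x \<le> 1"
  shows "char (distr M borel U) t = (\<Sum>k. (\<i> * of_real t) ^ k /\<^sub>R fact k * of_real (\<integral>x. U x ^ k \<partial>M))"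
proof -
  interpret prob_space M by fact
  let ?f = "\<lambda>k x. (\<i> * of_real t) ^ k /\<^sub>R fact k * of_real (U x ^ k) :: complex"
  have U_int: "integrable M (\<lambda>x. U x ^ k)" for k
    by (rule integrable_const_bound[where B = 1]) (use U01 in \<open>auto simp: power_le_one\<close>)
  have int: "integrable M (?f k)" for k using U_int by (intro integrable_mult_right integrable_of_real)
  have nf: "norm (?f k x) = \<bar>t\<bar> ^ k /\<^sub>R fact k * \<bar>U x\<bar> ^ k" for k x
    by (simp add: norm_mult norm_power power_abs)
  have nle: "AE x in M. norm (?f k x) \<le> \<bar>t\<bar> ^ k /\<^sub>R fact k" for k
    using U01
  proof eventually_elim
    case (elim x)
    then have "\<bar>U x\<bar> ^ k \<le> 1" by (simp add: power_le_one)
    then show ?case unfolding nf by (intro mult_left_le) auto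
  qed
  have sm: "summable (\<lambda>k. \<bar>t\<bar> ^ k /\<^sub>R fact k)" using summable_exp_generic[of "\<bar>t\<bar>"] by simp
  have "AE x in M. \<forall>k. norm (?f k x) \<le> \<bar>t\<bar> ^ k /\<^sub>R fact k" using nle by (simp add: AE_all_countable)
  then have s1: "AE x in M. summable (\<lambda>k. norm (?f k x))"
    by eventually_elim (rule summable_comparison_test'[OF sm, of 0], simp)
  have s2: "summable (\<lambda>k. \<integral>x. norm (?f k x) \<partial>M)"
  proof (rule summable_comparison_test'[OF sm, of 0])
    fix k :: nat
    have "(\<integral>x. norm (?f k x) \<partial>M) \<le> (\<integral>x. \<bar>t\<bar> ^ k /\<^sub>R fact k \<partial>M)"
      by (rule integral_mono_AE[OF integrable_norm[OF int] _ nle]) simp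
    then show "norm (\<integral>x. norm (?f k x) \<partial>M) \<le> \<bar>t\<bar> ^ k /\<^sub>R fact k"
      by (simp add: prob_space)
  qed
  have "char (distr M borel U) t = (\<integral>x. iexp (t * U x) \<partial>M)"
    unfolding char_def by (subst integral_distr) auto
  also have "\<dots> = (\<integral>x. (\<Sum>k. ?f k x) \<partial>M)"
  proof (intro Bochner_Integration.integral_cong refl)
    fix x
    have "iexp (t * U x) = (\<Sum>k. (\<i> * of_real (t * U x)) ^ k /\<^sub>R fact k)" by (simp add: exp_def)
    also have "\<dots> = (\<Sum>k. ?f k x)"
      by (intro suminf_cong) (simp add: power_mult_distrib scaleR_conv_of_real mult_ac)
    finally show "iexp (t * U x) = (\<Sum>k. ?f k x)" .
  qed
  also have "\<dots> = (\<Sum>k. \<integral>x. ?f k x \<partial>M)" by (rule integral_suminf[OF int s1 s2])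
  also have "\<dots> = (\<Sum>k. (\<i> * of_real t) ^ k /\<^sub>R fact k * of_real (\<integral>x. U x ^ k \<partial>M))"
    using U_int by (intro suminf_cong) (simp only: integral_mult_right_zero integral_complex_of_real)
  finally show ?thesis .
qed

text \<open>The values of the Laplace transform at the integers are the moments of
  \<open>exp (- X)\<close>, which lies in \<open>[0,1]\<close>; they fix its law, and
  \<open>- ln\<close> recovers \<open>X\<close>.\<close>

lemma laplace_transform_unique:
  fixes X :: "'a \<Rightarrow> real" and X' :: "'b \<Rightarrow> real"
  assumes M: "prob_space M" and M': "prob_space M'"
    and X [measurable]: "X \<in> borel_measurable M" and X' [measurable]: "X' \<in> borel_measurable M'"
    and pos: "AE x in M. X x \<ge> 0" "AE x in M'. X' x \<ge> 0"
    and eq: "\<And>n::nat. (\<integral>x. exp (- real n * X x) \<partial>M) = (\<integral>x. exp (- real n * X' x) \<partial>M')"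
  shows "distr M borel X = distr M' borel X'"
proof -
  let ?U = "\<lambda>x. exp (- X x)" and ?U' = "\<lambda>x. exp (- X' x)"
  have pw: "exp (- a) ^ n = exp (- real n * a)" for a :: real and n :: nat
    by (simp add: exp_of_nat_mult[symmetric])
  have "char (distr M borel ?U) = char (distr M' borel ?U')"
  proof
    fix t
    have "char (distr M borel ?U) t = (\<Sum>k. (\<i> * of_real t) ^ k /\<^sub>R fact k * of_real (\<integral>x. ?U x ^ k \<partial>M))"
      by (rule char_moment_series[OF M]) (use pos in auto)
    also have "\<dots> = (\<Sum>k. (\<i> * of_real t) ^ k /\<^sub>R fact k * of_real (\<integral>x. ?U' x ^ k \<partial>M'))"
      unfolding pw eq ..
    also have "\<dots> = char (distr M' borel ?U') t"
      by (rule char_moment_series[OF M', symmetric]) (use pos in auto)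
    finally show "char (distr M borel ?U) t = char (distr M' borel ?U') t" .
  qed
  then have U: "distr M borel ?U = distr M' borel ?U'"
    by (intro Levy_uniqueness prob_space.real_distribution_distr M M') auto
  have "distr M borel X = distr (distr M borel ?U) borel (\<lambda>u. - ln u)"
    by (subst distr_distr) (auto simp: o_def)
  also have "\<dots> = distr M' borel X'"
    unfolding U by (subst distr_distr) (auto simp: o_def)
  finally show ?thesis .
qed

text \<open>Cylinder sets determine the law, and a cylinder is an event about partial sums of
  independent increments, whose laws are fixed by the marginals.\<close>

lemma levy_process_law_unique:
  fixes X :: "real \<Rightarrow> 'a \<Rightarrow> real" and X' :: "real \<Rightarrow> 'b \<Rightarrow> real"
  assumes M: "prob_space M" and M': "prob_space M'" and X: "levy_process M X" and X': "levy_process M' X'"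
    and eq: "\<And>h. h \<ge> 0 \<Longrightarrow> distr M borel (X h) = distr M' borel (X' h)"
  shows "distr M (PiM {0..} (\<lambda>_. borel)) (\<lambda>\<omega>. \<lambda>t\<in>{0..}. X t \<omega>) =
    distr M' (PiM {0..} (\<lambda>_. borel)) (\<lambda>\<omega>. \<lambda>t\<in>{0..}. X' t \<omega>)" (is "?L = ?R")
proof (rule measure_eqI_PiM_infinite)
  let ?B = "PiM {0::real..} (\<lambda>_. borel :: real measure)"
  interpret prob_space M by fact
  have pm: "(\<lambda>\<omega>. \<lambda>t\<in>{0..}. Z t \<omega>) \<in> M'' \<rightarrow>\<^sub>M ?B" if "levy_process M'' Z" for Z :: "real \<Rightarrow> 'c \<Rightarrow> real" and M''
    using that by (intro measurable_restrict) (auto simp: levy_process_def)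
  show "finite_measure ?L" using pm[OF X] by (intro finite_measure_distr) 
  fix A and J :: "real set" assume J: "finite J" "J \<subseteq> {0..}" and A: "\<And>i. i \<in> J \<Longrightarrow> A i \<in> sets (borel :: real measure)"
  \<comment> \<open>The time 0 is added so that the partial sums of increments start from the value
    0.\<close>
  define xs where "xs = sorted_list_of_set (insert 0 J)"
  define n where "n = length xs"
  have xs: "set xs = insert 0 J" "sorted xs" using J(1)
    by (simp_all only: xs_def set_sorted_list_of_set finite_insert sorted_sorted_list_of_set)
  have n: "n > 0" using xs(1) by (auto simp: n_def)
  \<comment> \<open>Constant from \<open>n - 1\<close> on, since increments of a Levy process are
    taken along an infinite monotone sequence.\<close>
  define t where "t k = xs ! min k (n - 1)" for k
  have lt: "min k (n - 1) < n" for k using n by arith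
  have tset: "t k \<in> insert 0 J" for k unfolding t_def xs(1)[symmetric] using lt[of k] by (intro nth_mem) (simp add: n_def)
  have tmono: "mono t" unfolding mono_def t_def using xs(2) lt
    by (intro allI impI sorted_nth_mono) (auto simp: n_def min_le_iff_disj)
  have tpos: "t k \<ge> 0" for k using tset[of k] J by auto
  have "0 \<in> set xs" using xs by simp
  then obtain k where "k < n" "xs ! k = 0" by (auto simp: in_set_conv_nth n_def)
  then have "t k = 0" by (simp add: t_def min_def)
  then have t0: "t 0 = 0" using monoD[OF tmono, of 0 k] tpos[of 0] by simp
  have "\<exists>k<n. t k = j" if "j \<in> J" for j
  proof -
    have "j \<in> set xs" using that xs by simp
    then obtain k where "k < n" "xs ! k = j" by (auto simp: in_set_conv_nth n_def)
    then show ?thesis by (intro exI[of _ k]) (auto simp: t_def min_def)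
  qed
  then obtain \<kappa> where \<kappa>: "\<And>j. j \<in> J \<Longrightarrow> \<kappa> j < n \<and> t (\<kappa> j) = j" by metis
  let ?E = "prod_emb {0..} (\<lambda>_. borel) J (Pi\<^sub>E J A)"
  let ?P = "PiM {..<n} (\<lambda>_. borel :: real measure)"
  \<comment> \<open>The cylinder expressed through increments; \<open>\<kappa> j\<close> is the
    position of the time \<open>j\<close> in the list.\<close>
  define K where "K = {x\<in>space ?P. \<forall>j\<in>J. (\<Sum>l<\<kappa> j. x l) \<in> A j}"
  have K: "K \<in> sets ?P"
  proof -
    have "Measurable.pred ?P (\<lambda>x. \<forall>j\<in>J. (\<Sum>l<\<kappa> j. x l) \<in> A j)"
    proof (rule pred_intros_finite(3)[OF J(1)])
      fix j assume j: "j \<in> J"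
      have "(\<lambda>x. \<Sum>l<\<kappa> j. x l) \<in> borel_measurable ?P"
        using \<kappa>[OF j] by (intro borel_measurable_sum measurable_component_singleton) auto
      then show "Measurable.pred ?P (\<lambda>x. (\<Sum>l<\<kappa> j. x l) \<in> A j)" using A[OF j] by (rule pred_sets2[rotated])
    qed
    then show ?thesis unfolding K_def by measurable
  qed
  have E: "?E \<in> sets ?B" using J A by (intro sets_PiM_I) auto
  have main: "emeasure (distr M'' ?B (\<lambda>\<omega>. \<lambda>t\<in>{0..}. Z t \<omega>)) ?E = emeasure (PiM {..<n} (\<lambda>k. distr M'' borel (Z (t (Suc k) - t k)))) K"
    if M'': "prob_space M''" and Z: "levy_process M'' Z" for Z :: "real \<Rightarrow> 'c \<Rightarrow> real" and M''
  proof -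
    interpret M'': prob_space M'' by fact
    let ?D = "\<lambda>k \<omega>. Z (t (Suc k)) \<omega> - Z (t k) \<omega>"
    have Zm: "Z s \<in> borel_measurable M''" if "s \<ge> 0" for s using Z that by (auto simp: levy_process_def)
    have Dm: "?D k \<in> borel_measurable M''" for k using Zm tpos by auto
    have ind: "M''.indep_vars (\<lambda>_. borel) ?D {..<n}"
      using Z tpos tmono by (rule levy_process_indep)
    have law: "distr M'' ?P (\<lambda>\<omega>. \<lambda>k\<in>{..<n}. ?D k \<omega>) = PiM {..<n} (\<lambda>k. distr M'' borel (?D k))"
      using ind n by (subst (asm) M''.indep_vars_iff_distr_eq_PiM') (auto intro: Dm)
    have inc: "distr M'' borel (?D k) = distr M'' borel (Z (t (Suc k) - t k))" for k
    proof -
      have "t k + (t (Suc k) - t k) = t (Suc k)" by simp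
      moreover have "t (Suc k) - t k \<ge> 0" using monoD[OF tmono, of k "Suc k"] by simp
      ultimately show ?thesis using levy_process_increment[OF Z tpos, of "t (Suc k) - t k" k] by simp
    qed
    have Z0: "AE \<omega> in M''. Z 0 \<omega> = 0" using Z by (simp add: levy_process_def)
    have "emeasure (distr M'' ?B (\<lambda>\<omega>. \<lambda>t\<in>{0..}. Z t \<omega>)) ?E = emeasure M'' ((\<lambda>\<omega>. \<lambda>t\<in>{0..}. Z t \<omega>) -` ?E \<inter> space M'')"
      by (rule emeasure_distr[OF pm[OF Z] E])
    also have "\<dots> = emeasure M'' ((\<lambda>\<omega>. \<lambda>k\<in>{..<n}. ?D k \<omega>) -` K \<inter> space M'')"
    proof (rule emeasure_eq_AE)
      show "(\<lambda>\<omega>. \<lambda>t\<in>{0..}. Z t \<omega>) -` ?E \<inter> space M'' \<in> sets M''" using pm[OF Z] E by (rule measurable_sets)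
      show "(\<lambda>\<omega>. \<lambda>k\<in>{..<n}. ?D k \<omega>) -` K \<inter> space M'' \<in> sets M''"
        by (rule measurable_sets[OF _ K]) (intro measurable_restrict Dm)
      show "AE \<omega> in M''. (\<omega> \<in> (\<lambda>\<omega>. \<lambda>t\<in>{0..}. Z t \<omega>) -` ?E \<inter> space M'') = (\<omega> \<in> (\<lambda>\<omega>. \<lambda>k\<in>{..<n}. ?D k \<omega>) -` K \<inter> space M'')"
        using Z0
      proof eventually_elim
        case (elim \<omega>)
        have "(\<Sum>l<\<kappa> j. (\<lambda>k\<in>{..<n}. ?D k \<omega>) l) = Z j \<omega>" if "j \<in> J" for j
        proof -
          have "(\<Sum>l<\<kappa> j. (\<lambda>k\<in>{..<n}. ?D k \<omega>) l) = (\<Sum>l<\<kappa> j. ?D l \<omega>)"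
            using \<kappa>[OF that] by (intro sum.cong) auto
          also have "\<dots> = Z (t (\<kappa> j)) \<omega> - Z (t 0) \<omega>" by (rule sum_lessThan_telescope)
          also have "\<dots> = Z j \<omega>" using \<kappa>[OF that] elim t0 by simp
          finally show ?thesis .
        qed
        moreover have "(\<lambda>t\<in>{0..}. Z t \<omega>) \<in> ?E \<longleftrightarrow> (\<forall>j\<in>J. Z j \<omega> \<in> A j)"
          using J by (auto simp: prod_emb_def PiE_iff restrict_def extensional_def Pi_iff split: if_splits)
        ultimately show ?case by (auto simp: K_def space_PiM)
      qed
    qed
    also have "\<dots> = emeasure (distr M'' ?P (\<lambda>\<omega>. \<lambda>k\<in>{..<n}. ?D k \<omega>)) K"
      by (rule emeasure_distr[symmetric, OF _ K]) (intro measurable_restrict Dm)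
    finally show ?thesis unfolding law inc .
  qed
  have "PiM {..<n} (\<lambda>k. distr M borel (X (t (Suc k) - t k))) = PiM {..<n} (\<lambda>k. distr M' borel (X' (t (Suc k) - t k)))"
    by (intro PiM_cong refl eq) (use monoD[OF tmono] in auto)
  then show "emeasure ?L ?E = emeasure ?R ?E"
    unfolding main[OF M X] main[OF M' X'] by simp
qed auto

text \<open>Covers the compensated Poisson process (\<open>a = \<mu> * c\<close>,
  \<open>d = sqrt c\<close>), the rescaled subordinator (\<open>a = 0\<close>, \<open>d = u\<close>)
  and Brownian motion at speed \<open>\<mu>\<close> (\<open>a = 0\<close>,
  \<open>d = 1\<close>).\<close>

lemma levy_process_affine:
  fixes X :: "real \<Rightarrow> 'a \<Rightarrow> real"
  assumes M: "prob_space M" and X: "levy_process M X" and c: "c > 0"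
  shows "levy_process M (\<lambda>s \<omega>. (X (c * s) \<omega> - a * s) / d)"
  unfolding levy_process_def
proof (intro conjI allI impI)
  interpret prob_space M by fact
  have Xm: "X t \<in> borel_measurable M" if "t \<ge> 0" for t using X that by (auto simp: levy_process_def)
  show m: "(\<lambda>\<omega>. (X (c * t) \<omega> - a * t) / d) \<in> borel_measurable M" if "t \<ge> 0" for t
    using Xm[of "c * t"] that c by auto
  have "AE \<omega> in M. X 0 \<omega> = 0" using X by (simp add: levy_process_def)
  then show "AE \<omega> in M. (X (c * 0) \<omega> - a * 0) / d = 0" by eventually_elim simp
  fix t :: "nat \<Rightarrow> real" and n assume t: "0 \<le> t 0 \<and> mono t"
  have "mono (\<lambda>k. c * t k)" using t c by (auto simp: mono_def)
  then have ind: "indep_vars (\<lambda>_. borel) (\<lambda>k \<omega>. X (c * t (Suc k)) \<omega> - X (c * t k) \<omega>) {..<n}"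
    using X t c by (intro levy_process_indep) auto
  have "indep_vars (\<lambda>_. borel) (\<lambda>k \<omega>. ((X (c * t (Suc k)) \<omega> - X (c * t k) \<omega>) - a * (t (Suc k) - t k)) / d) {..<n}"
    by (rule indep_vars_compose2[OF ind, where Y = "\<lambda>k x. (x - a * (t (Suc k) - t k)) / d"]) measurable
  moreover have "((X (c * t (Suc k)) \<omega> - X (c * t k) \<omega>) - a * (t (Suc k) - t k)) / d =
      (X (c * t (Suc k)) \<omega> - a * t (Suc k)) / d - (X (c * t k) \<omega> - a * t k) / d" for k \<omega>
    unfolding diff_divide_distrib[symmetric] by (simp add: algebra_simps)
  ultimately show "indep_vars (\<lambda>_. borel) (\<lambda>k \<omega>. (X (c * t (Suc k)) \<omega> - a * t (Suc k)) / d - (X (c * t k) \<omega> - a * t k) / d) {..<n}"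
    by simp
next
  have Xm: "X t \<in> borel_measurable M" if "t \<ge> 0" for t using X that by (auto simp: levy_process_def)
  fix s h :: real assume s: "s \<ge> 0" and h: "h \<ge> 0"
  have [measurable]: "X (c * s + c * h) \<in> borel_measurable M" "X (c * s) \<in> borel_measurable M" "X (c * h) \<in> borel_measurable M"
    using s h c by (auto intro!: Xm)
  have "distr M borel (\<lambda>\<omega>. (X (c * (s + h)) \<omega> - a * (s + h)) / d - (X (c * s) \<omega> - a * s) / d)
      = distr (distr M borel (\<lambda>\<omega>. X (c * s + c * h) \<omega> - X (c * s) \<omega>)) borel (\<lambda>x. (x - a * h) / d)"
  proof -
    have "(X (c * (s + h)) \<omega> - a * (s + h)) / d - (X (c * s) \<omega> - a * s) / d
        = ((X (c * s + c * h) \<omega> - X (c * s) \<omega>) - a * h) / d" for \<omega>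
      unfolding diff_divide_distrib[symmetric] by (simp add: algebra_simps)
    then show ?thesis by (subst distr_distr) (auto simp: o_def)
  qed
  also have "distr M borel (\<lambda>\<omega>. X (c * s + c * h) \<omega> - X (c * s) \<omega>) = distr M borel (X (c * h))"
    using X s h c by (intro levy_process_increment) auto
  also have "distr (distr M borel (X (c * h))) borel (\<lambda>x. (x - a * h) / d) = distr M borel (\<lambda>\<omega>. (X (c * h) \<omega> - a * h) / d)"
    by (subst distr_distr) (auto simp: o_def)
  finally show "distr M borel (\<lambda>\<omega>. (X (c * (s + h)) \<omega> - a * (s + h)) / d - (X (c * s) \<omega> - a * s) / d)
      = distr M borel (\<lambda>\<omega>. (X (c * h) \<omega> - a * h) / d)" .
next
  have "AE \<omega> in M. cadlag (\<lambda>t. X t \<omega>)" using X by (simp add: levy_process_def)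
  then show "AE \<omega> in M. cadlag (\<lambda>t. (X (c * t) \<omega> - a * t) / d)"
  proof eventually_elim
    case (elim \<omega>)
    have cl: "clock (\<lambda>t. c * t)" using c by (intro clock_linear) simp
    have id: "cadlag (\<lambda>t::real. t)" using clock_cadlag[OF clock_linear[of 1]] by simp
    show ?case by (rule cadlag_affine[OF cadlag_clock[OF elim cl] id])
  qed
qed

section \<open>First passage times of stable subordinators\<close>

definition first_passage :: "(real \<Rightarrow> real) \<Rightarrow> real \<Rightarrow> real" where
  "first_passage l t = Inf {s. 0 < s \<and> t < l s}"

lemma first_passage_lower: "0 < s \<Longrightarrow> t < l s \<Longrightarrow> first_passage l t \<le> s"
  unfolding first_passage_def by (rule cInf_lower) (auto intro!: bdd_belowI[of _ 0])

lemma first_passage_less: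
  assumes l: "\<And>x. \<exists>s>0. x < l s" and a: "first_passage l t < a"
  obtains s where "0 < s" "t < l s" "s < a"
proof -
  have "{s. 0 < s \<and> t < l s} \<noteq> {}" "bdd_below {s. 0 < s \<and> t < l s}"
    using l[of t] by (auto intro!: bdd_belowI[of _ 0])
  then show thesis using that a cInf_less_iff[of "{s. 0 < s \<and> t < l s}" a] by (auto simp: first_passage_def)
qed

text \<open>Right-continuity comes from the strict inequality in the infimum: a level
  \<open>s\<close> with \<open>t < l s\<close> also serves every \<open>r < l s\<close>.\<close>

lemma clock_first_passage:
  assumes l: "\<And>x. \<exists>s>0. x < l s"
  shows "clock (first_passage l)"
  unfolding clock_def
proof (intro conjI allI impI)
  have ne: "{s. 0 < s \<and> t < l s} \<noteq> {}" for t using l[of t] by auto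
  have mono: "first_passage l s \<le> first_passage l t" if "s \<le> t" for s t
    unfolding first_passage_def[of l t] using ne[of t] that
    by (intro cInf_greatest) (auto intro!: first_passage_lower)
  show "0 \<le> first_passage l t" for t
    unfolding first_passage_def using ne by (intro cInf_greatest) auto
  show "mono_on {0..} (first_passage l)" using mono by (auto intro: mono_onI)
  fix t :: real
  show "(first_passage l \<longlongrightarrow> first_passage l t) (at_right t)"
  proof (rule order_tendstoI)
    fix a assume "a < first_passage l t"
    then show "\<forall>\<^sub>F r in at_right t. a < first_passage l r"
      unfolding eventually_at_right_field
      by (intro exI[of _ "t + 1"] conjI allI impI) (simp, rule less_le_trans[OF _ mono], assumption, blast intro: less_imp_le)
  next
    fix a assume lt: "first_passage l t < a"
    obtain s where s: "0 < s" "t < l s" "s < a" by (rule first_passage_less[OF l lt])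
    show "\<forall>\<^sub>F r in at_right t. first_passage l r < a"
      unfolding eventually_at_right_field
      using s by (intro exI[of _ "l s"]) (auto intro: le_less_trans[OF first_passage_lower])
  qed
qed

text \<open>A monotone \<open>l\<close> allows any admissible level to be moved up to a nearby
  rational. The countable infimum makes the passage time a measurable functional of the
  path.\<close>

lemma first_passage_rational:
  assumes l: "\<And>x. \<exists>s>0. x < l s" and mono: "mono_on {0..} l"
  shows "first_passage l t = Inf {s \<in> \<rat>. 0 < s \<and> t < l s}"
proof (rule antisym)
  have rat: "\<exists>q\<in>\<rat>. 0 < q \<and> t < l q \<and> q < a" if s: "0 < s" "t < l s" "s < a" for s a
  proof -
    obtain q where q: "q \<in> \<rat>" "s < q" "q < a" using Rats_dense_in_real[OF s(3)] by blast
    moreover have "l s \<le> l q" using mono_onD[OF mono, of s q] s q by auto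
    ultimately show ?thesis using s by (intro bexI[of _ q]) auto
  qed
  have ne: "{s \<in> \<rat>. 0 < s \<and> t < l s} \<noteq> {}"
  proof -
    obtain s where "s > 0" "t < l s" using l by blast
    then show ?thesis using rat[of s "s + 1"] by auto
  qed
  then show "first_passage l t \<le> Inf {s \<in> \<rat>. 0 < s \<and> t < l s}"
    by (intro cInf_greatest) (auto intro: first_passage_lower)
  show "Inf {s \<in> \<rat>. 0 < s \<and> t < l s} \<le> first_passage l t"
  proof (rule ccontr)
    assume "\<not> ?thesis"
    then have lt: "first_passage l t < Inf {s \<in> \<rat>. 0 < s \<and> t < l s}" by simp
    obtain s where s: "0 < s" "t < l s" "s < Inf {s \<in> \<rat>. 0 < s \<and> t < l s}"
      by (rule first_passage_less[OF l lt])
    obtain q where q: "q \<in> \<rat>" "0 < q" "t < l q" "q < Inf {s \<in> \<rat>. 0 < s \<and> t < l s}"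
      using rat[OF s] by blast
    then have "Inf {s \<in> \<rat>. 0 < s \<and> t < l s} \<le> q"
      by (intro cInf_lower) (auto intro!: bdd_belowI[of _ 0])
    then show False using q(4) by simp
  qed
qed

text \<open>Substitute \<open>c * s\<close> for \<open>s\<close>: the level \<open>u * t\<close> is
  passed by \<open>l\<close> at \<open>c * s\<close> when \<open>t\<close> is passed by
  \<open>l (c * s) / u\<close> at \<open>s\<close>.\<close>

lemma first_passage_scale:
  assumes l: "\<And>x. \<exists>s>0. x < l s" and c: "c > 0" and u: "u > 0"
  shows "first_passage l (u * t) = c * first_passage (\<lambda>s. l (c * s) / u) t"
proof -
  have l': "\<exists>s>0. x < l (c * s) / u" for x
  proof -
    obtain s where "s > 0" "x * u < l s" using l by blast
    then show ?thesis using c u by (intro exI[of _ "s / c"]) (auto simp: field_simps)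
  qed
  show ?thesis
  proof (rule antisym)
    show "first_passage l (u * t) \<le> c * first_passage (\<lambda>s. l (c * s) / u) t"
    proof (rule ccontr)
      assume "\<not> ?thesis"
      then have lt: "first_passage (\<lambda>s. l (c * s) / u) t < first_passage l (u * t) / c" using c by (simp add: field_simps)
      obtain s where s: "0 < s" "t < l (c * s) / u" "s < first_passage l (u * t) / c"
        by (rule first_passage_less[OF l' lt])
      then have "first_passage l (u * t) \<le> c * s" using c u by (intro first_passage_lower) (auto simp: field_simps)
      then show False using s c by (simp add: field_simps)
    qed
    show "c * first_passage (\<lambda>s. l (c * s) / u) t \<le> first_passage l (u * t)"
    proof (rule ccontr)
      assume "\<not> ?thesis"
      then have lt: "first_passage l (u * t) < c * first_passage (\<lambda>s. l (c * s) / u) t" by simp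
      obtain s where s: "0 < s" "u * t < l s" "s < c * first_passage (\<lambda>s. l (c * s) / u) t"
        by (rule first_passage_less[OF l lt])
      then have "first_passage (\<lambda>s. l (c * s) / u) t \<le> s / c" using c u by (intro first_passage_lower) (auto simp: field_simps)
      then show False using s c by (simp add: field_simps)
    qed
  qed
qed

section \<open>Unboundedness and self-similarity of stable subordinators\<close>

lemma standard_stable_subordinator_laplace:
  "standard_stable_subordinator M \<theta> L \<Longrightarrow> s \<ge> 0 \<Longrightarrow> t \<ge> 0 \<Longrightarrow>
    (\<integral>\<omega>. exp (- t * L s \<omega>) \<partial>M) = exp (- s * t powr \<theta>)"
  unfolding standard_stable_subordinator_def by blast

text \<open>If \<open>L\<close> stays below \<open>K\<close> at all positive integers, then
  \<open>exp (- L n) \<ge> exp (- K)\<close> there, while its expectation is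
  \<open>exp (- n)\<close>. Letting \<open>n\<close> grow, the event has probability 0.\<close>

lemma subordinator_unbounded:
  assumes M: "prob_space M" and L: "standard_stable_subordinator M \<theta> L"
  shows "AE \<omega> in M. \<forall>x. \<exists>s>0. x < L s \<omega>"
proof -
  interpret prob_space M by fact
  have Lm [measurable]: "L (real n) \<in> borel_measurable M" for n :: nat
    using L by (auto simp: standard_stable_subordinator_def levy_process_def)
  have "AE \<omega> in M. \<exists>n>0. real K < L (real n) \<omega>" for K :: nat
  proof -
    define A where "A = {\<omega>\<in>space M. \<forall>n>0. L (real n) \<omega> \<le> real K}"
    have A: "A \<in> events" unfolding A_def by measurable
    have le: "exp (- real K) * prob A \<le> exp (- real n)" if n: "n > 0" for n :: nat
    proof -
      have e: "(\<integral>\<omega>. exp (- 1 * L (real n) \<omega>) \<partial>M) = exp (- real n * 1 powr \<theta>)"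
        using L by (rule standard_stable_subordinator_laplace) auto
      \<comment> \<open>A Bochner integral defaults to 0 for a function that is not integrable; this
        one is an exponential, hence nonzero.\<close>
      then have int: "integrable M (\<lambda>\<omega>. exp (- 1 * L (real n) \<omega>))"
        using not_integrable_integral_eq[of M "\<lambda>\<omega>. exp (- 1 * L (real n) \<omega>)"] by (metis exp_not_eq_zero)
      have "exp (- real K) * prob A = (\<integral>\<omega>. exp (- real K) * indicator A \<omega> \<partial>M)" using A by simp
      also have "\<dots> \<le> (\<integral>\<omega>. exp (- 1 * L (real n) \<omega>) \<partial>M)"
      proof (rule integral_mono[OF _ int])
        show "integrable M (\<lambda>\<omega>. exp (- real K) * indicator A \<omega>)" using A by (simp add: emeasure_eq_measure)
        show "exp (- real K) * indicator A \<omega> \<le> exp (- 1 * L (real n) \<omega>)" if "\<omega> \<in> space M" for \<omega>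
          using n by (auto simp: A_def indicator_def)
      qed
      finally show ?thesis using e by simp
    qed
    have "(\<lambda>n. exp (- real n)) \<longlonglongrightarrow> 0"
      by (rule filterlim_compose[OF exp_at_bot filterlim_compose[OF filterlim_uminus_at_bot_at_top filterlim_real_sequentially]])
    then have "exp (- real K) * prob A \<le> 0"
      by (rule LIMSEQ_le_const) (use le in \<open>auto intro!: exI[of _ 1]\<close>)
    then have "prob A = 0" by (simp add: mult_le_0_iff) (metis antisym measure_nonneg)
    then have "AE \<omega> in M. \<omega> \<notin> A" using A by (simp add: prob_eq_0)
    with AE_space show ?thesis by eventually_elim (auto simp: A_def not_le)
  qed
  then have "AE \<omega> in M. \<forall>K::nat. \<exists>n>0. real K < L (real n) \<omega>" by (simp add: AE_all_countable)
  then show ?thesis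
  proof eventually_elim
    case (elim \<omega>)
    show ?case
    proof
      fix x :: real
      obtain K :: nat where "x < real K" using reals_Archimedean2 by blast
      moreover obtain n where "n > 0" "real K < L (real n) \<omega>" using elim by blast
      ultimately show "\<exists>s>0. x < L s \<omega>" by (intro exI[of _ "real n"]) auto
    qed
  qed
qed

text \<open>Both processes are Levy, so marginals suffice, and for these the Laplace exponents agree
  since \<open>u powr \<theta> * (n / u) powr \<theta> = n powr \<theta>\<close>.\<close>

lemma subordinator_scaling:
  assumes M: "prob_space M" and L: "standard_stable_subordinator M \<theta> L" and \<theta>: "\<theta> > 0" and u: "u > 0"
  shows "distr M (PiM {0..} (\<lambda>_. borel)) (\<lambda>\<omega>. \<lambda>s\<in>{0..}. L (u powr \<theta> * s) \<omega> / u) =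
    distr M (PiM {0..} (\<lambda>_. borel)) (\<lambda>\<omega>. \<lambda>s\<in>{0..}. L s \<omega>)"
proof (rule levy_process_law_unique[OF M M])
  have levy: "levy_process M L" using L by (simp add: standard_stable_subordinator_def)
  then show "levy_process M L" .
  have up: "u powr \<theta> > 0" using u by simp
  show "levy_process M (\<lambda>s \<omega>. L (u powr \<theta> * s) \<omega> / u)"
    using levy_process_affine[OF M levy up, of 0 u] by simp
  have pos: "AE \<omega> in M. L h \<omega> \<ge> 0" if "h \<ge> 0" for h
  proof -
    have "AE \<omega> in M. mono_on {0..} (\<lambda>s. L s \<omega>)" "AE \<omega> in M. L 0 \<omega> = 0"
      using L by (auto simp: standard_stable_subordinator_def levy_process_def)
    then show ?thesis
    proof eventually_elim
      case (elim \<omega>)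
      have "L 0 \<omega> \<le> L h \<omega>" using that by (intro mono_onD[OF elim(1)]) auto
      then show ?case using elim(2) by simp
    qed
  qed
  have Lm: "L h \<in> borel_measurable M" if "h \<ge> 0" for h using levy_process_measurable[OF levy that] .
  fix h :: real assume h: "h \<ge> 0"
  then have uh: "u powr \<theta> * h \<ge> 0" by simp
  show "distr M borel (\<lambda>\<omega>. L (u powr \<theta> * h) \<omega> / u) = distr M borel (L h)"
  proof (rule laplace_transform_unique[OF M M])
    show "(\<lambda>\<omega>. L (u powr \<theta> * h) \<omega> / u) \<in> borel_measurable M" "L h \<in> borel_measurable M"
      using Lm[OF uh] Lm[OF h] by auto
    show "AE \<omega> in M. L h \<omega> \<ge> 0" using pos[OF h] .
    show "AE \<omega> in M. L (u powr \<theta> * h) \<omega> / u \<ge> 0" using pos[OF uh] u by auto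
    fix n :: nat
    note lap = standard_stable_subordinator_laplace[OF L]
    have "(\<integral>\<omega>. exp (- real n * (L (u powr \<theta> * h) \<omega> / u)) \<partial>M) = (\<integral>\<omega>. exp (- (real n / u) * L (u powr \<theta> * h) \<omega>) \<partial>M)"
      by simp
    also have "\<dots> = exp (- (u powr \<theta> * h) * (real n / u) powr \<theta>)" using uh u by (intro lap) auto
    also have "(u powr \<theta> * h) * (real n / u) powr \<theta> = h * real n powr \<theta>"
      using u by (simp add: powr_divide)
    then have "exp (- (u powr \<theta> * h) * (real n / u) powr \<theta>) = exp (- h * real n powr \<theta>)" by simp
    also have "\<dots> = (\<integral>\<omega>. exp (- real n * L h \<omega>) \<partial>M)" using h by (intro lap[symmetric]) auto
    finally show "(\<integral>\<omega>. exp (- real n * (L (u powr \<theta> * h) \<omega> / u)) \<partial>M) = (\<integral>\<omega>. exp (- real n * L h \<omega>) \<partial>M)" .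
  qed
qed

lemma inverse_stable_subordinator_clock:
  assumes M: "prob_space M" and Y: "inverse_stable_subordinator M \<theta> Y"
  shows "AE \<omega> in M. clock (\<lambda>t. Y t \<omega>)"
proof -
  obtain L where L: "standard_stable_subordinator M \<theta> L"
    and YL: "\<And>t \<omega>. t \<ge> 0 \<Longrightarrow> \<omega> \<in> space M \<Longrightarrow> Y t \<omega> = first_passage (\<lambda>s. L s \<omega>) t"
    using Y unfolding inverse_stable_subordinator_def first_passage_def by blast
  have cong: "clock (\<lambda>t. Y t \<omega>) \<longleftrightarrow> clock (first_passage (\<lambda>s. L s \<omega>))" if "\<omega> \<in> space M" for \<omega>
  proof -
    have ev: "\<forall>\<^sub>F r in at_right t. Y r \<omega> = first_passage (\<lambda>s. L s \<omega>) r" if "t \<ge> 0" for t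
      using that YL[OF _ \<open>\<omega> \<in> space M\<close>] by (auto simp: eventually_at_right_field intro!: exI[of _ "t + 1"])
    show ?thesis
      unfolding clock_def mono_on_def using YL[OF _ that] tendsto_cong[OF ev] by auto
  qed
  show ?thesis using subordinator_unbounded[OF M L] AE_space
  proof eventually_elim
    case (elim \<omega>)
    then show ?case unfolding cong[OF elim(2)] by (intro clock_first_passage) auto
  qed
qed

text \<open>Almost surely both sides are the same functional \<open>F\<close>, applied to
  \<open>L\<close> and to its rescaling. \<open>F\<close> uses rational levels so as to be
  measurable for the product sigma-algebra.\<close>

lemma inverse_stable_subordinator_scaling:
  assumes M: "prob_space M" and \<theta>: "\<theta> > 0" and u: "u > 0"
    and Y: "inverse_stable_subordinator M \<theta> Y" and Ym: "\<And>t. t \<ge> 0 \<Longrightarrow> Y t \<in> borel_measurable M"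
  shows "distr M (PiM {0..} (\<lambda>_. borel)) (\<lambda>\<omega>. \<lambda>t\<in>{0..}. Y (u * t) \<omega>) =
    distr M (PiM {0..} (\<lambda>_. borel)) (\<lambda>\<omega>. \<lambda>t\<in>{0..}. u powr \<theta> * Y t \<omega>)"
proof -
  let ?B = "PiM {0::real..} (\<lambda>_. borel :: real measure)"
  obtain L where L: "standard_stable_subordinator M \<theta> L"
    and YL: "\<And>t \<omega>. t \<ge> 0 \<Longrightarrow> \<omega> \<in> space M \<Longrightarrow> Y t \<omega> = first_passage (\<lambda>s. L s \<omega>) t"
    using Y unfolding inverse_stable_subordinator_def first_passage_def by blast
  have Lm: "L h \<in> borel_measurable M" if "h \<ge> 0" for h
    using L that by (auto simp: standard_stable_subordinator_def levy_process_def)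
  have up: "u powr \<theta> > 0" using u by simp
  define F where "F l = (\<lambda>t\<in>{0..}. u powr \<theta> * Inf {s \<in> \<rat>. 0 < s \<and> t < l s})" for l :: "real \<Rightarrow> real"
  have F: "F \<in> ?B \<rightarrow>\<^sub>M ?B"
    unfolding F_def
  proof (intro measurable_restrict borel_measurable_times borel_measurable_const)
    fix t :: real
    show "(\<lambda>l. Inf {s \<in> \<rat>. 0 < s \<and> t < l s}) \<in> borel_measurable ?B"
    proof (rule borel_measurable_iff_less[THEN iffD2], rule allI)
      fix a :: real
      have comp [measurable]: "(\<lambda>l. l q) \<in> borel_measurable ?B" if "q > 0" for q
        using that by (intro measurable_component_singleton) auto
      \<comment> \<open>A path may never exceed \<open>t\<close> at a rational; then the infimum is
        the unspecified constant \<open>Inf {}\<close>, which gets its own clause.\<close>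
      have eq: "{l \<in> space ?B. Inf {s \<in> \<rat>. 0 < s \<and> t < l s} < a} =
        {l \<in> space ?B. (\<exists>q\<in>\<rat> \<inter> {0<..<a}. t < l q) \<or> (\<forall>q\<in>\<rat> \<inter> {0<..}. \<not> t < l q) \<and> Inf ({} :: real set) < a}"
      proof -
        have "Inf {s \<in> \<rat>. 0 < s \<and> t < l s} < a \<longleftrightarrow> (\<exists>q\<in>\<rat> \<inter> {0<..<a}. t < l q) \<or> (\<forall>q\<in>\<rat> \<inter> {0<..}. \<not> t < l q) \<and> Inf ({} :: real set) < a"
          for l :: "real \<Rightarrow> real"
        proof (cases "{s \<in> \<rat>. 0 < s \<and> t < l s} = {}")
          case True
          then have "\<forall>q\<in>\<rat> \<inter> {0<..}. \<not> t < l q" by auto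
          then show ?thesis unfolding True by auto
        next
          case False
          then show ?thesis
            by (subst cInf_less_iff) (auto intro!: bdd_belowI[of _ 0])
        qed
        then show ?thesis by simp
      qed
      have c: "countable (\<rat> \<inter> S)" for S :: "real set" using countable_rat by (rule countable_subset[rotated]) auto
      have p1: "Measurable.pred ?B (\<lambda>l. \<exists>q\<in>\<rat> \<inter> {0<..<a}. t < l q)"
      proof (rule measurable_pred_countable(2)[OF c])
        fix q assume "q \<in> \<rat> \<inter> {0<..<a}"
        then have [measurable]: "(\<lambda>l. l q) \<in> borel_measurable ?B" by (intro comp) auto
        show "Measurable.pred ?B (\<lambda>l. t < l q)" by measurable
      qed
      have p2: "Measurable.pred ?B (\<lambda>l. \<forall>q\<in>\<rat> \<inter> {0<..}. \<not> t < l q)"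
      proof (rule measurable_pred_countable(1)[OF c])
        fix q :: real assume "q \<in> \<rat> \<inter> {0<..}"
        then have [measurable]: "(\<lambda>l. l q) \<in> borel_measurable ?B" by (intro comp) auto
        show "Measurable.pred ?B (\<lambda>l. \<not> t < l q)" by measurable
      qed
      show "{l \<in> space ?B. Inf {s \<in> \<rat>. 0 < s \<and> t < l s} < a} \<in> sets ?B"
        unfolding eq using p1 p2 by measurable
    qed
  qed
  have mono: "AE \<omega> in M. mono_on {0..} (\<lambda>s. L s \<omega>)" using L by (simp add: standard_stable_subordinator_def)
  have pmL: "(\<lambda>\<omega>. \<lambda>s\<in>{0..}. L s \<omega>) \<in> M \<rightarrow>\<^sub>M ?B" by (intro measurable_restrict Lm) auto
  have pmL': "(\<lambda>\<omega>. \<lambda>s\<in>{0..}. L (u powr \<theta> * s) \<omega> / u) \<in> M \<rightarrow>\<^sub>M ?B"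
    using up by (intro measurable_restrict borel_measurable_divide Lm) auto
  have FL: "F (\<lambda>s\<in>{0..}. l s) t = u powr \<theta> * first_passage l t"
    if "\<And>x. \<exists>s>0. x < l s" "mono_on {0..} l" "t \<ge> 0" for l t
  proof -
    have "{s \<in> \<rat>. 0 < s \<and> t < (\<lambda>s\<in>{0..}. l s) s} = {s \<in> \<rat>. 0 < s \<and> t < l s}" by auto
    then show ?thesis using that by (simp add: F_def first_passage_rational[OF that(1,2)])
  qed
  have 1: "AE \<omega> in M. (\<lambda>t\<in>{0..}. u powr \<theta> * Y t \<omega>) = F (\<lambda>s\<in>{0..}. L s \<omega>)"
    using subordinator_unbounded[OF M L] mono AE_space
  proof eventually_elim
    case (elim \<omega>)
    have "F (\<lambda>s\<in>{0..}. L s \<omega>) t = u powr \<theta> * first_passage (\<lambda>s. L s \<omega>) t" if "t \<ge> 0" for t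
      using elim that by (intro FL) auto
    moreover have "F (\<lambda>s\<in>{0..}. L s \<omega>) t = undefined" if "\<not> t \<ge> 0" for t using that by (simp add: F_def)
    ultimately show ?case using YL[OF _ elim(3)] by (auto simp: fun_eq_iff restrict_def)
  qed
  have 2: "AE \<omega> in M. (\<lambda>t\<in>{0..}. Y (u * t) \<omega>) = F (\<lambda>s\<in>{0..}. L (u powr \<theta> * s) \<omega> / u)"
    using subordinator_unbounded[OF M L] mono AE_space
  proof eventually_elim
    case (elim \<omega>)
    have unb: "\<exists>s>0. x < L (u powr \<theta> * s) \<omega> / u" for x
    proof -
      obtain s where "s > 0" "x * u < L s \<omega>" using elim(1) by blast
      then show ?thesis using up u by (intro exI[of _ "s / u powr \<theta>"]) (auto simp: field_simps)
    qed
    have mono': "mono_on {0..} (\<lambda>s. L (u powr \<theta> * s) \<omega> / u)"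
    proof (rule mono_onI)
      fix r s :: real assume "r \<in> {0..}" "s \<in> {0..}" "r \<le> s"
      then have "L (u powr \<theta> * r) \<omega> \<le> L (u powr \<theta> * s) \<omega>"
        using up by (intro mono_onD[OF elim(2)]) auto
      then show "L (u powr \<theta> * r) \<omega> / u \<le> L (u powr \<theta> * s) \<omega> / u" using u by (simp add: divide_right_mono)
    qed
    have "F (\<lambda>s\<in>{0..}. L (u powr \<theta> * s) \<omega> / u) t = first_passage (\<lambda>s. L s \<omega>) (u * t)" if "t \<ge> 0" for t
      using FL[OF unb mono' that] first_passage_scale[of "\<lambda>s. L s \<omega>" "u powr \<theta>" u t] elim(1) up u by simp
    moreover have "F (\<lambda>s\<in>{0..}. L (u powr \<theta> * s) \<omega> / u) t = undefined" if "\<not> t \<ge> 0" for t using that by (simp add: F_def)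
    ultimately show ?case using YL[OF _ elim(3)] u by (auto simp: fun_eq_iff restrict_def)
  qed
  have pmY: "(\<lambda>\<omega>. \<lambda>t\<in>{0..}. Y (u * t) \<omega>) \<in> M \<rightarrow>\<^sub>M ?B" "(\<lambda>\<omega>. \<lambda>t\<in>{0..}. u powr \<theta> * Y t \<omega>) \<in> M \<rightarrow>\<^sub>M ?B"
    by (intro measurable_restrict Ym, use u in simp)
       (intro measurable_restrict borel_measurable_times borel_measurable_const Ym, simp)
  have "distr M ?B (\<lambda>\<omega>. \<lambda>t\<in>{0..}. Y (u * t) \<omega>) = distr M ?B (\<lambda>\<omega>. F (\<lambda>s\<in>{0..}. L (u powr \<theta> * s) \<omega> / u))"
    by (rule distr_cong_AE[OF refl _ 2 pmY(1) measurable_compose[OF pmL' F]]) simp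
  also have "\<dots> = distr (distr M ?B (\<lambda>\<omega>. \<lambda>s\<in>{0..}. L (u powr \<theta> * s) \<omega> / u)) ?B F"
    by (subst distr_distr[OF F pmL']) (simp add: o_def)
  also have "\<dots> = distr (distr M ?B (\<lambda>\<omega>. \<lambda>s\<in>{0..}. L s \<omega>)) ?B F"
    unfolding subordinator_scaling[OF M L \<theta> u] ..
  also have "\<dots> = distr M ?B (\<lambda>\<omega>. F (\<lambda>s\<in>{0..}. L s \<omega>))"
    by (subst distr_distr[OF F pmL]) (simp add: o_def)
  also have "\<dots> = distr M ?B (\<lambda>\<omega>. \<lambda>t\<in>{0..}. u powr \<theta> * Y t \<omega>)"
    by (rule distr_cong_AE[symmetric, OF refl _ 1 pmY(2) measurable_compose[OF pmL F]]) simp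
  finally show ?thesis .
qed

section \<open>Convergence along a fixed clock\<close>

text \<open>Applied with \<open>a = \<mu>\<close> and \<open>d = sqrt c\<close> to Poisson paths and with \<open>a = 0\<close> and \<open>d = 1\<close> to Brownian paths.\<close>

definition scaled_path :: "real \<Rightarrow> real \<Rightarrow> ('k \<Rightarrow> real) \<Rightarrow> ('k::finite \<Rightarrow> real \<Rightarrow> real) \<Rightarrow> (real \<Rightarrow> real) \<Rightarrow> real \<Rightarrow> real ^ 'k" where
  "scaled_path a d q x y = (\<lambda>t\<in>{0..}. \<chi> i. (x i (q i * y t) - a * (q i * y t)) / d)"

lemma scaled_path_in_skorokhod_space:
  assumes "\<And>i. cadlag (x i)" "clock y" "\<And>i. q i \<ge> 0"
  shows "scaled_path a d q x y \<in> skorokhod_space"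
  unfolding scaled_path_def restrict_in_skorokhod_space
proof (rule cadlag_vec)
  fix i
  have c: "clock (\<lambda>t. q i * y t)" using assms by (intro clock_mult)
  show "cadlag (\<lambda>t. (x i (q i * y t) - a * (q i * y t)) / d)"
    by (rule cadlag_affine[OF cadlag_clock[OF assms(1) c] clock_cadlag[OF c]])
qed

lemma scaled_path_cong:
  assumes "\<And>i t. t \<ge> 0 \<Longrightarrow> x i t = x' i t" "\<And>t. t \<ge> 0 \<Longrightarrow> y t = y' t" "\<And>t. t \<ge> 0 \<Longrightarrow> y t \<ge> 0" "\<And>i. q i \<ge> 0"
  shows "scaled_path a d q x y = scaled_path a d q x' y'"
  unfolding scaled_path_def
proof (rule restrict_ext)
  fix t :: real assume "t \<in> {0..}"
  then have t: "t \<ge> 0" by simp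
  have "x i (q i * y t) = x' i (q i * y' t)" for i
    using assms(1)[of "q i * y t" i] assms(2)[OF t] assms(3)[OF t] assms(4)[of i] by simp
  then show "(\<chi> i. (x i (q i * y t) - a * (q i * y t)) / d) = (\<chi> i. (x' i (q i * y' t) - a * (q i * y' t)) / d)"
    using assms(2)[OF t] by simp
qed

lemma scaled_path_measurable:
  fixes X :: "'k::finite \<Rightarrow> real \<Rightarrow> 'w \<Rightarrow> real"
  assumes X: "\<And>i w. w \<in> space \<Omega> \<Longrightarrow> cadlag (\<lambda>t. X i t w)" "\<And>i t. t \<ge> 0 \<Longrightarrow> X i t \<in> borel_measurable \<Omega>"
    and T: "\<And>w. w \<in> space \<Omega> \<Longrightarrow> clock (\<lambda>t. T t w)" "\<And>t. t \<ge> 0 \<Longrightarrow> T t \<in> borel_measurable \<Omega>"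
    and q: "\<And>i. q i \<ge> 0"
  shows "(\<lambda>w. scaled_path a d q (\<lambda>i t. X i t w) (\<lambda>t. T t w)) \<in> \<Omega> \<rightarrow>\<^sub>M borel_of skorokhod_J1"
proof (rule measurable_into_skorokhod)
  show "scaled_path a d q (\<lambda>i t. X i t w) (\<lambda>t. T t w) \<in> skorokhod_space" if "w \<in> space \<Omega>" for w
    using X(1)[OF that] T(1)[OF that] q by (rule scaled_path_in_skorokhod_space)
  fix t :: real assume t: "t \<ge> 0"
  have [measurable]: "T t \<in> borel_measurable \<Omega>" using T(2)[OF t] .
  have [measurable]: "(\<lambda>w. X i (q i * T t w) w) \<in> borel_measurable \<Omega>" for i
  proof (rule borel_measurable_random_time[where X = "X i" and T = "\<lambda>w. q i * T t w"])
    show "0 \<le> q i * T t w" if "w \<in> space \<Omega>" for w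
      using clock_nonneg[OF T(1)[OF that] t] q by simp
  qed (use X in \<open>auto simp: cadlag_def\<close>)
  have "(\<lambda>w. \<chi> i. (X i (q i * T t w) w - a * (q i * T t w)) / d) \<in> borel_measurable \<Omega>"
    by (rule borel_measurable_vec_lambda) measurable
  then show "(\<lambda>w. scaled_path a d q (\<lambda>i t. X i t w) (\<lambda>t. T t w) t) \<in> borel_measurable \<Omega>"
    using t by (simp add: scaled_path_def)
qed

lemma continuous_map_borel_of:
  assumes "continuous_map S euclideanreal f"
  shows "f \<in> borel_measurable (borel_of S)"
proof (rule borel_measurableI)
  fix U :: "real set" assume "open U"
  then have "openin S {x \<in> topspace S. f x \<in> U}"
    using assms by (auto simp: continuous_map_def)
  moreover have "f -` U \<inter> space (borel_of S) = {x \<in> topspace S. f x \<in> U}"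
    by (auto simp: borel_of_def space_measure_of_conv)
  moreover have "sets (borel_of S) = sigma_sets (topspace S) {U. openin S U}"
    unfolding borel_of_def by (rule sets_measure_of) (auto dest: openin_subset)
  ultimately show "f -` U \<inter> space (borel_of S) \<in> sets (borel_of S)" by auto
qed

text \<open>The identity time change shows that locally uniform closeness implies J1 closeness.
  Composition with a fixed clock turns closeness on a long enough interval \<open>[0,S]\<close> into
  closeness on \<open>[0,T]\<close>.\<close>

lemma J1_continuous_composition:
  fixes f :: "(real \<Rightarrow> real ^ 'k::finite) \<Rightarrow> real"
  assumes f: "continuous_map skorokhod_J1 euclideanreal f" and y: "clock y" and p: "\<And>i. p i \<ge> 0"
  shows "locally_uniformly_continuous
    (\<lambda>v. if cadlag v then f (\<lambda>t\<in>{0..}. \<chi> i. v (p i * y t) $ i) else 0)"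
  unfolding locally_uniformly_continuous_def
proof (intro allI impI)
  let ?c = "\<lambda>v :: real \<Rightarrow> real ^ 'k. \<lambda>t\<in>{0..}. \<chi> i. v (p i * y t) $ i"
  have comp: "?c v \<in> skorokhod_space" if v: "cadlag v" for v :: "real \<Rightarrow> real ^ 'k"
    unfolding restrict_in_skorokhod_space
  proof (rule cadlag_vec)
    fix i
    have "cadlag (\<lambda>t. v t $ i)" using v by (rule cadlag_nth)
    moreover have "clock (\<lambda>t. p i * y t)" using y p by (intro clock_mult)
    ultimately show "cadlag (\<lambda>t. v (p i * y t) $ i)" by (rule cadlag_clock)
  qed
  fix v :: "real \<Rightarrow> real ^ 'k" and e :: real assume v: "cadlag v" and e: "e > 0"
  have "openin skorokhod_J1 {x \<in> topspace skorokhod_J1. f x \<in> ball (f (?c v)) e}"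
    using f by (auto simp: continuous_map_def)
  moreover have "?c v \<in> {x \<in> topspace skorokhod_J1. f x \<in> ball (f (?c v)) e}"
    using comp[OF v] e by (simp add: topspace_skorokhod_J1)
  ultimately obtain T e' where Te: "T > 0" "e' > 0"
    "J1_nbhd (?c v) T e' \<subseteq> {x \<in> topspace skorokhod_J1. f x \<in> ball (f (?c v)) e}"
    unfolding openin_skorokhod_J1 by blast
  \<comment> \<open>The sum bounds every \<open>p i * y t\<close> with \<open>t \<le> T\<close>;
    adding 1 makes \<open>S\<close> positive.\<close>
  define S where "S = (\<Sum>i\<in>UNIV. p i * y T) + 1"
  have yT: "y T \<ge> 0" using clock_nonneg[OF y] Te by simp
  have S: "p i * y t \<in> {0..S}" if "t \<in> {0..T}" for i t
  proof -
    have "p i * y t \<le> p i * y T" using clock_mono[OF y, of t T] that p by (intro mult_left_mono) auto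
    also have "\<dots> \<le> (\<Sum>i\<in>UNIV. p i * y T)" using p yT by (intro member_le_sum) auto
    finally show ?thesis using clock_nonneg[OF y, of t] p that by (simp add: S_def)
  qed
  have S0: "S > 0" using p yT by (auto simp: S_def intro!: add_nonneg_pos sum_nonneg)
  \<comment> \<open>The factor \<open>CARD('k)\<close> comes from bounding the Euclidean norm by the
    sum of the coordinates; the 2 makes the final inequality strict.\<close>
  define d where "d = e' / (2 * CARD('k))"
  have d: "d > 0" using Te by (simp add: d_def)
  have "\<bar>f (?c w) - f (?c v)\<bar> < e" if w: "cadlag w" and vw: "\<forall>s\<in>{0..S}. dist (v s) (w s) < d" for w
  proof -
    have "dist (?c w (id s)) (?c v s) < e'" if s: "s \<in> {0..T}" for s
    proof -
      have "dist (?c w s) (?c v s) \<le> (\<Sum>i\<in>UNIV. \<bar>(?c w s - ?c v s) $ i\<bar>)"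
        unfolding dist_norm by (rule norm_le_l1_cart)
      also have "\<dots> \<le> real CARD('k) * d"
      proof (rule sum_bounded_above)
        fix i :: 'k
        have "\<bar>(?c w s - ?c v s) $ i\<bar> = \<bar>(w (p i * y s) - v (p i * y s)) $ i\<bar>" using s by simp
        also have "\<dots> \<le> dist (v (p i * y s)) (w (p i * y s))"
          unfolding dist_commute[of "v (p i * y s)"] unfolding dist_norm by (rule component_le_norm_cart)
        also have "\<dots> \<le> d" using vw S[OF s] by (simp add: less_imp_le)
        finally show "\<bar>(?c w s - ?c v s) $ i\<bar> \<le> d" .
      qed
      also have "\<dots> = e' / 2" by (simp add: d_def)
      also have "\<dots> < e'" using Te by simp
      finally show ?thesis by simp
    qed
    moreover have "id \<in> time_changes" by (auto simp: time_changes_def strict_mono_on_def)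
    ultimately have "?c w \<in> J1_nbhd (?c v) T e'"
      unfolding J1_nbhd_def using comp[OF w] Te by (auto intro!: bexI[of _ id])
    then show ?thesis using Te(3) by (auto simp: dist_real_def abs_minus_commute)
  qed
  then show "\<exists>T>0. \<exists>d>0. \<forall>w. cadlag w \<longrightarrow> (\<forall>s\<in>{0..T}. dist (v s) (w s) < d) \<longrightarrow>
      \<bar>(if cadlag w then f (?c w) else 0) - (if cadlag v then f (?c v) else 0)\<bar> < e"
    using S0 d v by (intro exI[of _ S] conjI exI[of _ d]) auto
qed

section \<open>The limit theorem for a deterministic clock\<close>

lemma independent_processes_affine:
  fixes X :: "'k \<Rightarrow> real \<Rightarrow> 'a \<Rightarrow> real"
  assumes M: "prob_space M" and X: "independent_processes M X" and c: "c \<ge> 0"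
  shows "independent_processes M (\<lambda>i s \<omega>. (X i (c * s) \<omega> - a * s) / d)"
proof -
  interpret prob_space M by fact
  have "indep_vars (\<lambda>_. PiM {0..} (\<lambda>_. borel))
    (\<lambda>i \<omega>. (\<lambda>x. \<lambda>s\<in>{0..}. (x (c * s) - a * s) / d) (\<lambda>t\<in>{0..}. X i t \<omega>)) UNIV"
    using X unfolding independent_processes_def
  proof (rule indep_vars_compose2)
    show "(\<lambda>x. \<lambda>s\<in>{0..}. (x (c * s) - a * s) / d) \<in> PiM {0..} (\<lambda>_. borel) \<rightarrow>\<^sub>M PiM {0..} (\<lambda>_. borel :: real measure)"
      using c by (intro measurable_restrict borel_measurable_divide borel_measurable_diff measurable_component_singleton) auto
  qed
  then show ?thesis using c by (simp add: independent_processes_def cong: restrict_cong)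
qed

text \<open>The clock is absorbed into the test function: \<open>g\<close> is \<open>f\<close> after
  composition with \<open>y\<close>, and functional convergence is applied to \<open>g\<close> and
  to \<open>- g\<close>.\<close>

lemma poisson_brownian_convergence:
  fixes X B :: "'k::finite \<Rightarrow> real \<Rightarrow> 'a \<Rightarrow> real"
  assumes M: "prob_space M" and \<mu>: "\<mu> > 0" and p: "\<And>i. p i \<ge> 0"
    and X: "\<And>i. levy_process M (X i)" "independent_processes M X"
    and Xpath: "\<And>i \<omega>. \<omega> \<in> space M \<Longrightarrow> cadlag (\<lambda>t. X i t \<omega>) \<and> X i 0 \<omega> = 0"
    and Xlaw: "\<And>i t. t > 0 \<Longrightarrow> distr M borel (X i t) = distr (measure_pmf (poisson_pmf (\<mu> * t))) borel real"
    and B: "\<And>i. levy_process M (B i)" "independent_processes M B"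
    and Bpath: "\<And>i \<omega>. \<omega> \<in> space M \<Longrightarrow> continuous_on {0..} (\<lambda>t. B i t \<omega>) \<and> B i 0 \<omega> = 0"
    and Blaw: "\<And>i t. t > 0 \<Longrightarrow> distributed M lborel (B i t) (\<lambda>x. ennreal (normal_density 0 (sqrt t) x))"
    and c: "filterlim c at_top sequentially" "\<And>n. c n > 0"
    and y: "clock y"
    and f: "continuous_map skorokhod_J1 euclideanreal f" and bound: "\<And>x. x \<in> skorokhod_space \<Longrightarrow> \<bar>f x\<bar> \<le> C"
  shows "(\<lambda>n. \<integral>\<omega>. f (scaled_path \<mu> (sqrt (c n)) p (\<lambda>i t. X i t \<omega>) (\<lambda>t. c n * y t)) \<partial>M)
    \<longlonglongrightarrow> (\<integral>\<omega>. f (scaled_path 0 1 (\<lambda>i. p i * \<mu>) (\<lambda>i t. B i t \<omega>) y) \<partial>M)"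
proof -
  interpret prob_space M by fact
  \<comment> \<open>Evaluated at \<open>p i * y t\<close>, \<open>V\<close> gives the component of
    the Poisson path and \<open>W\<close> gives \<open>B i (p i * \<mu> * y t)\<close>.\<close>
  define V where "V n i s \<omega> = (X i (c n * s) \<omega> - (\<mu> * c n) * s) / sqrt (c n)" for n i s \<omega>
  define W where "W i s \<omega> = (B i (\<mu> * s) \<omega> - 0 * s) / 1" for i s \<omega>
  \<comment> \<open>The value 0 off the cadlag paths keeps \<open>g\<close> bounded, as
    \<open>f\<close> is controlled on the Skorokhod space only.\<close>
  define g where "g v = (if cadlag v then f (\<lambda>t\<in>{0..}. \<chi> i. v (p i * y t) $ i) else 0)" for v
  have vm: "X i t \<in> borel_measurable M" "B i t \<in> borel_measurable M" if "t \<ge> 0" for i t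
    using levy_process_measurable[OF X(1) that] levy_process_measurable[OF B(1) that] .
  have V: "levy_process M (V n i)" "independent_processes M (V n)" for n i
    unfolding V_def
    using levy_process_affine[OF M X(1) c(2)[of n], of i "\<mu> * c n" "sqrt (c n)"]
      independent_processes_affine[OF M X(2) less_imp_le[OF c(2)[of n]], of "\<mu> * c n" "sqrt (c n)"] .
  have W: "levy_process M (W i)" "independent_processes M W" for i
    unfolding W_def
    using levy_process_affine[OF M B(1) \<mu>, of i 0 1] independent_processes_affine[OF M B(2) less_imp_le[OF \<mu>], of 0 1] .
  have id: "cadlag (\<lambda>t::real. t)" using clock_cadlag[OF clock_linear[of 1]] by simp
  have Vpath: "cadlag (\<lambda>t. V n i t \<omega>) \<and> V n i 0 \<omega> = 0" if "\<omega> \<in> space M" for n i \<omega>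
  proof -
    have "cadlag (\<lambda>t. X i t \<omega>)" using Xpath[OF that] by blast
    then have "cadlag (\<lambda>t. X i (c n * t) \<omega>)"
      using clock_linear[OF less_imp_le[OF c(2)[of n]]] by (rule cadlag_clock)
    from cadlag_affine[OF this id] show ?thesis using Xpath[OF that] by (simp add: V_def)
  qed
  have Wpath: "continuous_on {0..} (\<lambda>t. W i t \<omega>) \<and> W i 0 \<omega> = 0" if "\<omega> \<in> space M" for i \<omega>
  proof -
    have "continuous_on {0..} (\<lambda>t. B i (\<mu> * t) \<omega>)"
      by (rule continuous_on_compose2[of "{0..}" "\<lambda>t. B i t \<omega>"])
         (use Bpath[OF that] \<mu> in \<open>auto intro!: continuous_intros\<close>)
    then show ?thesis using Bpath[OF that] by (simp add: W_def)
  qed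
  have Vlaw: "distr M borel (V n i h) = scaled_poisson (c n) (\<mu> * h)" if h: "h > 0" for n i h
  proof -
    have ch: "c n * h > 0" using c(2)[of n] h by simp
    have [measurable]: "X i (c n * h) \<in> borel_measurable M" using vm ch by simp
    have "distr M borel (V n i h) = distr (distr M borel (X i (c n * h))) borel (\<lambda>x. (x - \<mu> * c n * h) / sqrt (c n))"
      unfolding V_def by (subst distr_distr) (auto simp: o_def)
    also have "\<dots> = scaled_poisson (c n) (\<mu> * h)"
      unfolding Xlaw[OF ch] scaled_poisson_def by (subst distr_distr) (auto simp: o_def mult_ac)
    finally show ?thesis .
  qed
  \<comment> \<open>\<open>B undefined\<close> is an arbitrary coordinate; all have the same
    law.\<close>
  define \<nu> where "\<nu> h = distr M borel (B undefined (\<mu> * h))" for h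
  have Wlaw: "distr M borel (W i h) = \<nu> h" if h: "h > 0" for i h
  proof -
    have mh: "\<mu> * h > 0" using h \<mu> by simp
    have "distr M borel (B i (\<mu> * h)) = density lborel (\<lambda>x. ennreal (normal_density 0 (sqrt (\<mu> * h)) x))" for i
      using Blaw[OF mh, of i] unfolding distributed_def by (metis distr_cong sets_lborel)
    moreover have "W i h = B i (\<mu> * h)" by (simp add: W_def fun_eq_iff)
    ultimately show ?thesis by (simp add: \<nu>_def)
  qed
  have \<nu>: "real_distribution (\<nu> h)" "\<And>t. char (\<nu> h) t = of_real (exp (- (\<mu> * h) * t\<^sup>2 / 2))" if h: "h > 0" for h
  proof -
    have mh: "\<mu> * h > 0" using h \<mu> by simp
    have [measurable]: "B undefined (\<mu> * h) \<in> borel_measurable M" using vm mh by simp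
    show "real_distribution (\<nu> h)" unfolding \<nu>_def by (rule real_distribution_distr) simp
    fix t
    have "distributed M lborel (\<lambda>x. (B undefined (\<mu> * h) x - 0) / sqrt (\<mu> * h)) (\<lambda>x. ennreal (std_normal_density x))"
      using Blaw[OF mh, of undefined] mh by (subst (asm) normal_standard_normal_convert) auto
    then have std: "distr M borel (\<lambda>x. B undefined (\<mu> * h) x / sqrt (\<mu> * h)) = std_normal_distribution"
      unfolding distributed_def by (simp cong: distr_cong)
    have "char (\<nu> h) t = (\<integral>x. iexp ((t * sqrt (\<mu> * h)) * (B undefined (\<mu> * h) x / sqrt (\<mu> * h))) \<partial>M)"
      unfolding char_def \<nu>_def using h \<mu> by (subst integral_distr) auto
    also have "\<dots> = char (distr M borel (\<lambda>x. B undefined (\<mu> * h) x / sqrt (\<mu> * h))) (t * sqrt (\<mu> * h))"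
      unfolding char_def by (subst integral_distr) auto
    also have "\<dots> = of_real (exp (- ((t * sqrt (\<mu> * h))\<^sup>2) / 2))"
      unfolding std char_std_normal_distribution ..
    also have "(t * sqrt (\<mu> * h))\<^sup>2 = (\<mu> * h) * t\<^sup>2" using mh by (simp add: power_mult_distrib)
    finally show "char (\<nu> h) t = of_real (exp (- (\<mu> * h) * t\<^sup>2 / 2))" by simp
  qed
  have conv: "weak_conv_m (\<lambda>n. scaled_poisson (c n) (\<mu> * h)) (\<nu> h)" if h: "h > 0" for h
    using scaled_poisson_clt[OF c, of "\<mu> * h" "\<nu> h"] \<nu>[OF h] h \<mu> by simp
  have tail: "\<forall>\<^sub>F n in sequentially. \<forall>l. 0 < l \<and> l \<le> 1 / real m \<longrightarrow>
      measure (scaled_poisson (c n) (\<mu> * l)) {x. \<bar>x\<bar> \<ge> \<epsilon>} \<le> 2 * exp (\<mu> - \<epsilon> * sqrt (real m))"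
    if m: "m > 0" for m :: nat and \<epsilon> :: real
  proof -
    \<comment> \<open>For \<open>h = 1 / m\<close> this is the condition
      \<open>c * h \<ge> 1\<close> of the tail bound.\<close>
    have "\<forall>\<^sub>F n in sequentially. real m \<le> c n" using c(1) by (simp add: filterlim_at_top)
    then show ?thesis
    proof eventually_elim
      case (elim n)
      have "1 / real m > 0" "c n * (1 / real m) \<ge> 1" using m elim by (auto simp: field_simps)
      note tl = scaled_poisson_tail[OF c(2)[of n] this \<mu>, of _ \<epsilon>]
      then show ?case by (auto simp: real_sqrt_divide)
    qed
  qed
  have C: "C \<ge> 0"
  proof -
    have "(\<lambda>t\<in>{0..}. 0 :: real ^ 'k) \<in> skorokhod_space"
      unfolding restrict_in_skorokhod_space by (rule cadlag_const)
    from bound[OF this] show ?thesis by linarith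
  qed
  have comp: "(\<lambda>t\<in>{0..}. \<chi> i. v (p i * y t) $ i) = scaled_path 0 1 p (\<lambda>i s. v s $ i) y" for v :: "real \<Rightarrow> real ^ 'k"
    by (simp add: scaled_path_def)
  have gbound: "\<bar>g v\<bar> \<le> C" for v
  proof (cases "cadlag v")
    case True
    have "scaled_path 0 1 p (\<lambda>i s. v s $ i) y \<in> skorokhod_space"
      by (rule scaled_path_in_skorokhod_space[OF _ y p]) (rule cadlag_nth[OF True])
    then show ?thesis using bound True unfolding g_def comp by simp
  qed (simp add: g_def C)
  have luc: "locally_uniformly_continuous g"
    unfolding g_def using J1_continuous_composition[OF f y p] .
  then have luc': "locally_uniformly_continuous (\<lambda>v. - g v)"
    unfolding locally_uniformly_continuous_def by (simp add: abs_minus_commute)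
  have contW: "cadlag (\<lambda>t. W i t \<omega>)" if "\<omega> \<in> space M" for i \<omega>
    using Wpath[OF that] by (intro continuous_cadlag) auto
  have gV: "g (\<lambda>t. \<chi> i. F i t \<omega>) = f (scaled_path 0 1 p (\<lambda>i s. F i s \<omega>) y)" if "\<And>i. cadlag (\<lambda>t. F i t \<omega>)"
    for F :: "'k \<Rightarrow> real \<Rightarrow> 'a \<Rightarrow> real" and \<omega>
    using cadlag_vec[of "\<lambda>i t. F i t \<omega>"] that by (simp add: g_def scaled_path_def)
  have gmeas: "(\<lambda>\<omega>. g (\<lambda>t. \<chi> i. F i t \<omega>)) \<in> borel_measurable M"
    if F: "\<And>i t. t \<ge> 0 \<Longrightarrow> F i t \<in> borel_measurable M" "\<And>i \<omega>. \<omega> \<in> space M \<Longrightarrow> cadlag (\<lambda>t. F i t \<omega>)"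
    for F :: "'k \<Rightarrow> real \<Rightarrow> 'a \<Rightarrow> real"
  proof -
    have "(\<lambda>\<omega>. scaled_path 0 1 p (\<lambda>i s. F i s \<omega>) (\<lambda>t. y t)) \<in> M \<rightarrow>\<^sub>M borel_of skorokhod_J1"
      by (rule scaled_path_measurable) (use F y p in auto)
    then have "(\<lambda>\<omega>. f (scaled_path 0 1 p (\<lambda>i s. F i s \<omega>) y)) \<in> borel_measurable M"
      by (rule measurable_compose[OF _ continuous_map_borel_of[OF f]])
    then show ?thesis by (subst measurable_cong[OF gV[OF F(2)]])
  qed
  have gVm: "(\<lambda>\<omega>. g (\<lambda>t. \<chi> i. V n i t \<omega>)) \<in> borel_measurable M" for n
    using Vpath levy_process_measurable[OF V(1)] by (intro gmeas) auto
  have gWm: "(\<lambda>\<omega>. g (\<lambda>t. \<chi> i. W i t \<omega>)) \<in> borel_measurable M"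
    using contW levy_process_measurable[OF W(1)] by (intro gmeas) auto
  let ?GV = "\<lambda>n. \<integral>\<omega>. g (\<lambda>t. \<chi> i. V n i t \<omega>) \<partial>M" and ?GW = "\<integral>\<omega>. g (\<lambda>t. \<chi> i. W i t \<omega>) \<partial>M"
  let ?PX = "\<lambda>n \<omega>. scaled_path \<mu> (sqrt (c n)) p (\<lambda>i t. X i t \<omega>) (\<lambda>t. c n * y t)"
  let ?PB = "\<lambda>\<omega>. scaled_path 0 1 (\<lambda>i. p i * \<mu>) (\<lambda>i t. B i t \<omega>) y"
  note lower = functional_convergence_lower[where \<mu> = "\<lambda>h n. scaled_poisson (c n) (\<mu> * h)" and \<nu> = \<nu> and b = \<mu>,
      OF M V Vpath Vlaw W Wpath Wlaw conv tail]
  have lo: "\<forall>\<^sub>F n in sequentially. ?GV n \<ge> ?GW - \<delta>" if "\<delta> > 0" for \<delta>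
    by (rule lower[where g = g and C = C]) (use gbound luc gVm gWm that in auto)
  have hi: "\<forall>\<^sub>F n in sequentially. ?GV n \<le> ?GW + \<delta>" if "\<delta> > 0" for \<delta>
  proof -
    have "\<forall>\<^sub>F n in sequentially. (\<integral>\<omega>. - g (\<lambda>t. \<chi> i. V n i t \<omega>) \<partial>M) \<ge> (\<integral>\<omega>. - g (\<lambda>t. \<chi> i. W i t \<omega>) \<partial>M) - \<delta>"
      by (rule lower[where g = "\<lambda>v. - g v" and C = C]) (use gbound luc' gVm gWm that in auto)
    then show ?thesis by eventually_elim simp
  qed
  have lim: "(\<lambda>n. ?GV n) \<longlonglongrightarrow> ?GW"
  proof (rule tendstoI)
    fix e :: real assume "e > 0"
    then have "e / 2 > 0" by simp
    from lo[OF this] hi[OF this]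
    show "\<forall>\<^sub>F n in sequentially. dist (?GV n) ?GW < e"
      by eventually_elim (use \<open>e > 0\<close> in \<open>simp add: dist_real_def abs_less_iff\<close>)
  qed
  have "?GV n = (\<integral>\<omega>. f (?PX n \<omega>) \<partial>M)" for n
  proof (intro Bochner_Integration.integral_cong refl)
    fix \<omega> assume "\<omega> \<in> space M"
    then have "g (\<lambda>t. \<chi> i. V n i t \<omega>) = f (scaled_path 0 1 p (\<lambda>i s. V n i s \<omega>) y)"
      using Vpath by (intro gV) auto
    also have "scaled_path 0 1 p (\<lambda>i s. V n i s \<omega>) y = ?PX n \<omega>"
      by (simp add: scaled_path_def V_def mult_ac)
    finally show "g (\<lambda>t. \<chi> i. V n i t \<omega>) = f (?PX n \<omega>)" .
  qed
  moreover have "?GW = (\<integral>\<omega>. f (?PB \<omega>) \<partial>M)"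
  proof (intro Bochner_Integration.integral_cong refl)
    fix \<omega> assume "\<omega> \<in> space M"
    then have "g (\<lambda>t. \<chi> i. W i t \<omega>) = f (scaled_path 0 1 p (\<lambda>i s. W i s \<omega>) y)"
      using contW by (intro gV) auto
    also have "scaled_path 0 1 p (\<lambda>i s. W i s \<omega>) y = ?PB \<omega>"
      by (simp add: scaled_path_def W_def mult_ac)
    finally show "g (\<lambda>t. \<chi> i. W i t \<omega>) = f (?PB \<omega>)" .
  qed
  ultimately show ?thesis using lim by simp
qed

section \<open>Independence and the random clock\<close>

lemma (in prob_space) indep_sets_reindex:
  assumes F: "indep_sets F (f ` I)" and f: "inj_on f I"
  shows "indep_sets (\<lambda>i. F (f i)) I"
proof (rule indep_setsI)
  show "F (f i) \<subseteq> events" if "i \<in> I" for i using F that by (auto simp: indep_sets_def)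
  fix A J assume J: "J \<noteq> {}" "J \<subseteq> I" "finite J" and A: "\<forall>j\<in>J. A j \<in> F (f j)"
  have inj: "inj_on f J" using f J by (auto intro: inj_on_subset)
  define A' where "A' = (\<lambda>k. A (the_inv_into J f k))"
  have A': "A' (f j) = A j" if "j \<in> J" for j using the_inv_into_f_f[OF inj that] by (simp add: A'_def)
  have "prob (\<Inter>k\<in>f ` J. A' k) = (\<Prod>k\<in>f ` J. prob (A' k))"
    by (rule indep_setsD[OF F]) (use J A A' in auto)
  then show "prob (\<Inter>j\<in>J. A j) = (\<Prod>j\<in>J. prob (A j))"
    using A' by (simp add: prod.reindex[OF inj])
qed

lemma (in prob_space) indep_vars_reindex:
  assumes "indep_vars N X (f ` I)" "inj_on f I"
  shows "indep_vars (\<lambda>i. N (f i)) (\<lambda>i. X (f i)) I"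
  using assms indep_sets_reindex[of "\<lambda>i. {X i -` A \<inter> space M |A. A \<in> sets (N i)}" f I]
  by (auto simp: indep_vars_def2)

text \<open>Independence of a finite family says that its joint law is a product, and laws do not
  see null sets.\<close>

lemma (in prob_space) indep_vars_cong_AE:
  assumes I: "finite I" and X: "indep_vars N X I"
    and eq: "\<And>i. i \<in> I \<Longrightarrow> AE \<omega> in M. X i \<omega> = X' i \<omega>" and X': "\<And>i. i \<in> I \<Longrightarrow> X' i \<in> M \<rightarrow>\<^sub>M N i"
  shows "indep_vars N X' I"
proof (cases "I = {}")
  case True then show ?thesis by (simp add: indep_vars_def indep_sets_def)
next
  case False
  have Xm: "X i \<in> M \<rightarrow>\<^sub>M N i" if "i \<in> I" for i using X that by (auto simp: indep_vars_def)
  have "AE \<omega> in M. \<forall>i\<in>I. X i \<omega> = X' i \<omega>" using I eq by (intro AE_finite_allI) auto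
  then have "AE \<omega> in M. (\<lambda>i\<in>I. X' i \<omega>) = (\<lambda>i\<in>I. X i \<omega>)" by eventually_elim (auto intro: restrict_ext)
  then have "distr M (PiM I N) (\<lambda>\<omega>. \<lambda>i\<in>I. X' i \<omega>) = distr M (PiM I N) (\<lambda>\<omega>. \<lambda>i\<in>I. X i \<omega>)"
    by (intro distr_cong_AE refl measurable_restrict X' Xm)
  also have "\<dots> = PiM I (\<lambda>i. distr M (N i) (X i))"
    using X Xm False by (subst (asm) indep_vars_iff_distr_eq_PiM') auto
  also have "\<dots> = PiM I (\<lambda>i. distr M (N i) (X' i))"
    by (intro PiM_cong refl distr_cong_AE eq Xm X')
  finally show ?thesis using X' False by (subst indep_vars_iff_distr_eq_PiM') auto
qed

lemma (in prob_space) indep_vars_restrict_space: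
  assumes X: "indep_vars N X I" and \<Omega>: "\<And>i. i \<in> I \<Longrightarrow> X i \<in> space M \<rightarrow> \<Omega> i"
  shows "indep_vars (\<lambda>i. restrict_space (N i) (\<Omega> i)) X I"
  unfolding indep_vars_def2
proof (intro conjI ballI)
  show "X i \<in> M \<rightarrow>\<^sub>M restrict_space (N i) (\<Omega> i)" if "i \<in> I" for i
    using X \<Omega>[OF that] that by (auto simp: indep_vars_def intro: measurable_restrict_space2)
  have "indep_sets (\<lambda>i. {X i -` A \<inter> space M |A. A \<in> sets (N i)}) I" using X by (simp add: indep_vars_def2)
  then show "indep_sets (\<lambda>i. {X i -` A \<inter> space M |A. A \<in> sets (restrict_space (N i) (\<Omega> i))}) I"
  proof (rule indep_sets_mono_sets)
    fix i assume i: "i \<in> I"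
    show "{X i -` A \<inter> space M |A. A \<in> sets (restrict_space (N i) (\<Omega> i))} \<subseteq> {X i -` A \<inter> space M |A. A \<in> sets (N i)}"
    proof safe
      fix A assume "A \<in> sets (restrict_space (N i) (\<Omega> i))"
      then obtain A' where A': "A' \<in> sets (N i)" "A = \<Omega> i \<inter> A'" by (auto simp: sets_restrict_space)
      have "X i -` A \<inter> space M = X i -` A' \<inter> space M" using \<Omega>[OF i] A' by auto
      then show "\<exists>A'. X i -` A \<inter> space M = X i -` A' \<inter> space M \<and> A' \<in> sets (N i)" using A' by blast
    qed
  qed
qed

text \<open>A set of the trace is \<open>\<Omega> \<inter> A'\<close> with \<open>A'\<close>
  measurable, and for a map into \<open>\<Omega>\<close> it has the same preimage as
  \<open>A'\<close>.\<close>

lemma distr_restrict_space_eq: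
  assumes eq: "distr M N X = distr M N Y" and X: "X \<in> M \<rightarrow>\<^sub>M N" "X \<in> space M \<rightarrow> \<Omega>" and Y: "Y \<in> M \<rightarrow>\<^sub>M N" "Y \<in> space M \<rightarrow> \<Omega>"
  shows "distr M (restrict_space N \<Omega>) X = distr M (restrict_space N \<Omega>) Y"
proof (rule measure_eqI)
  fix A assume "A \<in> sets (distr M (restrict_space N \<Omega>) X)"
  then obtain A' where A': "A' \<in> sets N" "A = \<Omega> \<inter> A'" by (auto simp: sets_restrict_space)
  have *: "emeasure (distr M (restrict_space N \<Omega>) Z) A = emeasure (distr M N Z) A'"
    if Z: "Z \<in> M \<rightarrow>\<^sub>M N" "Z \<in> space M \<rightarrow> \<Omega>" for Z
  proof -
    have "Z \<in> M \<rightarrow>\<^sub>M restrict_space N \<Omega>" using Z by (intro measurable_restrict_space2)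
    moreover have "A \<in> sets (restrict_space N \<Omega>)" using A' by (auto simp: sets_restrict_space)
    moreover have "Z -` A \<inter> space M = Z -` A' \<inter> space M" using Z A' by auto
    ultimately show ?thesis using Z A' by (simp add: emeasure_distr)
  qed
  show "emeasure (distr M (restrict_space N \<Omega>) X) A = emeasure (distr M (restrict_space N \<Omega>) Y) A"
    using *[OF X] *[OF Y] eq by simp
qed simp

lemma levy_process_cong_AE:
  assumes M: "prob_space M" and X: "levy_process M X"
    and eq: "AE \<omega> in M. \<forall>t\<ge>0. X t \<omega> = X' t \<omega>" and X': "\<And>t. t \<ge> 0 \<Longrightarrow> X' t \<in> borel_measurable M"
  shows "levy_process M X'"
  unfolding levy_process_def
proof (intro conjI allI impI)
  interpret prob_space M by fact
  note Xm = levy_process_measurable[OF X]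
  have eqt: "AE \<omega> in M. X t \<omega> = X' t \<omega>" if "t \<ge> 0" for t using eq by eventually_elim (use that in auto)
  show "X' t \<in> borel_measurable M" if "t \<ge> 0" for t using X' that .
  have "AE \<omega> in M. X 0 \<omega> = 0" using X by (simp add: levy_process_def)
  then show "AE \<omega> in M. X' 0 \<omega> = 0" using eqt[OF order_refl] by eventually_elim auto
  have "AE \<omega> in M. cadlag (\<lambda>t. X t \<omega>)" using X by (simp add: levy_process_def)
  then show "AE \<omega> in M. cadlag (\<lambda>t. X' t \<omega>)"
    using eq
  proof eventually_elim
    case (elim \<omega>)
    then show ?case using cadlag_cong[of "\<lambda>t. X t \<omega>" "\<lambda>t. X' t \<omega>"] by simp
  qed
  show "distr M borel (\<lambda>\<omega>. X' (s + h) \<omega> - X' s \<omega>) = distr M borel (X' h)" if s: "s \<ge> 0" and h: "h \<ge> 0" for s h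
  proof -
    have "AE \<omega> in M. X (s + h) \<omega> - X s \<omega> = X' (s + h) \<omega> - X' s \<omega>"
      using eq by eventually_elim (use s h in auto)
    then have "distr M borel (\<lambda>\<omega>. X' (s + h) \<omega> - X' s \<omega>) = distr M borel (\<lambda>\<omega>. X (s + h) \<omega> - X s \<omega>)"
      using s h by (intro distr_cong_AE[symmetric] borel_measurable_diff Xm X') auto
    also have "\<dots> = distr M borel (X h)" by (rule levy_process_increment[OF X s h])
    also have "\<dots> = distr M borel (X' h)" using h by (intro distr_cong_AE eqt Xm X') auto
    finally show ?thesis .
  qed
  fix t :: "nat \<Rightarrow> real" and n assume t: "0 \<le> t 0 \<and> mono t"
  then have tk: "t k \<ge> 0" for k using monoD[of t 0 k] by auto
  show "indep_vars (\<lambda>_. borel) (\<lambda>k \<omega>. X' (t (Suc k)) \<omega> - X' (t k) \<omega>) {..<n}"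
  proof (rule indep_vars_cong_AE)
    show "indep_vars (\<lambda>_. borel) (\<lambda>k \<omega>. X (t (Suc k)) \<omega> - X (t k) \<omega>) {..<n}"
      using t by (intro levy_process_indep[OF X]) auto
    show "AE \<omega> in M. X (t (Suc k)) \<omega> - X (t k) \<omega> = X' (t (Suc k)) \<omega> - X' (t k) \<omega>" for k
      using eq by eventually_elim (use tk in auto)
    show "(\<lambda>\<omega>. X' (t (Suc k)) \<omega> - X' (t k) \<omega>) \<in> borel_measurable M" for k
      using tk by (intro borel_measurable_diff X')
  qed simp
qed

lemma independent_processes_cong_AE:
  fixes X X' :: "'j::finite \<Rightarrow> real \<Rightarrow> 'a \<Rightarrow> real"
  assumes M: "prob_space M" and X: "independent_processes M X"
    and eq: "\<And>j. AE \<omega> in M. \<forall>t\<ge>0. X j t \<omega> = X' j t \<omega>" and X': "\<And>j t. t \<ge> 0 \<Longrightarrow> X' j t \<in> borel_measurable M"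
  shows "independent_processes M X'"
proof -
  interpret prob_space M by fact
  show ?thesis
    unfolding independent_processes_def
  proof (rule indep_vars_cong_AE[OF _ X[unfolded independent_processes_def]])
    show "AE \<omega> in M. (\<lambda>t\<in>{0..}. X j t \<omega>) = (\<lambda>t\<in>{0..}. X' j t \<omega>)" for j
      using eq[of j] by eventually_elim (auto intro: restrict_ext)
    show "(\<lambda>\<omega>. \<lambda>t\<in>{0..}. X' j t \<omega>) \<in> M \<rightarrow>\<^sub>M PiM {0..} (\<lambda>_. borel)" for j
      by (intro measurable_restrict X') auto
  qed simp
qed

text \<open>The set \<open>{x. P x}\<close> is typically not measurable in the product space. Only the trace sigma-algebra
  matters here; the measure of this restriction is never used.\<close>

definition path_space :: "((real \<Rightarrow> real) \<Rightarrow> bool) \<Rightarrow> (real \<Rightarrow> real) measure" where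
  "path_space P = restrict_space (PiM {0..} (\<lambda>_. borel)) {x. P x}"

lemma measurable_path_space_eval: "t \<ge> 0 \<Longrightarrow> (\<lambda>x. x t) \<in> borel_measurable (path_space P)"
  unfolding path_space_def by (intro measurable_restrict_space1 measurable_component_singleton) auto

section \<open>Fubini's theorem for independent paths and clock\<close>

lemma (in prob_space) measurable_expectation_section:
  fixes \<Psi> :: "'b \<times> 'c \<Rightarrow> real"
  assumes A [measurable]: "A \<in> M \<rightarrow>\<^sub>M S" and \<Psi> [measurable]: "\<Psi> \<in> borel_measurable (S \<Otimes>\<^sub>M T)"
  shows "(\<lambda>y. \<integral>\<omega>. \<Psi> (A \<omega>, y) \<partial>M) \<in> borel_measurable T"
proof (rule borel_measurable_lebesgue_integral)
  show "(\<lambda>(y, \<omega>). \<Psi> (A \<omega>, y)) \<in> borel_measurable (T \<Otimes>\<^sub>M M)" by measurable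
qed

lemma (in prob_space) indep_var_integral:
  fixes \<Psi> :: "'b \<times> 'b \<Rightarrow> real"
  assumes iv: "indep_var S A T B" and \<Psi> [measurable]: "\<Psi> \<in> borel_measurable (S \<Otimes>\<^sub>M T)"
    and bound: "\<And>z. z \<in> space (S \<Otimes>\<^sub>M T) \<Longrightarrow> \<bar>\<Psi> z\<bar> \<le> C"
  shows "(\<integral>\<omega>. \<Psi> (A \<omega>, B \<omega>) \<partial>M) = (\<integral>\<omega>'. (\<integral>\<omega>. \<Psi> (A \<omega>, B \<omega>') \<partial>M) \<partial>M)"
proof -
  have rv [measurable]: "A \<in> M \<rightarrow>\<^sub>M S" "B \<in> M \<rightarrow>\<^sub>M T" using indep_var_rv1[OF iv] indep_var_rv2[OF iv] .
  have joint: "distr M S A \<Otimes>\<^sub>M distr M T B = distr M (S \<Otimes>\<^sub>M T) (\<lambda>\<omega>. (A \<omega>, B \<omega>))"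
    using iv by (simp only: indep_var_distribution_eq)
  have m: "(\<lambda>y. \<integral>\<omega>. \<Psi> (A \<omega>, y) \<partial>M) \<in> borel_measurable T"
    by (rule measurable_expectation_section) (rule rv \<Psi>)+
  interpret DA: prob_space "distr M S A" by (rule prob_space_distr) (rule rv)
  interpret DB: prob_space "distr M T B" by (rule prob_space_distr) (rule rv)
  interpret pair_prob_space "distr M S A" "distr M T B" ..
  have \<Psi>m: "\<Psi> \<in> borel_measurable (distr M S A \<Otimes>\<^sub>M distr M T B)"
    unfolding joint by simp
  have inner: "(\<integral>x. \<Psi> (x, y) \<partial>distr M S A) = (\<integral>\<omega>. \<Psi> (A \<omega>, y) \<partial>M)" if "y \<in> space T" for y
    by (rule integral_distr[OF rv(1)]) (use that in measurable)
  have "integrable (distr M S A \<Otimes>\<^sub>M distr M T B) \<Psi>"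
    by (rule P.integrable_const_bound[where B = C, OF _ \<Psi>m])
       (auto intro!: AE_I2 bound simp: space_pair_measure)
  then have int: "integrable (distr M S A \<Otimes>\<^sub>M distr M T B) (case_prod (\<lambda>x y. \<Psi> (x, y)))" by simp
  have "(\<integral>\<omega>. \<Psi> (A \<omega>, B \<omega>) \<partial>M) = (\<integral>z. \<Psi> z \<partial>distr M (S \<Otimes>\<^sub>M T) (\<lambda>\<omega>. (A \<omega>, B \<omega>)))"
    by (intro integral_distr[symmetric]) measurable
  also have "\<dots> = (\<integral>z. \<Psi> z \<partial>(distr M S A \<Otimes>\<^sub>M distr M T B))" unfolding joint ..
  also have "\<dots> = (\<integral>y. (\<integral>x. \<Psi> (x, y) \<partial>distr M S A) \<partial>distr M T B)"
    using integral_snd[OF int] by simp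
  also have "\<dots> = (\<integral>y. (\<integral>\<omega>. \<Psi> (A \<omega>, y) \<partial>M) \<partial>distr M T B)"
    by (intro Bochner_Integration.integral_cong refl inner) simp
  also have "\<dots> = (\<integral>\<omega>'. (\<integral>\<omega>. \<Psi> (A \<omega>, B \<omega>') \<partial>M) \<partial>M)"
    by (rule integral_distr[OF rv(2) m])
  finally show ?thesis .
qed

text \<open>Independence lets the inner expectation be taken with the path of \<open>Y\<close>
  frozen. The trace sigma-algebras matter because \<open>\<Phi>\<close> is measurable only among
  paths with properties \<open>P\<close> and \<open>Q\<close>.\<close>

lemma decoupling:
  fixes X :: "'k::finite \<Rightarrow> real \<Rightarrow> 'a \<Rightarrow> real" and \<Phi> :: "('k \<Rightarrow> real \<Rightarrow> real) \<times> (real \<Rightarrow> real) \<Rightarrow> real"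
  assumes M: "prob_space M"
    and ind: "independent_processes M (\<lambda>j. case j of None \<Rightarrow> Y | Some i \<Rightarrow> X i)"
    and X: "\<And>i \<omega>. \<omega> \<in> space M \<Longrightarrow> P (\<lambda>t\<in>{0..}. X i t \<omega>)" and Y: "\<And>\<omega>. \<omega> \<in> space M \<Longrightarrow> Q (\<lambda>t\<in>{0..}. Y t \<omega>)"
    and \<Phi>: "\<Phi> \<in> borel_measurable (PiM UNIV (\<lambda>_. path_space P) \<Otimes>\<^sub>M path_space Q)"
    and bound: "\<And>z. z \<in> space (PiM UNIV (\<lambda>_. path_space P) \<Otimes>\<^sub>M path_space Q) \<Longrightarrow> \<bar>\<Phi> z\<bar> \<le> C"
  shows "(\<integral>\<omega>. \<Phi> (\<lambda>i. \<lambda>t\<in>{0..}. X i t \<omega>, \<lambda>t\<in>{0..}. Y t \<omega>) \<partial>M) =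
      (\<integral>\<omega>'. (\<integral>\<omega>. \<Phi> (\<lambda>i. \<lambda>t\<in>{0..}. X i t \<omega>, \<lambda>t\<in>{0..}. Y t \<omega>') \<partial>M) \<partial>M)" (is ?eq)
    and "(\<lambda>y. \<integral>\<omega>. \<Phi> (\<lambda>i. \<lambda>t\<in>{0..}. X i t \<omega>, y) \<partial>M) \<in> borel_measurable (path_space Q)" (is ?meas)
proof -
  interpret prob_space M by fact
  let ?B = "PiM {0::real..} (\<lambda>_. borel :: real measure)"
  let ?S = "PiM (UNIV :: 'k set) (\<lambda>_. path_space P)" and ?T = "path_space Q"
  define N where "N j = (case j of None \<Rightarrow> path_space Q | Some (i :: 'k) \<Rightarrow> path_space P)" for j
  define Z where "Z j \<omega> = (\<lambda>t\<in>{0..}. (case j of None \<Rightarrow> Y | Some i \<Rightarrow> X i) t \<omega>)" for j \<omega>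
  define \<Omega> where "\<Omega> j = (case j of None \<Rightarrow> {x. Q x} | Some (i :: 'k) \<Rightarrow> {x. P x})" for j
  have N: "N = (\<lambda>j. restrict_space ?B (\<Omega> j))"
    by (auto simp: N_def \<Omega>_def path_space_def fun_eq_iff split: option.split)
  have indZ: "indep_vars N Z UNIV"
    unfolding N
  proof (rule indep_vars_restrict_space)
    show "indep_vars (\<lambda>_. ?B) Z UNIV"
      using ind unfolding independent_processes_def Z_def .
    show "Z j \<in> space M \<rightarrow> \<Omega> j" for j
      using X Y by (cases j) (auto simp: Z_def \<Omega>_def)
  qed
  let ?X = "\<lambda>\<omega> i. \<lambda>t\<in>{0..}. X i t \<omega>" and ?Y = "\<lambda>\<omega>. \<lambda>t\<in>{0..}. Y t \<omega>"
  \<comment> \<open>Both halves are families over \<open>'k option\<close>; this gives them the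
    common type that \<open>indep_var\<close> requires.\<close>
  let ?A = "PiM (range Some) N" and ?B' = "PiM {None} N"
  have iv: "indep_var ?A (\<lambda>\<omega>. \<lambda>j\<in>range Some. Z j \<omega>) ?B' (\<lambda>\<omega>. \<lambda>j\<in>{None}. Z j \<omega>)"
    by (rule indep_var_restrict[OF indZ]) auto
  have pA: "(\<lambda>p i. p (Some i)) \<in> ?A \<rightarrow>\<^sub>M ?S"
  proof (rule measurable_abs_UNIV)
    show "(\<lambda>p. p (Some i)) \<in> ?A \<rightarrow>\<^sub>M path_space P" for i
      using measurable_component_singleton[of "Some i" "range Some" N] by (simp add: N_def)
  qed
  have pB: "(\<lambda>p. p None) \<in> ?B' \<rightarrow>\<^sub>M ?T"
    using measurable_component_singleton[of None "{None}" N] by (simp add: N_def)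
  define \<Psi> where "\<Psi> z = \<Phi> (\<lambda>i. fst z (Some i), snd z None)" for z :: "('k option \<Rightarrow> real \<Rightarrow> real) \<times> ('k option \<Rightarrow> real \<Rightarrow> real)"
  have pair: "(\<lambda>z. (\<lambda>i. fst z (Some i), snd z None)) \<in> ?A \<Otimes>\<^sub>M ?B' \<rightarrow>\<^sub>M ?S \<Otimes>\<^sub>M ?T"
    using measurable_compose[OF measurable_fst pA] measurable_compose[OF measurable_snd pB] by (rule measurable_Pair)
  have \<Psi>m: "\<Psi> \<in> borel_measurable (?A \<Otimes>\<^sub>M ?B')"
    unfolding \<Psi>_def by (rule measurable_compose[OF pair \<Phi>])
  have \<Psi>b: "\<bar>\<Psi> z\<bar> \<le> C" if "z \<in> space (?A \<Otimes>\<^sub>M ?B')" for z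
    unfolding \<Psi>_def by (rule bound) (rule measurable_space[OF pair that])
  have \<Psi>Z: "\<Psi> (\<lambda>j\<in>range Some. Z j \<omega>, \<lambda>j\<in>{None}. Z j \<omega>') = \<Phi> (?X \<omega>, ?Y \<omega>')" for \<omega> \<omega>'
    by (simp add: \<Psi>_def Z_def)
  show ?eq
    using indep_var_integral[OF iv \<Psi>m \<Psi>b] unfolding \<Psi>Z .
  have "?X \<in> M \<rightarrow>\<^sub>M ?S"
  proof (rule measurable_abs_UNIV)
    show "(\<lambda>\<omega>. \<lambda>t\<in>{0..}. X i t \<omega>) \<in> M \<rightarrow>\<^sub>M path_space P" for i
    proof -
      have "Z (Some i) \<in> M \<rightarrow>\<^sub>M N (Some i)" using indZ unfolding indep_vars_def by blast
      moreover have "Z (Some i) = (\<lambda>\<omega>. \<lambda>t\<in>{0..}. X i t \<omega>)" by (auto simp: Z_def fun_eq_iff)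
      ultimately show ?thesis by (simp add: N_def)
    qed
  qed
  then show ?meas using \<Phi> by (rule measurable_expectation_section)
qed

lemma (in prob_space) abs_expectation_le:
  fixes h :: "'a \<Rightarrow> real"
  assumes "\<And>\<omega>. \<omega> \<in> space M \<Longrightarrow> \<bar>h \<omega>\<bar> \<le> C"
  shows "\<bar>\<integral>\<omega>. h \<omega> \<partial>M\<bar> \<le> C"
proof -
  have "\<bar>\<integral>\<omega>. h \<omega> \<partial>M\<bar> \<le> (\<integral>\<omega>. \<bar>h \<omega>\<bar> \<partial>M)" by (rule integral_abs_bound)
  also have "\<dots> \<le> (\<integral>\<omega>. C \<partial>M)"
    by (rule integral_mono') (use assms in \<open>auto intro: order_trans[OF abs_ge_zero]\<close>)
  finally show ?thesis by (simp add: prob_space)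
qed

lemma path_space_scaled_path_measurable:
  assumes q: "\<And>i. q i \<ge> 0" and u: "u > 0"
  shows "(\<lambda>z. scaled_path a d q (fst z) (\<lambda>t. snd z (u * t)))
    \<in> PiM (UNIV :: 'k::finite set) (\<lambda>_. path_space cadlag) \<Otimes>\<^sub>M path_space clock \<rightarrow>\<^sub>M borel_of skorokhod_J1"
proof -
  let ?S = "PiM (UNIV :: 'k set) (\<lambda>_. path_space cadlag)" and ?T = "path_space clock"
  have "(\<lambda>z. scaled_path a d q (\<lambda>i t. fst z i t) (\<lambda>t. snd z (u * t))) \<in> ?S \<Otimes>\<^sub>M ?T \<rightarrow>\<^sub>M borel_of skorokhod_J1"
  proof (rule scaled_path_measurable)
    fix z assume "z \<in> space (?S \<Otimes>\<^sub>M ?T)"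
    then have z: "fst z \<in> space ?S" "snd z \<in> space ?T" by (auto simp: space_pair_measure)
    show "cadlag (\<lambda>t. fst z i t)" for i
      using z(1) by (auto simp: space_PiM path_space_def space_restrict_space PiE_iff)
    have "clock (snd z)" using z(2) by (auto simp: path_space_def space_restrict_space)
    from clock_scale[OF this, of 1 u] show "clock (\<lambda>t. snd z (u * t))" using u by simp
  next
    show "(\<lambda>z. fst z i t) \<in> borel_measurable (?S \<Otimes>\<^sub>M ?T)" if "t \<ge> 0" for i t
    proof -
      have "(\<lambda>x. x i) \<in> ?S \<rightarrow>\<^sub>M path_space cadlag" by (rule measurable_component_singleton) simp
      from measurable_compose[OF measurable_compose[OF measurable_fst this] measurable_path_space_eval[OF that]]
      show ?thesis .
    qed
    show "(\<lambda>z. snd z (u * t)) \<in> borel_measurable (?S \<Otimes>\<^sub>M ?T)" if "t \<ge> 0" for t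
      by (rule measurable_compose[OF measurable_snd measurable_path_space_eval]) (use that u in simp)
  qed (rule q)
  then show ?thesis by simp
qed

theorem theorem2p7:
  fixes M :: "'a measure"
    and \<alpha> lam :: real
    and p :: "'k::finite \<Rightarrow> real"
    and N :: "'k \<Rightarrow> real \<Rightarrow> 'a \<Rightarrow> nat"
    and B :: "'k \<Rightarrow> real \<Rightarrow> 'a \<Rightarrow> real"
    and Y :: "real \<Rightarrow> 'a \<Rightarrow> real"
  assumes "prob_space M"
    and "0 < \<alpha>" "\<alpha> \<le> 1" "0 < lam"
    and "\<And>i. 0 < p i" "(\<Sum>i\<in>UNIV. p i) = 1"
    and "\<And>i. poisson_process M (lam powr \<alpha>) (N i)"
    and "inverse_stable_subordinator M \<alpha> Y"
    and "independent_processes M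
           (\<lambda>j. case j of None \<Rightarrow> Y | Some i \<Rightarrow> (\<lambda>t \<omega>. real (N i t \<omega>)))"
    and "\<And>i. standard_brownian_motion M (B i)"
    and "independent_processes M (\<lambda>j. case j of None \<Rightarrow> Y | Some i \<Rightarrow> B i)"
  shows "converges_in_distribution_J1 M
           (\<lambda>u t \<omega>. (\<chi> i. (real (N i (p i * Y (u * t) \<omega>) \<omega>)
                             - p i * lam powr \<alpha> * Y (u * t) \<omega>) / u powr (\<alpha> / 2)) :: real ^ 'k)
           (\<lambda>t \<omega>. (\<chi> i. B i (p i * lam powr \<alpha> * Y t \<omega>) \<omega>))
           at_top"
proof -
  interpret prob_space M by fact
  note M = assms(1)
  define \<mu> where "\<mu> = lam powr \<alpha>"
  have \<mu>: "\<mu> > 0" using assms(4) by (simp add: \<mu>_def)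
  have p: "p i \<ge> 0" for i using assms(5)[of i] by simp
  define X where "X i t \<omega> = real (N i t \<omega>)" for i t \<omega>
  have Xlevy: "levy_process M (X i)" for i
    using assms(7)[of i] unfolding poisson_process_def X_def by simp
  have Blevy: "levy_process M (B i)" for i
    using assms(10)[of i] unfolding standard_brownian_motion_def by simp
  have Xm: "X i t \<in> borel_measurable M" and Bm: "B i t \<in> borel_measurable M" if "t \<ge> 0" for i t
    using levy_process_measurable[OF Xlevy that] levy_process_measurable[OF Blevy that] .
  have indX: "independent_processes M (\<lambda>j. case j of None \<Rightarrow> Y | Some i \<Rightarrow> X i)"
    using assms(9) unfolding X_def .
  have Ym: "Y t \<in> borel_measurable M" if "t \<ge> 0" for t
  proof -
    have "(\<lambda>\<omega>. \<lambda>t\<in>{0..}. Y t \<omega>) \<in> M \<rightarrow>\<^sub>M PiM {0..} (\<lambda>_. borel)"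
      using indX unfolding independent_processes_def indep_vars_def by (auto dest!: spec[where x = None])
    from measurable_compose[OF this measurable_component_singleton[of t]] show ?thesis using that by simp
  qed
  define good where "good \<omega> \<longleftrightarrow> (\<forall>i. cadlag (\<lambda>t. X i t \<omega>) \<and> X i 0 \<omega> = 0) \<and>
    (\<forall>i. continuous_on {0..} (\<lambda>t. B i t \<omega>) \<and> B i 0 \<omega> = 0) \<and> clock (\<lambda>t. Y t \<omega>)" for \<omega>
  have "AE \<omega> in M. good \<omega>"
    unfolding good_def
  proof (intro AE_conjI)
    have "AE \<omega> in M. cadlag (\<lambda>t. X i t \<omega>) \<and> X i 0 \<omega> = 0" for i
      using Xlevy[of i] by (simp add: levy_process_def)
    then show "AE \<omega> in M. \<forall>i. cadlag (\<lambda>t. X i t \<omega>) \<and> X i 0 \<omega> = 0"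
      by (subst AE_all_countable) simp
    have "AE \<omega> in M. continuous_on {0..} (\<lambda>t. B i t \<omega>) \<and> B i 0 \<omega> = 0" for i
      using assms(10)[of i] Blevy[of i] by (simp add: levy_process_def standard_brownian_motion_def)
    then show "AE \<omega> in M. \<forall>i. continuous_on {0..} (\<lambda>t. B i t \<omega>) \<and> B i 0 \<omega> = 0"
      by (subst AE_all_countable) simp
    show "AE \<omega> in M. clock (\<lambda>t. Y t \<omega>)"
      using inverse_stable_subordinator_clock[OF M assms(8)] .
  qed
  then obtain Z where Z: "\<And>\<omega>. \<omega> \<in> space M - Z \<Longrightarrow> good \<omega>" "Z \<in> null_sets M" by (rule AE_E3) blast
  have Zs: "Z \<in> sets M" using Z(2) by auto
  have AEZ: "AE \<omega> in M. \<omega> \<notin> Z" using Z(2) by (rule AE_not_in)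
  \<comment> \<open>On the null set all paths become 0, which is continuous and a clock, so the path
    properties hold at every outcome.\<close>
  define X' where "X' i t \<omega> = (if \<omega> \<in> Z then 0 else X i t \<omega>)" for i t \<omega>
  define B' where "B' i t \<omega> = (if \<omega> \<in> Z then 0 else B i t \<omega>)" for i t \<omega>
  define Y' where "Y' t \<omega> = (if \<omega> \<in> Z then 0 else Y t \<omega>)" for t \<omega>
  have X'm: "X' i t \<in> borel_measurable M" and B'm: "B' i t \<in> borel_measurable M" and Y'm: "Y' t \<in> borel_measurable M"
    if "t \<ge> 0" for i t
    unfolding X'_def B'_def Y'_def using Zs Xm[OF that] Bm[OF that] Ym[OF that]
    by (auto intro!: measurable_If_set)
  have AEX: "AE \<omega> in M. \<forall>t\<ge>0. X i t \<omega> = X' i t \<omega>" and AEB: "AE \<omega> in M. \<forall>t\<ge>0. B i t \<omega> = B' i t \<omega>"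
    and AEY: "AE \<omega> in M. \<forall>t\<ge>0. Y t \<omega> = Y' t \<omega>" for i
    using AEZ by (eventually_elim, simp add: X'_def B'_def Y'_def)+
  have X'path: "cadlag (\<lambda>t. X' i t \<omega>) \<and> X' i 0 \<omega> = 0" and B'path: "continuous_on {0..} (\<lambda>t. B' i t \<omega>) \<and> B' i 0 \<omega> = 0"
    and Y'clock: "clock (\<lambda>t. Y' t \<omega>)" if "\<omega> \<in> space M" for i \<omega>
    using Z(1)[of \<omega>] that by (auto simp: good_def X'_def B'_def Y'_def cadlag_const clock_def mono_on_def)
  have indX': "independent_processes M (\<lambda>j. case j of None \<Rightarrow> Y' | Some i \<Rightarrow> X' i)"
    by (rule independent_processes_cong_AE[OF M indX]) (use AEX AEY X'm Y'm in \<open>auto split: option.split\<close>)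
  have indB': "independent_processes M (\<lambda>j. case j of None \<Rightarrow> Y' | Some i \<Rightarrow> B' i)"
    by (rule independent_processes_cong_AE[OF M assms(11)]) (use AEB AEY B'm Y'm in \<open>auto split: option.split\<close>)
  have sub: "independent_processes M F" if "independent_processes M (\<lambda>j. case j of None \<Rightarrow> Y' | Some i \<Rightarrow> F i)"
    for F :: "'k \<Rightarrow> real \<Rightarrow> 'a \<Rightarrow> real"
    using indep_vars_reindex[OF indep_vars_subset[OF that[unfolded independent_processes_def], of "range Some"]]
    by (simp add: independent_processes_def)
  have X'levy: "levy_process M (X' i)" for i
    by (rule levy_process_cong_AE[OF M Xlevy AEX X'm])
  have B'levy: "levy_process M (B' i)" for i
    by (rule levy_process_cong_AE[OF M Blevy AEB B'm])
  have X'law: "distr M borel (X' i t) = distr (measure_pmf (poisson_pmf (\<mu> * t))) borel real" if t: "t > 0" for i t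
  proof -
    have pmf: "distr M (count_space UNIV) (N i t) = measure_pmf (poisson_pmf (\<mu> * t))"
      using assms(7)[of i] t by (simp add: poisson_process_def \<mu>_def)
    have "N i t \<in> M \<rightarrow>\<^sub>M count_space UNIV"
    proof -
      have [measurable]: "X i t \<in> borel_measurable M" using Xm t by simp
      have "(\<lambda>\<omega>. nat \<lfloor>X i t \<omega>\<rfloor>) \<in> M \<rightarrow>\<^sub>M count_space UNIV" by measurable
      then show ?thesis by (simp add: X_def)
    qed
    then have "distr (distr M (count_space UNIV) (N i t)) borel real = distr M borel (X i t)"
      by (subst distr_distr) (auto simp: o_def X_def[abs_def])
    moreover have "distr M borel (X i t) = distr M borel (X' i t)"
    proof (rule distr_cong_AE)
      show "AE \<omega> in M. X i t \<omega> = X' i t \<omega>" using AEX[of i] by eventually_elim (use t in auto)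
    qed (use Xm[of t i] X'm[of t i] t in auto)
    ultimately show ?thesis unfolding pmf by simp
  qed
  have B'law: "distributed M lborel (B' i t) (\<lambda>x. ennreal (normal_density 0 (sqrt t) x))" if t: "t > 0" for i t
  proof -
    have d: "distributed M lborel (B i t) (\<lambda>x. ennreal (normal_density 0 (sqrt t) x))"
      using assms(10)[of i] t by (simp add: standard_brownian_motion_def)
    have "distr M lborel (B' i t) = distr M lborel (B i t)"
    proof (rule distr_cong_AE)
      show "AE \<omega> in M. B' i t \<omega> = B i t \<omega>" using AEB[of i] by eventually_elim (use t in auto)
    qed (use Bm[of t i] B'm[of t i] t in auto)
    then show ?thesis using d B'm[of t i] t by (simp add: distributed_def)
  qed
  have scaling: "distr M (path_space clock) (\<lambda>\<omega>. \<lambda>t\<in>{0..}. Y' (u * t) \<omega>) =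
      distr M (path_space clock) (\<lambda>\<omega>. \<lambda>t\<in>{0..}. u powr \<alpha> * Y' t \<omega>)" if u: "u > 0" for u
    unfolding path_space_def
  proof (rule distr_restrict_space_eq)
    let ?P = "PiM {0::real..} (\<lambda>_. borel :: real measure)"
    show m1: "(\<lambda>\<omega>. \<lambda>t\<in>{0..}. Y' (u * t) \<omega>) \<in> M \<rightarrow>\<^sub>M ?P"
      by (intro measurable_restrict Y'm) (use u in auto)
    show m2: "(\<lambda>\<omega>. \<lambda>t\<in>{0..}. u powr \<alpha> * Y' t \<omega>) \<in> M \<rightarrow>\<^sub>M ?P"
      by (intro measurable_restrict borel_measurable_times borel_measurable_const Y'm) auto
    show "(\<lambda>\<omega>. \<lambda>t\<in>{0..}. Y' (u * t) \<omega>) \<in> space M \<rightarrow> {x. clock x}"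
      using clock_scale[OF Y'clock, of _ 1 u] u by (auto intro!: clock_restrict)
    show "(\<lambda>\<omega>. \<lambda>t\<in>{0..}. u powr \<alpha> * Y' t \<omega>) \<in> space M \<rightarrow> {x. clock x}"
      using clock_mult[OF Y'clock, of _ "u powr \<alpha>"] by (auto intro!: clock_restrict)
    have o1: "(\<lambda>\<omega>. \<lambda>t\<in>{0..}. Y (u * t) \<omega>) \<in> M \<rightarrow>\<^sub>M ?P"
      by (intro measurable_restrict Ym) (use u in auto)
    have o2: "(\<lambda>\<omega>. \<lambda>t\<in>{0..}. u powr \<alpha> * Y t \<omega>) \<in> M \<rightarrow>\<^sub>M ?P"
      by (intro measurable_restrict borel_measurable_times borel_measurable_const Ym) auto
    have e1: "AE \<omega> in M. (\<lambda>t\<in>{0..}. Y' (u * t) \<omega>) = (\<lambda>t\<in>{0..}. Y (u * t) \<omega>)"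
      using AEY by eventually_elim (use u in \<open>auto intro!: restrict_ext\<close>)
    have e2: "AE \<omega> in M. (\<lambda>t\<in>{0..}. u powr \<alpha> * Y t \<omega>) = (\<lambda>t\<in>{0..}. u powr \<alpha> * Y' t \<omega>)"
      using AEY by eventually_elim (auto intro!: restrict_ext)
    show "distr M ?P (\<lambda>\<omega>. \<lambda>t\<in>{0..}. Y' (u * t) \<omega>) = distr M ?P (\<lambda>\<omega>. \<lambda>t\<in>{0..}. u powr \<alpha> * Y' t \<omega>)"
      using distr_cong_AE[OF refl refl e1 m1 o1] distr_cong_AE[OF refl refl e2 o2 m2]
        inverse_stable_subordinator_scaling[OF M assms(2) u assms(8) Ym] by simp
  qed
  \<comment> \<open>Everywhere D-valued representatives, equal to the given paths off the null
    set.\<close>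
  define Zu where "Zu u \<omega> = scaled_path \<mu> (u powr (\<alpha> / 2)) p (\<lambda>i t. X' i t \<omega>) (\<lambda>t. Y' (u * t) \<omega>)" for u \<omega>
  define Z0 where "Z0 \<omega> = scaled_path 0 1 (\<lambda>i. p i * \<mu>) (\<lambda>i t. B' i t \<omega>) (\<lambda>t. Y' t \<omega>)" for \<omega>
  have B'cad: "cadlag (\<lambda>t. B' i t \<omega>)" if "\<omega> \<in> space M" for i \<omega>
    using B'path[OF that] by (intro continuous_cadlag) auto
  have Zu_meas: "Zu u \<in> M \<rightarrow>\<^sub>M borel_of skorokhod_J1" if u: "u > 0" for u
    unfolding Zu_def
  proof (rule scaled_path_measurable)
    show "clock (\<lambda>t. Y' (u * t) \<omega>)" if "\<omega> \<in> space M" for \<omega>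
      using clock_scale[OF Y'clock[OF that], of 1 u] u by simp
    show "Y' (u * t) \<in> borel_measurable M" if "t \<ge> 0" for t using that u by (intro Y'm) simp
  qed (use X'path X'm p in auto)
  have Z0_meas: "Z0 \<in> M \<rightarrow>\<^sub>M borel_of skorokhod_J1"
    unfolding Z0_def by (rule scaled_path_measurable) (use B'cad B'm Y'clock Y'm p \<mu> in auto)
  have Zu_path: "path_element M (\<lambda>t \<omega>. (\<chi> i. (real (N i (p i * Y (u * t) \<omega>) \<omega>)
      - p i * lam powr \<alpha> * Y (u * t) \<omega>) / u powr (\<alpha> / 2)) :: real ^ 'k) (Zu u)" if u: "u > 0" for u
    unfolding path_element_def
  proof
    show "Zu u \<in> M \<rightarrow>\<^sub>M borel_of skorokhod_J1" using Zu_meas[OF u] .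
    show "AE \<omega> in M. Zu u \<omega> = (\<lambda>t\<in>{0..}. (\<chi> i. (real (N i (p i * Y (u * t) \<omega>) \<omega>)
      - p i * lam powr \<alpha> * Y (u * t) \<omega>) / u powr (\<alpha> / 2)))"
      using AEZ by eventually_elim (simp add: Zu_def scaled_path_def X'_def Y'_def X_def \<mu>_def mult_ac)
  qed
  have Z0_path: "path_element M (\<lambda>t \<omega>. (\<chi> i. B i (p i * lam powr \<alpha> * Y t \<omega>) \<omega>) :: real ^ 'k) Z0"
    unfolding path_element_def
  proof
    show "Z0 \<in> M \<rightarrow>\<^sub>M borel_of skorokhod_J1" using Z0_meas .
    show "AE \<omega> in M. Z0 \<omega> = (\<lambda>t\<in>{0..}. (\<chi> i. B i (p i * lam powr \<alpha> * Y t \<omega>) \<omega>))"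
      using AEZ by eventually_elim (simp add: Z0_def scaled_path_def B'_def Y'_def \<mu>_def mult_ac)
  qed
  have conv: "((\<lambda>u. \<integral>\<omega>. f (Zu u \<omega>) \<partial>M) \<longlongrightarrow> (\<integral>\<omega>. f (Z0 \<omega>) \<partial>M)) at_top"
    if f: "continuous_map skorokhod_J1 euclideanreal f" and bd: "bounded (f ` topspace skorokhod_J1)"
    for f :: "(real \<Rightarrow> real ^ 'k) \<Rightarrow> real"
  proof (rule tendsto_at_topI_sequentially)
    obtain C where C: "\<And>x. x \<in> skorokhod_space \<Longrightarrow> \<bar>f x\<bar> \<le> C"
      using bd unfolding bounded_iff topspace_skorokhod_J1 by auto
    have fm: "f \<in> borel_measurable (borel_of skorokhod_J1)" using f by (rule continuous_map_borel_of)
    have Y'r: "clock (\<lambda>t\<in>{0..}. Y' t \<omega>)" if "\<omega> \<in> space M" for \<omega>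
      using Y'clock[OF that] by (rule clock_restrict)
    let ?ST = "PiM (UNIV :: 'k set) (\<lambda>_. path_space cadlag) \<Otimes>\<^sub>M path_space clock"
    define \<Phi> where "\<Phi> a d q u z = f (scaled_path a d q (fst z) (\<lambda>t. snd z (u * t)))"
      for a d q u and z :: "('k \<Rightarrow> real \<Rightarrow> real) \<times> (real \<Rightarrow> real)"
    have \<Phi>m: "\<Phi> a d q u \<in> borel_measurable ?ST" if "\<And>i. q i \<ge> 0" "u > 0" for a d q u
      unfolding \<Phi>_def by (rule measurable_compose[OF path_space_scaled_path_measurable[OF that] fm])
    have \<Phi>b: "\<bar>\<Phi> a d q u z\<bar> \<le> C" if q: "\<And>i. q i \<ge> 0" and u: "u > 0" and z: "z \<in> space ?ST" for a d q u z
    proof -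
      have "scaled_path a d q (fst z) (\<lambda>t. snd z (u * t)) \<in> space (borel_of skorokhod_J1)"
        using measurable_space[OF path_space_scaled_path_measurable[OF q u] z] .
      then show ?thesis unfolding \<Phi>_def
        by (intro C) (simp add: borel_of_def space_measure_of_conv topspace_skorokhod_J1)
    qed
    have \<Phi>p: "\<Phi> a d q u (\<lambda>i. \<lambda>t\<in>{0..}. F i t, \<lambda>t\<in>{0..}. y t) = f (scaled_path a d q F (\<lambda>t. y (u * t)))"
      if q: "\<And>i. q i \<ge> 0" and u: "u > 0" and y: "clock y" for a d q u F y
    proof -
      have "scaled_path a d q F (\<lambda>t. y (u * t)) = scaled_path a d q (\<lambda>i. \<lambda>t\<in>{0..}. F i t) (\<lambda>t. (\<lambda>t\<in>{0..}. y t) (u * t))"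
        using q u clock_nonneg[OF y] by (intro scaled_path_cong) auto
      then show ?thesis by (simp add: \<Phi>_def)
    qed
    \<comment> \<open>Expectation over the driving processes with the clock frozen at
      \<open>y\<close>; the parameter \<open>u\<close> of \<open>\<Phi>\<close> is 1 since the
      scaling is put into \<open>y\<close>.\<close>
    define G where "G a d q F y = (\<integral>\<omega>. \<Phi> a d q 1 (\<lambda>i. \<lambda>t\<in>{0..}. F i t \<omega>, y) \<partial>M)"
      for a d q and F :: "'k \<Rightarrow> real \<Rightarrow> 'a \<Rightarrow> real" and y
    have GF: "G a d q F (\<lambda>t\<in>{0..}. y t) = (\<integral>\<omega>. f (scaled_path a d q (\<lambda>i t. F i t \<omega>) y) \<partial>M)"
      if "clock y" "\<And>i. q i \<ge> 0" for a d q F y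
      unfolding G_def by (subst \<Phi>p) (use that in auto)
    have Gb: "\<bar>G a d q F (\<lambda>t\<in>{0..}. y t)\<bar> \<le> C"
      if y: "clock y" and q: "\<And>i. q i \<ge> 0" and F: "\<And>i \<omega>. \<omega> \<in> space M \<Longrightarrow> cadlag (\<lambda>t. F i t \<omega>)" for a d q F y
      unfolding GF[OF y q]
      by (rule abs_expectation_le) (use F y q in \<open>auto intro!: C scaled_path_in_skorokhod_space\<close>)
    have Gm: "G a d q F \<in> borel_measurable (path_space clock)" (is ?m)
      and dec: "(\<integral>\<omega>. f (scaled_path a d q (\<lambda>i t. F i t \<omega>) (\<lambda>t. Y' (u * t) \<omega>)) \<partial>M) = (\<integral>\<omega>'. G a d q F (\<lambda>t\<in>{0..}. Y' (u * t) \<omega>') \<partial>M)" (is ?d)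
      if q: "\<And>i. q i \<ge> 0" and u: "u > 0" and ind: "independent_processes M (\<lambda>j. case j of None \<Rightarrow> Y' | Some i \<Rightarrow> F i)"
        and F: "\<And>i \<omega>. \<omega> \<in> space M \<Longrightarrow> cadlag (\<lambda>t. F i t \<omega>)" for a d q u F
    proof -
      have Fr: "cadlag (\<lambda>t\<in>{0..}. F i t \<omega>)" if "\<omega> \<in> space M" for i \<omega>
        using F[OF that] cadlag_cong[of "\<lambda>t. F i t \<omega>" "\<lambda>t\<in>{0..}. F i t \<omega>"] by auto
      show ?m
        unfolding G_def
        by (rule decoupling(2)[where P = cadlag and Q = clock and C = C, OF M ind Fr Y'r \<Phi>m \<Phi>b]) (use q in auto)
      have "(\<integral>\<omega>. f (scaled_path a d q (\<lambda>i t. F i t \<omega>) (\<lambda>t. Y' (u * t) \<omega>)) \<partial>M)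
          = (\<integral>\<omega>. \<Phi> a d q u (\<lambda>i. \<lambda>t\<in>{0..}. F i t \<omega>, \<lambda>t\<in>{0..}. Y' t \<omega>) \<partial>M)"
        by (intro Bochner_Integration.integral_cong refl \<Phi>p[symmetric] q u Y'clock)
      also have "\<dots> = (\<integral>\<omega>'. (\<integral>\<omega>. \<Phi> a d q u (\<lambda>i. \<lambda>t\<in>{0..}. F i t \<omega>, \<lambda>t\<in>{0..}. Y' t \<omega>') \<partial>M) \<partial>M)"
        by (rule decoupling(1)[where P = cadlag and Q = clock and C = C, OF M ind Fr Y'r \<Phi>m \<Phi>b]) (use q u in auto)
      also have "\<dots> = (\<integral>\<omega>'. G a d q F (\<lambda>t\<in>{0..}. Y' (u * t) \<omega>') \<partial>M)"
      proof (intro Bochner_Integration.integral_cong refl)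
        fix \<omega>' assume \<omega>': "\<omega>' \<in> space M"
        have c: "clock (\<lambda>t. Y' (u * t) \<omega>')" using clock_scale[OF Y'clock[OF \<omega>'], of 1 u] u by simp
        show "(\<integral>\<omega>. \<Phi> a d q u (\<lambda>i. \<lambda>t\<in>{0..}. F i t \<omega>, \<lambda>t\<in>{0..}. Y' t \<omega>') \<partial>M) = G a d q F (\<lambda>t\<in>{0..}. Y' (u * t) \<omega>')"
          unfolding GF[OF c q]
          by (intro Bochner_Integration.integral_cong refl \<Phi>p q u Y'clock \<omega>')
      qed
      finally show ?d .
    qed
    have X'cad: "cadlag (\<lambda>t. X' i t \<omega>)" if "\<omega> \<in> space M" for i \<omega> using X'path[OF that] by blast
    have path_meas: "(\<lambda>\<omega>. \<lambda>t\<in>{0..}. a * Y' (u * t) \<omega>) \<in> M \<rightarrow>\<^sub>M path_space clock" if "a \<ge> 0" "u > 0" for a u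
      unfolding path_space_def
    proof (rule measurable_restrict_space2)
      show "(\<lambda>\<omega>. \<lambda>t\<in>{0..}. a * Y' (u * t) \<omega>) \<in> space M \<rightarrow> {x. clock x}"
        using clock_scale[OF Y'clock that] by (auto intro!: clock_restrict)
      show "(\<lambda>\<omega>. \<lambda>t\<in>{0..}. a * Y' (u * t) \<omega>) \<in> M \<rightarrow>\<^sub>M PiM {0..} (\<lambda>_. borel)"
        by (intro measurable_restrict borel_measurable_times borel_measurable_const Y'm) (use that in auto)
    qed
    \<comment> \<open>After decoupling only the law of the clock counts, so
      \<open>Y' (u * t)\<close> is replaced by \<open>u powr \<alpha> * Y' t\<close>. From here on
      one and the same clock serves all \<open>u\<close>.\<close>
    have EZu: "(\<integral>\<omega>. f (Zu u \<omega>) \<partial>M) = (\<integral>\<omega>'. G \<mu> (sqrt (u powr \<alpha>)) p X' (\<lambda>t\<in>{0..}. u powr \<alpha> * Y' t \<omega>') \<partial>M)" if u: "u > 0" for u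
    proof -
      let ?G = "G \<mu> (sqrt (u powr \<alpha>)) p X'"
      note Gm' = Gm[OF p u indX' X'cad]
      have pm1: "(\<lambda>\<omega>. \<lambda>t\<in>{0..}. Y' (u * t) \<omega>) \<in> M \<rightarrow>\<^sub>M path_space clock"
        using path_meas[of 1 u] u by simp
      have pm2: "(\<lambda>\<omega>. \<lambda>t\<in>{0..}. u powr \<alpha> * Y' t \<omega>) \<in> M \<rightarrow>\<^sub>M path_space clock"
        using path_meas[of "u powr \<alpha>" 1] by simp
      have "(\<integral>\<omega>. f (Zu u \<omega>) \<partial>M) = (\<integral>\<omega>'. ?G (\<lambda>t\<in>{0..}. Y' (u * t) \<omega>') \<partial>M)"
        unfolding Zu_def using u by (subst dec[OF p u indX' X'cad]) (auto simp: powr_half_sqrt_powr)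
      also have "\<dots> = (\<integral>y. ?G y \<partial>distr M (path_space clock) (\<lambda>\<omega>. \<lambda>t\<in>{0..}. Y' (u * t) \<omega>))"
        by (rule integral_distr[OF pm1 Gm', symmetric])
      also have "\<dots> = (\<integral>\<omega>'. ?G (\<lambda>t\<in>{0..}. u powr \<alpha> * Y' t \<omega>') \<partial>M)"
        unfolding scaling[OF u] by (rule integral_distr[OF pm2 Gm'])
      finally show ?thesis .
    qed
    have p\<mu>: "p i * \<mu> \<ge> 0" for i using p \<mu> by simp
    have EZ0: "(\<integral>\<omega>. f (Z0 \<omega>) \<partial>M) = (\<integral>\<omega>'. G 0 1 (\<lambda>i. p i * \<mu>) B' (\<lambda>t\<in>{0..}. Y' t \<omega>') \<partial>M)"
      unfolding Z0_def using dec[OF p\<mu> zero_less_one indB' B'cad, of 0 1] by simp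
    fix U :: "nat \<Rightarrow> real" assume U: "filterlim U at_top sequentially"
    \<comment> \<open>Positive for every \<open>n\<close>, and equal to \<open>U n\<close> from some
      index on.\<close>
    define V where "V n = max 1 (U n)" for n
    define c where "c n = V n powr \<alpha>" for n
    have V: "V n > 0" for n by (simp add: V_def)
    have cpos: "c n > 0" for n using V[of n] by (simp add: c_def)
    have "filterlim V at_top sequentially"
      using U by (rule filterlim_at_top_mono) (simp add: V_def)
    then have "filterlim (\<lambda>n. exp (\<alpha> * ln (V n))) at_top sequentially"
      by (intro filterlim_compose[OF exp_at_top] filterlim_tendsto_pos_mult_at_top[OF tendsto_const assms(2)]
          filterlim_compose[OF ln_at_top])
    moreover have "exp (\<alpha> * ln (V n)) = c n" for n using V[of n] by (simp add: c_def powr_def)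
    ultimately have ctop: "filterlim c at_top sequentially" by simp
    have "(\<lambda>n. \<integral>\<omega>'. G \<mu> (sqrt (c n)) p X' (\<lambda>t\<in>{0..}. c n * Y' t \<omega>') \<partial>M)
        \<longlonglongrightarrow> (\<integral>\<omega>'. G 0 1 (\<lambda>i. p i * \<mu>) B' (\<lambda>t\<in>{0..}. Y' t \<omega>') \<partial>M)"
    proof (rule integral_dominated_convergence[where w = "\<lambda>_. C"])
      show "(\<lambda>\<omega>'. G 0 1 (\<lambda>i. p i * \<mu>) B' (\<lambda>t\<in>{0..}. Y' t \<omega>')) \<in> borel_measurable M"
        using measurable_compose[OF path_meas[OF zero_le_one zero_less_one] Gm[OF p\<mu> zero_less_one indB' B'cad]] by simp
      show "(\<lambda>\<omega>'. G \<mu> (sqrt (c n)) p X' (\<lambda>t\<in>{0..}. c n * Y' t \<omega>')) \<in> borel_measurable M" for n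
        using measurable_compose[OF path_meas[OF less_imp_le[OF cpos] zero_less_one] Gm[OF p zero_less_one indX' X'cad]] by simp
      show "AE \<omega>' in M. norm (G \<mu> (sqrt (c n)) p X' (\<lambda>t\<in>{0..}. c n * Y' t \<omega>')) \<le> C" for n
        unfolding real_norm_def
        by (intro AE_I2 Gb clock_mult Y'clock p X'cad less_imp_le[OF cpos])
      show "AE \<omega>' in M. (\<lambda>n. G \<mu> (sqrt (c n)) p X' (\<lambda>t\<in>{0..}. c n * Y' t \<omega>'))
          \<longlonglongrightarrow> G 0 1 (\<lambda>i. p i * \<mu>) B' (\<lambda>t\<in>{0..}. Y' t \<omega>')"
      \<comment> \<open>For each outcome of the clock this is the deterministic-clock
        theorem.\<close>
      proof (rule AE_I2)
        fix \<omega>' assume \<omega>': "\<omega>' \<in> space M"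
        have y: "clock (\<lambda>t. Y' t \<omega>')" using Y'clock[OF \<omega>'] .
        have "clock (\<lambda>t. c n * Y' t \<omega>')" for n using y cpos[of n] by (intro clock_mult) auto
        note g1 = GF[OF this p] and g2 = GF[OF y p\<mu>]
        show "(\<lambda>n. G \<mu> (sqrt (c n)) p X' (\<lambda>t\<in>{0..}. c n * Y' t \<omega>'))
          \<longlonglongrightarrow> G 0 1 (\<lambda>i. p i * \<mu>) B' (\<lambda>t\<in>{0..}. Y' t \<omega>')"
          unfolding g1 g2
          by (rule poisson_brownian_convergence[OF M \<mu> p X'levy sub[OF indX'] X'path X'law B'levy sub[OF indB'] B'path B'law ctop cpos y f C])
      qed
    qed simp
    then have "(\<lambda>n. \<integral>\<omega>. f (Zu (V n) \<omega>) \<partial>M) \<longlonglongrightarrow> (\<integral>\<omega>. f (Z0 \<omega>) \<partial>M)"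
      unfolding EZu[OF V] EZ0 c_def .
    moreover have "\<forall>\<^sub>F n in sequentially. (\<integral>\<omega>. f (Zu (V n) \<omega>) \<partial>M) = (\<integral>\<omega>. f (Zu (U n) \<omega>) \<partial>M)"
      using U[unfolded filterlim_at_top, rule_format, of 1] by eventually_elim (simp add: V_def max_def)
    ultimately show "(\<lambda>n. \<integral>\<omega>. f (Zu (U n) \<omega>) \<partial>M) \<longlonglongrightarrow> (\<integral>\<omega>. f (Z0 \<omega>) \<partial>M)"
      by (rule Lim_transform_eventually)
  qed
  show ?thesis
    unfolding converges_in_distribution_J1_def
  proof (intro exI conjI)
    show "\<forall>\<^sub>F u in at_top. path_element M (\<lambda>t \<omega>. (\<chi> i. (real (N i (p i * Y (u * t) \<omega>) \<omega>)
      - p i * lam powr \<alpha> * Y (u * t) \<omega>) / u powr (\<alpha> / 2)) :: real ^ 'k) (Zu u)"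
      using eventually_gt_at_top[of 0] by eventually_elim (rule Zu_path)
    show "path_element M (\<lambda>t \<omega>. (\<chi> i. B i (p i * lam powr \<alpha> * Y t \<omega>) \<omega>) :: real ^ 'k) Z0" by (rule Z0_path)
    show "weakly_converges skorokhod_J1 (\<lambda>u. distr M (borel_of skorokhod_J1) (Zu u)) (distr M (borel_of skorokhod_J1) Z0) at_top"
      unfolding weakly_converges_def
    proof (intro allI impI)
      fix f :: "(real \<Rightarrow> real ^ 'k) \<Rightarrow> real"
      assume f: "continuous_map skorokhod_J1 euclideanreal f \<and> bounded (f ` topspace skorokhod_J1)"
      then have fm: "f \<in> borel_measurable (borel_of skorokhod_J1)" by (intro continuous_map_borel_of) simp
      have "\<forall>\<^sub>F u in at_top. (\<integral>\<omega>. f (Zu u \<omega>) \<partial>M) = integral\<^sup>L (distr M (borel_of skorokhod_J1) (Zu u)) f"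
        using eventually_gt_at_top[of 0] by eventually_elim (rule integral_distr[symmetric, OF Zu_meas fm])
      then have "((\<lambda>u. integral\<^sup>L (distr M (borel_of skorokhod_J1) (Zu u)) f) \<longlongrightarrow> (\<integral>\<omega>. f (Z0 \<omega>) \<partial>M)) at_top"
        using conv f by (intro Lim_transform_eventually[OF conv]) auto
      then show "((\<lambda>u. integral\<^sup>L (distr M (borel_of skorokhod_J1) (Zu u)) f) \<longlongrightarrow>
          integral\<^sup>L (distr M (borel_of skorokhod_J1) Z0) f) at_top"
        by (simp add: integral_distr[OF Z0_meas fm])
    qed
  qed
qed

end
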